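(* Let $p\ge 5$ be a prime, let $H$ be a proper subgroup of $\mathrm{SL}(2,p)$, let $x\in \mathrm{SL}(2,p)$ with $\langle H,x\rangle=\mathrm{SL}(2,p)$, and let $S$ be either the subgroup-plus-two subset $H\cup\{x,x^{-1}\}$ or, when $x^2\in H$, the subgroup plus coset core $H\cup(xH\cap Hx)$; suppose $\langle S\rangle=\mathrm{SL}(2,p)$. Then $$|S^3|\ge |S|^{1+\delta}\quad\text{for}\quad \delta=\frac{\log_2(7)-1}{6}.$$ Moreover, $|S^3|=|S|^{1+\delta}$ for this $\delta$ if and only if $H\cong 2\cdot\mathrm{S}_4$, $x^2\in H$, $[H:x^{-1}Hx\cap H]=3$ and $S=H\cup(xH\cap Hx)$. In particular, subgroup-plus-two subsets never attain equality, and so do not attain the smallest possible value of $\log|S^3|/\log|S|-1$.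
   Context: For a subset $S$ of a group, $S^3=\{abc: a,b,c\in S\}$. For a proper subgroup $H$ of $\mathrm{SL}(2,p)$ and $x\in\mathrm{SL}(2,p)$ with $\langle H,x\rangle=\mathrm{SL}(2,p)$, the set $H\cup\{x,x^{-1}\}$ is called a subgroup-plus-two subset; if moreover $x^2\in H$, the set $H\cup(xH\cap Hx)$ is called a subgroup plus coset core. Here $2\cdot\mathrm{S}_4$ denotes the binary octahedral group of order 48, i.e. the double cover of $\mathrm{S}_4$ occurring as the full preimage in $\mathrm{SL}(2,p)$ of a subgroup $\mathrm{S}_4$ of $\mathrm{PSL}(2,p)$. *)

theory Defs
  imports
    "HOL-Analysis.Determinants"
    "HOL-Number_Theory.Cong"
    "HOL-Algebra.Sym_Groups"
begin

text \<open>
  The field of \<open>p\<close> elements is represented by the residues \<open>0, \<dots>, p - 1\<close>, so that \<open>p\<close> can be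
  quantified over; matrix entries are reduced modulo \<open>p\<close> after each multiplication.
\<close>

definition reduce_mod :: "nat \<Rightarrow> int^2^2 \<Rightarrow> int^2^2" where
  "reduce_mod p = map_matrix (\<lambda>a. a mod int p)"

definition SL2 :: "nat \<Rightarrow> (int^2^2) monoid" where
  "SL2 p = \<lparr>carrier = {A. (\<forall>i j. A $ i $ j \<in> {0..<int p}) \<and> [det A = 1] (mod int p)},
            mult = (\<lambda>A B. reduce_mod p (A ** B)),
            one = mat 1\<rparr>"

lemma reduce_mod_mult_left: "reduce_mod p (reduce_mod p A ** B) = reduce_mod p (A ** B)"
  unfolding reduce_mod_def vec_eq_iff matrix_matrix_mult_def sum_2
  by (simp flip: cong_def) (intro allI cong_add cong_mult; simp add: cong_def)

lemma reduce_mod_mult_right: "reduce_mod p (A ** reduce_mod p B) = reduce_mod p (A ** B)"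
  unfolding reduce_mod_def vec_eq_iff matrix_matrix_mult_def sum_2
  by (simp flip: cong_def) (intro allI cong_add cong_mult; simp add: cong_def)

lemma det_reduce_mod: "[det (reduce_mod p A) = det A] (mod int p)"
  unfolding reduce_mod_def det_2 nth_map_matrix
  by (intro cong_diff cong_mult; simp add: cong_def)

lemma group_SL2:
  assumes "p \<ge> 2"
  shows "group (SL2 p)"
proof (rule groupI)
  fix A B assume A: "A \<in> carrier (SL2 p)" and B: "B \<in> carrier (SL2 p)"
  have "[det (reduce_mod p (A ** B)) = det A * det B] (mod int p)"
    using det_reduce_mod[of p "A ** B"] by (simp add: det_mul)
  also have "[det A * det B = 1 * 1] (mod int p)"
    using A B by (intro cong_mult) (auto simp: SL2_def)
  finally show "A \<otimes>\<^bsub>SL2 p\<^esub> B \<in> carrier (SL2 p)"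
    using assms by (simp add: SL2_def) (simp add: reduce_mod_def)
next
  show "\<one>\<^bsub>SL2 p\<^esub> \<in> carrier (SL2 p)"
    using assms by (simp add: SL2_def det_I) (simp add: mat_def)
next
  fix A B C
  show "A \<otimes>\<^bsub>SL2 p\<^esub> B \<otimes>\<^bsub>SL2 p\<^esub> C = A \<otimes>\<^bsub>SL2 p\<^esub> (B \<otimes>\<^bsub>SL2 p\<^esub> C)"
    by (simp add: SL2_def reduce_mod_mult_left reduce_mod_mult_right matrix_mul_assoc)
next
  fix A assume "A \<in> carrier (SL2 p)"
  then show "\<one>\<^bsub>SL2 p\<^esub> \<otimes>\<^bsub>SL2 p\<^esub> A = A"
    by (simp add: SL2_def matrix_mul_lid) (simp add: reduce_mod_def vec_eq_iff)
next
  fix A assume A: "A \<in> carrier (SL2 p)"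
  define B :: "int^2^2" where
    "B = reduce_mod p (vector [vector [A$2$2, - (A$1$2)], vector [- (A$2$1), A$1$1]])"
  have B': "[det B = det A] (mod int p)"
    unfolding B_def by (rule cong_trans[OF det_reduce_mod]) (simp add: det_2 algebra_simps)
  have "B \<in> carrier (SL2 p)"
    using A assms cong_trans[OF B'] by (simp add: SL2_def) (simp add: B_def reduce_mod_def)
  moreover have "B \<otimes>\<^bsub>SL2 p\<^esub> A = \<one>\<^bsub>SL2 p\<^esub>"
    using A assms unfolding B_def
    by (simp add: SL2_def reduce_mod_mult_left)
       (simp add: reduce_mod_def vec_eq_iff forall_2 matrix_matrix_mult_def sum_2 mat_def det_2
          cong_def algebra_simps)
  ultimately show "\<exists>B\<in>carrier (SL2 p). B \<otimes>\<^bsub>SL2 p\<^esub> A = \<one>\<^bsub>SL2 p\<^esub>" by blast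
qed

definition group_centre :: "('a, 'b) monoid_scheme \<Rightarrow> 'a set" where
  "group_centre G = {z \<in> carrier G. \<forall>g\<in>carrier G. z \<otimes>\<^bsub>G\<^esub> g = g \<otimes>\<^bsub>G\<^esub> z}"

definition PSL2 :: "nat \<Rightarrow> (int^2^2) set monoid" where
  "PSL2 p = SL2 p Mod group_centre (SL2 p)"

definition PSL2_preimage :: "nat \<Rightarrow> (int^2^2) set set \<Rightarrow> (int^2^2) set" where
  "PSL2_preimage p K = {g \<in> carrier (SL2 p). group_centre (SL2 p) #>\<^bsub>SL2 p\<^esub> g \<in> K}"

text \<open>
  \<open>G\<close> is isomorphic to the binary octahedral group \<open>2 \<cdot> S\<^sub>4\<close>, i.e. to the full preimage in
  \<open>SL(2,p)\<close> of a subgroup \<open>S\<^sub>4\<close> of \<open>PSL(2,p)\<close>. For \<open>p \<ge> 5\<close> all such preimages are isomorphic.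
  If \<open>PSL(2,p)\<close> has no subgroup \<open>S\<^sub>4\<close>, then \<open>SL(2,p)\<close> has no subgroup \<open>2 \<cdot> S\<^sub>4\<close> either, and the
  predicate is false for every \<open>G\<close>.
\<close>

definition iso_2S4 :: "nat \<Rightarrow> ('a, 'b) monoid_scheme \<Rightarrow> bool" where
  "iso_2S4 p G \<longleftrightarrow> (\<exists>K. subgroup K (PSL2 p) \<and> PSL2 p\<lparr>carrier := K\<rparr> \<cong> sym_group 4 \<and>
     G \<cong> SL2 p\<lparr>carrier := PSL2_preimage p K\<rparr>)"

definition coset_core :: "('a, 'b) monoid_scheme \<Rightarrow> 'a set \<Rightarrow> 'a \<Rightarrow> 'a set" where
  "coset_core G H x = (x <#\<^bsub>G\<^esub> H) \<inter> (H #>\<^bsub>G\<^esub> x)"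

definition subgroup_plus_two :: "('a, 'b) monoid_scheme \<Rightarrow> 'a set \<Rightarrow> 'a \<Rightarrow> 'a set \<Rightarrow> bool" where
  "subgroup_plus_two G H x S \<longleftrightarrow>
     subgroup H G \<and> H \<noteq> carrier G \<and> x \<in> carrier G \<and> generate G (insert x H) = carrier G \<and>
     S = H \<union> {x, inv\<^bsub>G\<^esub> x}"

definition subgroup_plus_coset_core :: "('a, 'b) monoid_scheme \<Rightarrow> 'a set \<Rightarrow> 'a \<Rightarrow> 'a set \<Rightarrow> bool"
  where
  "subgroup_plus_coset_core G H x S \<longleftrightarrow>
     subgroup H G \<and> H \<noteq> carrier G \<and> x \<in> carrier G \<and> generate G (insert x H) = carrier G \<and>
     x [^]\<^bsub>G\<^esub> (2::nat) \<in> H \<and> S = H \<union> coset_core G H x"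

definition triple_product :: "('a, 'b) monoid_scheme \<Rightarrow> 'a set \<Rightarrow> 'a set" where
  "triple_product G S = S <#>\<^bsub>G\<^esub> S <#>\<^bsub>G\<^esub> S"

definition growth_exponent :: "('a, 'b) monoid_scheme \<Rightarrow> 'a set \<Rightarrow> real" where
  "growth_exponent G S = ln (real (card (triple_product G S))) / ln (real (card S)) - 1"

text \<open>All possible values of the growth exponent, over all primes \<open>p \<ge> 5\<close> and both types of sets.\<close>

definition growth_exponents :: "real set" where
  "growth_exponents = {growth_exponent (SL2 p) S | p H x S.
     prime p \<and> p \<ge> 5 \<and>
     (subgroup_plus_two (SL2 p) H x S \<or> subgroup_plus_coset_core (SL2 p) H x S) \<and>
     generate (SL2 p) S = carrier (SL2 p)}"

end

theory Submission
  imports Defs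
begin

text \<open>
  Write \<open>n\<close> for the order of \<open>H\<close>, \<open>K\<close> for the intersection of \<open>H\<close> with \<open>x^-1 H x\<close>, and \<open>k = n / |K|\<close>.
  The triple product contains the disjoint sets \<open>H\<close> and \<open>H x H\<close>, of sizes \<open>n\<close> and \<open>n k\<close>, so it has at
  least \<open>n (k + 1)\<close> elements. On the other side, \<open>|S| \<le> n + 2\<close> for a subgroup plus two, and for a
  subgroup plus coset core \<open>|S|\<close> is \<open>y = |K| (k + 1)\<close>, because the coset core is \<open>x K\<close>. Since
  \<open>7 ^ 8 < 2 ^ 23\<close>, the exponent \<open>1 + \<delta>\<close> is below \<open>21/16\<close>; and as \<open>n (k + 1) = y k\<close>, the strict
  inequality follows from \<open>y ^ 5 < k ^ 16\<close>. So the theorem asks for a polynomial bound of \<open>n\<close> in terms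
  of \<open>k\<close>, which is \<open>pair_cases\<close>; its numerical use is \<open>growth_inequality\<close>.

  The bound rests on Dickson's analysis of the subgroups of \<open>SL(2,p)\<close>, of which only the numerical part
  is needed. If \<open>H\<close> contains a noncentral element of trace 2 or -2, then \<open>H\<close> is conjugate to a group of
  triangular matrices, so \<open>n \<le> p\<^sup>2\<close>; and \<open>K\<close> misses the \<open>p\<close>-elements of \<open>H\<close>, so \<open>k \<ge> p\<close>. In all other
  cases the centralisers of the noncentral elements of \<open>H\<close> are abelian, meet in the centre or
  coincide, and have index at most 2 in their normalisers. Counting the noncentral elements of \<open>H\<close> by
  the conjugacy classes of these centralisers gives Klein's equation, and hence (\<open>dickson\<close>) either a
  normal abelian subgroup \<open>A\<close> of index at most 2, or order 12, 24 or 60 modulo the centre. In the first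
  case \<open>A\<close> and \<open>x^-1 A x\<close> share only central elements, since the centraliser of any other common element
  would be normalised by \<open>H\<close> and \<open>x\<close>, that is, by \<open>SL(2,p)\<close>; hence \<open>|K| \<le> 8\<close>. For order 60 the same
  analysis of \<open>K\<close> rules out \<open>k = 3\<close> and \<open>k = 4\<close>. For \<open>k = 2\<close> and \<open>x\<^sup>2 \<in> H\<close> the group \<open>K\<close> is normal
  in \<open>SL(2,p)\<close> and hence central; for a subgroup plus two, either \<open>H x^-1 H\<close> is a further double coset in
  the triple product, or \<open>x\<close> can be replaced by some \<open>x h\<close> with square in \<open>H\<close>.

  One case escapes: \<open>n = 48\<close>, \<open>k = 3\<close> and \<open>S\<close> the subgroup plus coset core. Then \<open>H - K\<close> is a single
  double coset of \<open>K\<close>, and \<open>x\<close> normalises \<open>K\<close>, so that \<open>x (H - K) x\<close> lies inside \<open>H x H\<close> or is disjoint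
  from it. The first would make \<open>H \<union> H x H\<close> a subgroup, hence all of \<open>SL(2,p)\<close>, of order 192, which \<open>p\<close>
  does not divide. So \<open>|S\<^sup>3| = 48 + 144 + 32 = 224\<close>, and \<open>224 = 64 powr (1 + \<delta>)\<close>. The group \<open>H\<close> is
  binary octahedral because it permutes the four centralisers of order 6 with the centre as kernel.
  The case does occur, in \<open>SL(2,17)\<close>, so \<open>\<delta>\<close> is the minimum of the growth exponents.
\<close>

section \<open>Counting in finite groups\<close>

lemma card_eq_fibres:
  assumes "finite A" "\<And>y. y \<in> f ` A \<Longrightarrow> card {x \<in> A. f x = y} = c"
  shows "card A = card (f ` A) * c"
proof -
  have "card A = (\<Sum>y\<in>f ` A. card {x \<in> A. f x = y})"
    using sum.image_gen[OF assms(1), of "\<lambda>_. 1::nat" f] by simp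
  also have "\<dots> = (\<Sum>y\<in>f ` A. c)" using assms(2) by simp
  finally show ?thesis by simp
qed

lemma card_le_fibres:
  assumes "finite A" "finite B" "f ` A \<subseteq> B"
    and "\<And>y. y \<in> f ` A \<Longrightarrow> card {x \<in> A. f x = y} \<le> c"
  shows "card A \<le> card B * c"
proof -
  have "card A = (\<Sum>y\<in>f ` A. card {x \<in> A. f x = y})"
    using sum.image_gen[OF assms(1), of "\<lambda>_. 1::nat" f] by simp
  also have "\<dots> \<le> (\<Sum>y\<in>f ` A. c)" using assms(4) by (intro sum_mono)
  also have "\<dots> \<le> card B * c" using assms(2,3) by (simp add: card_mono)
  finally show ?thesis .
qed

context group begin

lemma inv_mult_cancel: "\<lbrakk>a \<in> carrier G; b \<in> carrier G\<rbrakk> \<Longrightarrow> inv a \<otimes> (a \<otimes> b) = b"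
  by (simp add: m_assoc [symmetric])

lemma mult_inv_cancel: "\<lbrakk>a \<in> carrier G; b \<in> carrier G\<rbrakk> \<Longrightarrow> a \<otimes> (inv a \<otimes> b) = b"
  by (simp add: m_assoc [symmetric])

lemmas group_word_simps = m_assoc inv_mult_group inv_mult_cancel mult_inv_cancel

lemma conj_commute:
  assumes "a \<otimes> b = b \<otimes> a" "a \<in> carrier G" "b \<in> carrier G" "g \<in> carrier G"
  shows "(g \<otimes> a \<otimes> inv g) \<otimes> (g \<otimes> b \<otimes> inv g) = (g \<otimes> b \<otimes> inv g) \<otimes> (g \<otimes> a \<otimes> inv g)"
proof -
  have "a \<otimes> (b \<otimes> inv g) = b \<otimes> (a \<otimes> inv g)"
    using assms by (simp add: m_assoc[symmetric])
  then show ?thesis using assms by (simp add: group_word_simps)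
qed

lemma centraliser_is_subgroup:
  assumes a: "a \<in> carrier G" shows "subgroup {g \<in> carrier G. a \<otimes> g = g \<otimes> a} G"
proof (rule subgroupI)
  let ?C = "{g \<in> carrier G. a \<otimes> g = g \<otimes> a}"
  show "?C \<subseteq> carrier G" by blast
  show "?C \<noteq> {}" using a by auto
  show "inv b \<in> ?C" if "b \<in> ?C" for b
  proof -
    have b: "b \<in> carrier G" "a \<otimes> b = b \<otimes> a" using that by auto
    have "inv b \<otimes> (a \<otimes> b) \<otimes> inv b = inv b \<otimes> (b \<otimes> a) \<otimes> inv b" using b by simp
    then show ?thesis using b(1) a by (simp add: group_word_simps)
  qed
  show "b \<otimes> c \<in> ?C" if "b \<in> ?C" "c \<in> ?C" for b c
  proof -
    have b: "b \<in> carrier G" "a \<otimes> b = b \<otimes> a" and c: "c \<in> carrier G" "a \<otimes> c = c \<otimes> a" using that by auto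
    have "a \<otimes> (b \<otimes> c) = b \<otimes> (a \<otimes> c)" using m_assoc[of a b c] m_assoc[of b a c] a b c by simp
    then show ?thesis using a b c by (simp add: m_assoc)
  qed
qed

lemma card_subgroup_dvd:
  assumes "subgroup K G" "subgroup H G" "K \<subseteq> H" shows "card K dvd card H"
proof -
  interpret HH: group "G\<lparr>carrier := H\<rparr>" using subgroup_imp_group[OF assms(2)] .
  have "card (rcosets\<^bsub>G\<lparr>carrier := H\<rparr>\<^esub> K) * card K = card H"
    using HH.lagrange[OF subgroup_incl[OF assms]] by (simp add: order_def)
  then show ?thesis by (metis dvd_triv_right)
qed

text \<open>The products of elements of \<open>M\<close> and \<open>A\<close> lie in \<open>H\<close>, and each is attained at most \<open>|M \<inter> A|\<close> times.\<close>

lemma card_subgroup_Int_ge: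
  assumes H: "subgroup H G" and M: "subgroup M G" and A: "subgroup A G"
    and fin: "finite H" and MH: "M \<subseteq> H" and AH: "A \<subseteq> H"
  shows "card M * card A \<le> card H * card (M \<inter> A)"
proof -
  have finM: "finite M" "finite A" using assms finite_subset by auto
  note mc = subgroup.mem_carrier[OF M] subgroup.mem_carrier[OF A]
  let ?f = "\<lambda>(m, a). m \<otimes> a"
  have "card (M \<times> A) \<le> card H * card (M \<inter> A)"
  proof (rule card_le_fibres[where f = ?f])
    show "?f ` (M \<times> A) \<subseteq> H" using MH AH subgroup.m_closed[OF H] by auto
    fix y assume "y \<in> ?f ` (M \<times> A)"
    then obtain m0 a0 where y: "m0 \<in> M" "a0 \<in> A" "y = m0 \<otimes> a0" by auto
    let ?F = "{v \<in> M \<times> A. ?f v = y}"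
    let ?g = "\<lambda>(m, a). inv m0 \<otimes> m"
    have key: "inv m0 \<otimes> m = a0 \<otimes> inv a" if "m \<in> M" "a \<in> A" "m \<otimes> a = y" for m a
    proof -
      have "inv m0 \<otimes> (m \<otimes> a) \<otimes> inv a = inv m0 \<otimes> (m0 \<otimes> a0) \<otimes> inv a"
        using that y by simp
      then show ?thesis using that(1,2) y(1,2) mc by (simp add: group_word_simps)
    qed
    have "inj_on ?g ?F"
    proof (rule inj_onI)
      fix v w assume vw: "v \<in> ?F" "w \<in> ?F" "?g v = ?g w"
      obtain m a m' a' where eq: "v = (m, a)" "w = (m', a')" by (cases v, cases w)
      have *: "m \<in> M" "a \<in> A" "m' \<in> M" "a' \<in> A" "inv m0 \<otimes> m = inv m0 \<otimes> m'"
        "m \<otimes> a = m' \<otimes> a'" using vw by (auto simp: eq)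
      then have "m = m'" using y mc by simp
      moreover from this have "a = a'" using * mc inv_mult_cancel[of m a] inv_mult_cancel[of m a'] by simp
      ultimately show "v = w" by (simp add: eq)
    qed
    moreover have "?g ` ?F \<subseteq> M \<inter> A"
    proof
      fix w assume "w \<in> ?g ` ?F"
      then obtain m a where *: "m \<in> M" "a \<in> A" "m \<otimes> a = y" and w: "w = inv m0 \<otimes> m" by auto
      have "w \<in> M" using * w y(1) subgroup.m_closed[OF M] subgroup.m_inv_closed[OF M] by simp
      moreover have "w \<in> A"
        using key[OF *] w * y(2) subgroup.m_closed[OF A] subgroup.m_inv_closed[OF A] by simp
      ultimately show "w \<in> M \<inter> A" by simp
    qed
    ultimately show "card ?F \<le> card (M \<inter> A)"
      using finM by (meson card_inj_on_le finite_Int)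
  qed (use finM fin in auto)
  then show ?thesis by (simp add: card_cartesian_product)
qed

end

section \<open>The class equation of a group with abelian centralisers\<close>

text \<open>The setting for a subgroup \<open>H\<close> of \<open>SL(2,p)\<close> without noncentral elements of trace 2 or -2, where \<open>Z\<close> is
  the part of the centre in \<open>H\<close>. The last axiom expresses that two diagonalisable matrices of
  determinant 1 with the same trace and the same eigenvectors are equal or inverse to each other.\<close>

locale dickson_group = group G for G (structure) +
  fixes H Z
  assumes sub_H: "subgroup H G" and fin_H: "finite H"
    and sub_Z: "subgroup Z G" and Z_le: "Z \<subseteq> H"
    and central: "\<lbrakk>z \<in> Z; h \<in> H\<rbrakk> \<Longrightarrow> z \<otimes> h = h \<otimes> z"
    and commute_trans: "\<lbrakk>a \<in> H; a \<notin> Z; b \<in> H; c \<in> H; a \<otimes> b = b \<otimes> a; a \<otimes> c = c \<otimes> a\<rbrakk>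
      \<Longrightarrow> b \<otimes> c = c \<otimes> b"
    and commute_conj: "\<lbrakk>a \<in> H; a \<notin> Z; g \<in> H; (g \<otimes> a \<otimes> inv g) \<otimes> a = a \<otimes> (g \<otimes> a \<otimes> inv g)\<rbrakk>
      \<Longrightarrow> g \<otimes> a \<otimes> inv g = a \<or> g \<otimes> a \<otimes> inv g = inv a"
begin

definition cent :: "'a \<Rightarrow> 'a set" where
  "cent a = {h \<in> H. a \<otimes> h = h \<otimes> a}"

text \<open>As commuting is transitive outside \<open>Z\<close>, this set is the normaliser of \<open>cent a\<close> in \<open>H\<close>.\<close>

definition norm_cent :: "'a \<Rightarrow> 'a set" where
  "norm_cent a = {g \<in> H. a \<otimes> (g \<otimes> a \<otimes> inv g) = (g \<otimes> a \<otimes> inv g) \<otimes> a}"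

text \<open>The union of the conjugates of \<open>cent a - Z\<close>. These sets are the classes of the relation that \<open>a\<close> commutes
  with a conjugate of \<open>b\<close>, so they partition \<open>H - Z\<close>.\<close>

definition swept :: "'a \<Rightarrow> 'a set" where
  "swept a = (\<lambda>(g, c). g \<otimes> c \<otimes> inv g) ` (H \<times> (cent a - Z))"

lemma H_carrier [simp]: "h \<in> H \<Longrightarrow> h \<in> carrier G"
  using subgroup.mem_carrier[OF sub_H] .

lemma Z_carrier [simp]: "h \<in> Z \<Longrightarrow> h \<in> carrier G"
  using subgroup.mem_carrier[OF sub_Z] .

lemma H_closed [simp]: "a \<in> H \<Longrightarrow> b \<in> H \<Longrightarrow> a \<otimes> b \<in> H" "a \<in> H \<Longrightarrow> inv a \<in> H" "\<one> \<in> H"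
  using subgroup.m_closed[OF sub_H] subgroup.m_inv_closed[OF sub_H] subgroup.one_closed[OF sub_H] by auto

lemma fin_Z: "finite Z" using Z_le fin_H finite_subset by blast

lemma card_Z_pos: "card Z > 0"
  using fin_Z subgroup.one_closed[OF sub_Z] by (auto simp: card_gt_0_iff)

lemma subgroup_cent: assumes "a \<in> H" shows "subgroup (cent a) G"
proof -
  have "cent a = H \<inter> {g \<in> carrier G. a \<otimes> g = g \<otimes> a}" by (auto simp: cent_def)
  then show ?thesis using subgroups_Inter_pair[OF sub_H centraliser_is_subgroup] assms by simp
qed

lemma cent_subset: "cent a \<subseteq> H" by (auto simp: cent_def)

lemma fin_cent: "finite (cent a)" using cent_subset fin_H finite_subset by blast

lemma Z_subset_cent: "a \<in> H \<Longrightarrow> Z \<subseteq> cent a"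
  unfolding cent_def using Z_le by (blast intro: central[symmetric])

lemma self_cent: "a \<in> H \<Longrightarrow> a \<in> cent a" by (simp add: cent_def)

lemma cent_abelian: "\<lbrakk>a \<in> H; a \<notin> Z; b \<in> cent a; c \<in> cent a\<rbrakk> \<Longrightarrow> b \<otimes> c = c \<otimes> b"
  unfolding cent_def by (blast intro: commute_trans)

lemma Z_dvd_cent: "a \<in> H \<Longrightarrow> card Z dvd card (cent a)"
  using card_subgroup_dvd[OF sub_Z subgroup_cent Z_subset_cent] .

lemma card_cent_ge: assumes "a \<in> H" "a \<notin> Z" obtains \<alpha> where "card (cent a) = card Z * \<alpha>" "\<alpha> \<ge> 2"
proof -
  obtain \<alpha> where al: "card (cent a) = card Z * \<alpha>" using Z_dvd_cent[OF assms(1)] by (auto elim: dvdE)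
  have "Z \<subset> cent a" using Z_subset_cent self_cent assms by blast
  then have "card Z < card (cent a)" using fin_cent psubset_card_mono by blast
  then have "\<alpha> \<ge> 2" using al by (cases "\<alpha> \<le> 1"; cases \<alpha>) auto
  then show ?thesis using that al by blast
qed

lemma conj_in_Z: assumes "z \<in> Z" "g \<in> H" shows "g \<otimes> z \<otimes> inv g = z"
proof -
  have "g \<otimes> z \<otimes> inv g = z \<otimes> g \<otimes> inv g" using central[OF assms] by simp
  then show ?thesis using assms by (simp add: m_assoc)
qed

lemma conj_notin_Z: assumes "c \<in> H" "c \<notin> Z" "g \<in> H" shows "g \<otimes> c \<otimes> inv g \<notin> Z"
proof
  assume "g \<otimes> c \<otimes> inv g \<in> Z"
  then have "inv g \<otimes> (g \<otimes> c \<otimes> inv g) \<otimes> inv (inv g) \<in> Z" using conj_in_Z[of _ "inv g"] assms by simp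
  then show False using assms by (simp add: group_word_simps)
qed

lemma conj_back_commute:
  assumes "a \<in> H" "b \<in> H" "g \<in> H" "a \<otimes> (g \<otimes> b \<otimes> inv g) = (g \<otimes> b \<otimes> inv g) \<otimes> a"
  shows "(inv g \<otimes> a \<otimes> g) \<otimes> b = b \<otimes> (inv g \<otimes> a \<otimes> g)"
proof -
  have "inv g \<otimes> (g \<otimes> b \<otimes> inv g) \<otimes> inv (inv g) = b" using assms(2,3) by (simp add: group_word_simps)
  moreover have "inv (inv g) = g" using assms(3) by simp
  ultimately show ?thesis
    using conj_commute[OF assms(4), of "inv g"] assms(1-3) by (simp only: H_closed H_carrier inv_closed m_closed)
qed

text \<open>An element of the normaliser sends \<open>a\<close> to \<open>a\<close> or to its inverse, and those of the first kind form
  the centraliser.\<close>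

lemma card_norm_cent:
  assumes a: "a \<in> H" "a \<notin> Z"
  shows "card (norm_cent a) = card (cent a) \<or> card (norm_cent a) = 2 * card (cent a)"
proof (cases "norm_cent a = cent a")
  case False
  have sub: "cent a \<subseteq> norm_cent a"
  proof
    fix c assume "c \<in> cent a"
    then have c: "c \<in> H" "a \<otimes> c = c \<otimes> a" by (auto simp: cent_def)
    then have "c \<otimes> a \<otimes> inv c = a \<otimes> c \<otimes> inv c" by simp
    then have "c \<otimes> a \<otimes> inv c = a" using c(1) a by (simp add: m_assoc)
    then show "c \<in> norm_cent a" using c a by (simp add: norm_cent_def)
  qed
  then obtain m where m: "m \<in> norm_cent a" "m \<notin> cent a" using False by blast
  have two: "g \<otimes> a \<otimes> inv g = inv a" if "g \<in> norm_cent a" "g \<notin> cent a" for g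
  proof -
    have g: "g \<in> H" using that by (auto simp: norm_cent_def)
    have "g \<otimes> a \<otimes> inv g \<noteq> a"
    proof
      assume "g \<otimes> a \<otimes> inv g = a"
      then have "g \<otimes> a \<otimes> inv g \<otimes> g = a \<otimes> g" by simp
      then show False using that g a by (simp add: cent_def m_assoc)
    qed
    then show ?thesis using commute_conj[OF a g] that by (auto simp: norm_cent_def)
  qed
  have mH: "m \<in> H" using m by (auto simp: norm_cent_def)
  have tm: "m \<otimes> a \<otimes> inv m = inv a" using two m by blast
  have "norm_cent a = cent a \<union> (\<lambda>c. m \<otimes> c) ` cent a"
  proof (intro equalityI subsetI)
    fix g assume g: "g \<in> norm_cent a"
    have gH: "g \<in> H" using g by (auto simp: norm_cent_def)
    show "g \<in> cent a \<union> (\<lambda>c. m \<otimes> c) ` cent a"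
    proof (cases "g \<in> cent a")
      case False
      have eq: "g \<otimes> a \<otimes> inv g = m \<otimes> a \<otimes> inv m" using two[OF g False] tm by simp
      have "inv m \<otimes> (g \<otimes> a \<otimes> inv g) \<otimes> g = inv m \<otimes> (m \<otimes> a \<otimes> inv m) \<otimes> g" using eq by simp
      then have "inv m \<otimes> g \<in> cent a" using gH mH a by (simp add: cent_def group_word_simps)
      moreover have "g = m \<otimes> (inv m \<otimes> g)" using gH mH by (simp add: group_word_simps)
      ultimately show ?thesis by blast
    qed simp
  next
    fix g assume "g \<in> cent a \<union> (\<lambda>c. m \<otimes> c) ` cent a"
    then consider "g \<in> cent a" | c where "c \<in> cent a" "g = m \<otimes> c" by blast
    then show "g \<in> norm_cent a"
    proof cases
      case 2
      have c: "c \<in> H" "a \<otimes> c = c \<otimes> a" using 2 by (auto simp: cent_def)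
      have "g \<otimes> a \<otimes> inv g = m \<otimes> (c \<otimes> a) \<otimes> inv c \<otimes> inv m" using 2 c mH a by (simp add: group_word_simps)
      also have "\<dots> = m \<otimes> (a \<otimes> c) \<otimes> inv c \<otimes> inv m" using c by simp
      also have "\<dots> = m \<otimes> a \<otimes> inv m" using c(1) mH a(1) by (simp add: group_word_simps)
      also have "\<dots> = inv a" by (rule tm)
      finally show ?thesis using 2 c mH a by (simp add: norm_cent_def)
    qed (use sub in blast)
  qed
  moreover have "cent a \<inter> (\<lambda>c. m \<otimes> c) ` cent a = {}"
  proof -
    have "m \<in> cent a" if "c \<in> cent a" "m \<otimes> c \<in> cent a" for c
    proof -
      note S = subgroup_cent[OF a(1)]
      have "m \<otimes> c \<otimes> inv c \<in> cent a"
        using that subgroup.m_closed[OF S] subgroup.m_inv_closed[OF S] by blast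
      moreover have "c \<in> H" using that cent_subset by blast
      ultimately show ?thesis using mH by (simp add: group_word_simps)
    qed
    then show ?thesis using m by blast
  qed
  moreover have "card ((\<lambda>c. m \<otimes> c) ` cent a) = card (cent a)"
    using cent_subset mH by (intro card_image inj_onI) (simp add: subset_eq)
  ultimately show ?thesis using fin_cent by (simp add: card_Un_disjoint)
qed simp

text \<open>A pair \<open>(g, c)\<close> with \<open>c \<in> cent a - Z\<close> produces the element \<open>g c g^-1\<close>; the pairs that produce the same
  element differ by an element of the normaliser of \<open>cent a\<close>.\<close>

lemma card_swept:
  assumes a: "a \<in> H" "a \<notin> Z"
  shows "card (swept a) * card (norm_cent a) = card H * (card (cent a) - card Z)"
proof -
  have "card (H \<times> (cent a - Z)) = card (swept a) * card (norm_cent a)"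
    unfolding swept_def
  proof (rule card_eq_fibres)
    show "finite (H \<times> (cent a - Z))" using fin_H fin_cent by blast
    let ?f = "\<lambda>(g, c). g \<otimes> c \<otimes> inv g"
    fix y assume "y \<in> ?f ` (H \<times> (cent a - Z))"
    then obtain g0 c0 where 0: "g0 \<in> H" "c0 \<in> cent a" "c0 \<notin> Z" "y = g0 \<otimes> c0 \<otimes> inv g0" by auto
    have c0: "c0 \<in> H" "a \<otimes> c0 = c0 \<otimes> a" using 0 by (auto simp: cent_def)
    \<comment> \<open>The fibre through \<open>(g0, c0)\<close>, parametrised by the normaliser.\<close>
    have "bij_betw (\<lambda>m. (g0 \<otimes> m, inv m \<otimes> c0 \<otimes> m)) (norm_cent a)
      {x \<in> H \<times> (cent a - Z). ?f x = y}"
    proof (rule bij_betwI')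
      fix m m' assume "m \<in> norm_cent a" "m' \<in> norm_cent a"
      then show "((g0 \<otimes> m, inv m \<otimes> c0 \<otimes> m) = (g0 \<otimes> m', inv m' \<otimes> c0 \<otimes> m')) = (m = m')"
        using 0 by (auto simp: norm_cent_def)
    next
      fix m assume m: "m \<in> norm_cent a"
      then have mH: "m \<in> H" and mc: "a \<otimes> (m \<otimes> a \<otimes> inv m) = (m \<otimes> a \<otimes> inv m) \<otimes> a"
        by (auto simp: norm_cent_def)
      have "c0 \<otimes> (m \<otimes> a \<otimes> inv m) = (m \<otimes> a \<otimes> inv m) \<otimes> c0"
        by (rule commute_trans[OF a, of c0]) (use mH mc c0 a in auto)
      from conj_back_commute[OF _ _ _ this] have "inv m \<otimes> c0 \<otimes> m \<in> cent a"
        using mH c0 a by (simp add: cent_def)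
      moreover have "inv m \<otimes> c0 \<otimes> m \<notin> Z" using conj_notin_Z[of c0 "inv m"] c0 0 mH by simp
      ultimately show "(g0 \<otimes> m, inv m \<otimes> c0 \<otimes> m) \<in> {x \<in> H \<times> (cent a - Z). ?f x = y}"
        using mH 0 c0 by (simp add: group_word_simps)
    next
      fix v assume "v \<in> {x \<in> H \<times> (cent a - Z). ?f x = y}"
      then obtain g c where v: "v = (g, c)" "g \<in> H" "c \<in> cent a" "c \<notin> Z" "g \<otimes> c \<otimes> inv g = y" by auto
      have c: "c \<in> H" "a \<otimes> c = c \<otimes> a" using v by (auto simp: cent_def)
      define m where "m = inv g0 \<otimes> g"
      have m: "m \<in> H" using v 0 by (simp add: m_def)
      have g: "g = g0 \<otimes> m" using v 0 by (simp add: m_def group_word_simps)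
      have "inv g0 \<otimes> (g \<otimes> c \<otimes> inv g) \<otimes> g0 = inv g0 \<otimes> (g0 \<otimes> c0 \<otimes> inv g0) \<otimes> g0" using v 0 by simp
      then have mc: "m \<otimes> c \<otimes> inv m = c0" using 0 c c0 m by (simp add: g group_word_simps)
      then have c': "c = inv m \<otimes> c0 \<otimes> m" using m c by (simp add: group_word_simps flip: mc)
      have "c0 \<otimes> (m \<otimes> a \<otimes> inv m) = (m \<otimes> a \<otimes> inv m) \<otimes> c0"
        using conj_commute[OF c(2), of m] a c m mc by simp
      then have "a \<otimes> (m \<otimes> a \<otimes> inv m) = (m \<otimes> a \<otimes> inv m) \<otimes> a"
        using commute_trans[of c0 a "m \<otimes> a \<otimes> inv m"] c0 0 a m by simp
      then have "m \<in> norm_cent a" using m by (simp add: norm_cent_def)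
      then show "\<exists>m\<in>norm_cent a. v = (g0 \<otimes> m, inv m \<otimes> c0 \<otimes> m)"
        using v(1) g c' by blast
    qed
    from bij_betw_same_card[OF this] show "card {x \<in> H \<times> (cent a - Z). ?f x = y} = card (norm_cent a)"
      by simp
  qed
  then show ?thesis using Z_subset_cent[OF a(1)] fin_Z
    by (simp add: card_cartesian_product card_Diff_subset)
qed

lemma self_swept: assumes "a \<in> H" "a \<notin> Z" shows "a \<in> swept a"
proof -
  have "(\<lambda>(g, c). g \<otimes> c \<otimes> inv g) (\<one>, a) \<in> swept a"
    unfolding swept_def by (rule imageI) (use assms in \<open>simp add: self_cent\<close>)
  then show ?thesis using assms by simp
qed

lemma swept_subset: assumes "a \<in> H" shows "swept a \<subseteq> H - Z"
proof
  fix y assume "y \<in> swept a"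
  then obtain g c where "g \<in> H" "c \<in> cent a" "c \<notin> Z" "y = g \<otimes> c \<otimes> inv g"
    by (auto simp: swept_def)
  moreover from this have "c \<in> H" using cent_subset by blast
  ultimately show "y \<in> H - Z" using conj_notin_Z[of c g] by simp
qed

lemma swept_sym: assumes a: "a \<in> H" "a \<notin> Z" and b: "b \<in> swept a" shows "a \<in> swept b"
proof -
  obtain g c where g: "g \<in> H" "c \<in> cent a" "c \<notin> Z" "b = g \<otimes> c \<otimes> inv g"
    using b by (auto simp: swept_def)
  have c: "c \<in> H" "c \<otimes> a = a \<otimes> c" using g by (auto simp: cent_def)
  have "g \<otimes> a \<otimes> inv g \<in> cent b - Z"
    using conj_commute[OF c(2), of g] conj_notin_Z[of a g] g c a by (simp add: cent_def)
  then have "(\<lambda>(g, c). g \<otimes> c \<otimes> inv g) (inv g, g \<otimes> a \<otimes> inv g) \<in> swept b"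
    unfolding swept_def by (intro imageI) (use g in simp)
  then show ?thesis using g c a by (simp add: group_word_simps)
qed

lemma swept_mono: assumes a: "a \<in> H" "a \<notin> Z" and b: "b \<in> swept a" shows "swept b \<subseteq> swept a"
proof
  fix y assume y: "y \<in> swept b"
  obtain g c where g: "g \<in> H" "c \<in> cent a" "c \<notin> Z" "b = g \<otimes> c \<otimes> inv g"
    using b by (auto simp: swept_def)
  have c: "c \<in> H" "c \<otimes> a = a \<otimes> c" using g by (auto simp: cent_def)
  obtain h d where h: "h \<in> H" "d \<in> cent b" "d \<notin> Z" "y = h \<otimes> d \<otimes> inv h"
    using y by (auto simp: swept_def)
  have d: "d \<in> H" "d \<otimes> b = b \<otimes> d" using h by (auto simp: cent_def)
  define e where "e = inv g \<otimes> d \<otimes> g"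
  have e: "e \<in> H" "e \<notin> Z" using conj_notin_Z[of d "inv g"] g d h by (auto simp: e_def)
  have "c \<otimes> e = e \<otimes> c" using conj_back_commute[of d c g] d c g unfolding e_def by simp
  then have "a \<otimes> e = e \<otimes> a" using commute_trans[of c a e] c g e a by simp
  then have "(\<lambda>(g, c). g \<otimes> c \<otimes> inv g) (h \<otimes> g, e) \<in> swept a"
    unfolding swept_def by (intro imageI) (use g h e in \<open>simp add: cent_def\<close>)
  then show "y \<in> swept a" using g h d by (simp add: e_def group_word_simps)
qed

lemma class_equation:
  "card H = card Z + (\<Sum>D\<in>swept ` (H - Z). card D)"
proof -
  have eqs: "swept a = swept b" if "a \<in> H - Z" "b \<in> H - Z" "swept a \<inter> swept b \<noteq> {}" for a b
  proof -
    have *: "swept c = swept a" if "a \<in> H - Z" "c \<in> swept a" for a c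
    proof -
      have "c \<in> H - Z" using that swept_subset by blast
      then have "swept c \<subseteq> swept a" "swept a \<subseteq> swept c"
        using that swept_mono[of a c] swept_mono[of c a] swept_sym[of a c] by auto
      then show ?thesis by blast
    qed
    from that(3) obtain c where "c \<in> swept a" "c \<in> swept b" by blast
    then show ?thesis using *[OF that(1)] *[OF that(2)] by metis
  qed
  have "card (\<Union>(swept ` (H - Z))) = (\<Sum>D\<in>swept ` (H - Z). card D)"
  proof (rule card_Union_disjoint)
    show "pairwise disjnt (swept ` (H - Z))"
      using eqs by (auto simp: pairwise_def disjnt_def)
    show "finite D" if "D \<in> swept ` (H - Z)" for D
      using that swept_subset finite_Diff[OF fin_H, of Z] by (auto intro: finite_subset)
  qed
  moreover have "\<Union>(swept ` (H - Z)) = H - Z"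
    using swept_subset self_swept by blast
  moreover have "card H = card Z + card (H - Z)"
    using Z_le fin_H fin_Z by (metis card_Diff_subset card_mono le_add_diff_inverse)
  ultimately show ?thesis by simp
qed

end

text \<open>The proportion of \<open>H\<close> that is swept by a centraliser of order \<open>a\<close> modulo \<open>Z\<close> and of index \<open>e\<close> in its
  normaliser.\<close>

definition class_weight :: "nat \<Rightarrow> nat \<Rightarrow> real" where
  "class_weight e a = (1 - 1 / real a) / real e"

lemma class_weight_ge:
  assumes "a \<ge> 2" "e = 1 \<or> e = 2"
  shows "class_weight e a \<ge> 1/4" "e = 1 \<Longrightarrow> class_weight e a \<ge> 1/2"
proof -
  have "1 / real a \<le> 1/2" using assms(1) by (simp add: field_simps)
  then show "class_weight e a \<ge> 1/4" "e = 1 \<Longrightarrow> class_weight e a \<ge> 1/2"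
    using assms(2) by (auto simp: class_weight_def)
qed

lemma one_class:
  assumes "a \<ge> 2" "e = 1 \<or> e = 2" "e * a \<le> N" "class_weight e a = 1 - 1 / real N"
  shows "e = 1 \<and> a = N"
proof -
  have N: "N \<ge> 2" using assms by auto
  have "1 / real N \<le> 1/2" using N by (simp add: field_simps)
  moreover have "1 / real a > 0" using assms by simp
  moreover have "1 - 1 / real a = 2 - 2 * (1 / real N)" if "e = 2"
    using assms(4) that by (simp add: class_weight_def)
  ultimately have "e \<noteq> 2" by linarith
  then have "e = 1" using assms(2) by blast
  then show ?thesis using assms(4) by (simp add: class_weight_def)
qed

lemma two_classes_aux:
  assumes "a \<ge> 2" "b \<ge> 2" "2 * b \<le> N" "class_weight 1 a + class_weight 2 b = 1 - 1 / real N"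
  shows "N = 2 * b \<or> N = 12"
proof -
  have N: "N \<ge> 4" using assms by simp
  have eq: "1 / real N = 1 / real a + 1 / (2 * real b) - 1/2"
    using assms(4) by (simp add: class_weight_def field_simps)
  have pos: "1 / real N > 0" using N by simp
  show ?thesis
  proof (cases "a = 2")
    case True
    then have "1 / real N = 1 / (2 * real b)" using eq by simp
    then show ?thesis using N assms by simp
  next
    case False
    then have a3: "1 / real a \<le> 1/3" using assms(1) by (simp add: field_simps)
    have b: "b = 2"
    proof (rule ccontr)
      assume "b \<noteq> 2"
      then have "1 / (2 * real b) \<le> 1/6" using assms(2) by (simp add: field_simps)
      then show False using eq pos a3 by linarith
    qed
    have "a = 3"
    proof (rule ccontr)
      assume "a \<noteq> 3"
      then have "1 / real a \<le> 1/4" using False assms(1) by (simp add: field_simps)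
      then show False using eq pos b by simp
    qed
    then have "1 / real N = 1 / 12" using eq b by simp
    then show ?thesis using N by simp
  qed
qed

lemma two_classes:
  assumes "a \<ge> 2" "b \<ge> 2" "e = 1 \<or> e = 2" "f = 1 \<or> f = 2" "e * a \<le> N" "f * b \<le> N"
    and eq: "class_weight e a + class_weight f b = 1 - 1 / real N"
  shows "(e = 2 \<and> N = 2 * a) \<or> (f = 2 \<and> N = 2 * b) \<or> N = 12"
proof -
  have N: "N \<ge> 2" using assms by auto
  have pos: "1 / real N > 0" using N by simp
  have "\<not> (e = 1 \<and> f = 1)"
    using class_weight_ge(2)[of a e] class_weight_ge(2)[of b f] assms pos by force
  moreover have False if "e = 2" "f = 2"
  proof -
    have "2 / real N = 1 / real a + 1 / real b" using eq that by (simp add: class_weight_def field_simps)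
    moreover have "1 / real a \<ge> 2 / real N" using that assms(1,5) N by (simp add: field_simps)
    moreover have "1 / real b > 0" using assms by simp
    ultimately show False by linarith
  qed
  ultimately consider "e = 1" "f = 2" | "e = 2" "f = 1" using assms(3,4) by blast
  then show ?thesis
  proof cases
    case 1 then show ?thesis using two_classes_aux[of a b N] assms by auto
  next
    case 2 then show ?thesis using two_classes_aux[of b a N] assms by (auto simp: add.commute)
  qed
qed

text \<open>Klein's equation for the finite rotation groups: its solutions are the dihedral triples
  \<open>(2, 2, c)\<close> and the triples \<open>(2, 3, c)\<close> with \<open>c = 3, 4, 5\<close>.\<close>

lemma three_classes_sorted:
  assumes "a \<ge> 2" "a \<le> b" "b \<le> c" "N \<ge> 1" and eq: "1 / real a + 1 / real b + 1 / real c = 1 + 2 / real N"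
  shows "N = 2 * c \<or> N = 12 \<or> (N = 24 \<and> b = 3) \<or> (N = 60 \<and> c \<le> 5)"
proof -
  have pos: "2 / real N > 0" using assms by simp
  have ba: "1 / real b \<le> 1 / real a" "1 / real c \<le> 1 / real b" using assms by (simp_all add: frac_le)
  have a: "a = 2"
  proof (rule ccontr)
    assume "a \<noteq> 2"
    then have "1 / real a \<le> 1/3" using assms(1) by (simp add: field_simps)
    then show False using eq pos ba by linarith
  qed
  have b: "b = 2 \<or> b = 3"
  proof (rule ccontr)
    assume "\<not> (b = 2 \<or> b = 3)"
    then have "1 / real b \<le> 1/4" using assms(1,2) by (simp add: field_simps)
    moreover have "1 / real a = 1/2" using a by simp
    ultimately show False using eq pos ba by linarith
  qed
  show ?thesis
  proof (cases "b = 2")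
    case True
    then have "1 / real c = 2 / real N" using eq a by simp
    then have "real N = 2 * real c" using assms by (simp add: field_simps)
    then show ?thesis by linarith
  next
    case False
    then have b3: "b = 3" using b by simp
    have eq': "1 / real c = 1/6 + 2 / real N" using eq a b3 by simp
    have "c \<le> 5"
    proof (rule ccontr)
      assume "\<not> c \<le> 5"
      then have "1 / real c \<le> 1/6" by (simp add: field_simps)
      then show False using eq' pos by linarith
    qed
    then consider "c = 3" | "c = 4" | "c = 5" using b3 assms(3) by linarith
    then show ?thesis using eq' b3 by cases (auto simp: field_simps)
  qed
qed

text \<open>Three classes have total weight below 1 only if each has index 2 in its normaliser, as a class of
  index 1 weighs at least a half and the others at least a quarter.\<close>

lemma three_classes:
  assumes "a \<ge> 2" "b \<ge> 2" "c \<ge> 2" "e = 1 \<or> e = 2" "f = 1 \<or> f = 2" "g = 1 \<or> g = 2" "N \<ge> 1"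
    and eq: "class_weight e a + class_weight f b + class_weight g c = 1 - 1 / real N"
  shows "e = 2 \<and> f = 2 \<and> g = 2 \<and> (N = 2 * a \<or> N = 2 * b \<or> N = 2 * c \<or> N = 12 \<or>
    (N = 24 \<and> (a = 3 \<or> b = 3 \<or> c = 3)) \<or> (N = 60 \<and> a \<le> 5 \<and> b \<le> 5 \<and> c \<le> 5))"
proof -
  have pos: "1 / real N > 0" using assms by simp
  have quarter: "class_weight e a \<ge> 1/4" "class_weight f b \<ge> 1/4" "class_weight g c \<ge> 1/4"
    using class_weight_ge(1) assms by auto
  have half: "e = 1 \<Longrightarrow> class_weight e a \<ge> 1/2" "f = 1 \<Longrightarrow> class_weight f b \<ge> 1/2"
    "g = 1 \<Longrightarrow> class_weight g c \<ge> 1/2"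
    using class_weight_ge(2) assms by auto
  have "e \<noteq> 1" "f \<noteq> 1" "g \<noteq> 1" using quarter half eq pos by linarith+
  then have e: "e = 2" "f = 2" "g = 2" using assms by auto
  then have eq': "1 / real a + 1 / real b + 1 / real c = 1 + 2 / real N"
    using eq by (simp add: class_weight_def field_simps)
  consider "a \<le> b" "b \<le> c" | "a \<le> c" "c \<le> b" | "b \<le> a" "a \<le> c" | "b \<le> c" "c \<le> a"
    | "c \<le> a" "a \<le> b" | "c \<le> b" "b \<le> a" by linarith
  then show ?thesis
    using three_classes_sorted[of a b c N] three_classes_sorted[of a c b N] three_classes_sorted[of b a c N]
      three_classes_sorted[of b c a N] three_classes_sorted[of c a b N] three_classes_sorted[of c b a N]
      assms eq' e by cases (auto simp: add_ac)
qed

context dickson_group begin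

text \<open>The cyclic and dihedral cases of the classification.\<close>

definition splits_half :: bool where
  "splits_half \<longleftrightarrow> (\<exists>A. subgroup A G \<and> A \<subseteq> H \<and> (\<forall>b\<in>A. \<forall>c\<in>A. b \<otimes> c = c \<otimes> b) \<and>
     (\<forall>h\<in>H. \<forall>b\<in>A. h \<otimes> b \<otimes> inv h \<in> A) \<and> card H \<le> 2 * card A)"

text \<open>Either \<open>H\<close> is the centraliser of \<open>a\<close>, or the centraliser has index 2 in \<open>H\<close> and its normaliser is \<open>H\<close>.\<close>

lemma splits_halfI:
  assumes a: "a \<in> H" "a \<notin> Z" and "card H = card (cent a) \<or> card H = 2 * card (cent a) \<and> card (norm_cent a) = card H"
  shows splits_half
proof -
  have "h \<otimes> b \<otimes> inv h \<in> cent a" if "h \<in> H" "b \<in> cent a" for h b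
    using assms(3)
  proof
    assume "card H = card (cent a)"
    then have "cent a = H" using cent_subset fin_H by (metis card_subset_eq)
    then show ?thesis using that by simp
  next
    assume "card H = 2 * card (cent a) \<and> card (norm_cent a) = card H"
    then have "norm_cent a = H" using fin_H by (intro card_subset_eq) (auto simp: norm_cent_def)
    then have h: "a \<otimes> (h \<otimes> a \<otimes> inv h) = (h \<otimes> a \<otimes> inv h) \<otimes> a" using that by (auto simp: norm_cent_def)
    have b: "b \<in> H" "a \<otimes> b = b \<otimes> a" using that by (auto simp: cent_def)
    note c = conj_commute[OF b(2), of h]
    have "a \<otimes> (h \<otimes> b \<otimes> inv h) = (h \<otimes> b \<otimes> inv h) \<otimes> a"
      by (rule commute_trans[of "h \<otimes> a \<otimes> inv h"]) (use that a b c h conj_notin_Z in simp_all)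
    then show ?thesis using that b by (simp add: cent_def)
  qed
  then show ?thesis unfolding splits_half_def
    using subgroup_cent[OF a(1)] cent_subset cent_abelian[OF a] assms(3) by (intro exI[of _ "cent a"]) auto
qed

lemma class_data:
  assumes a: "a \<in> H" "a \<notin> Z" and N: "card H = card Z * N"
  obtains \<alpha> e where "\<alpha> \<ge> 2" "e = 1 \<or> e = 2" "e * \<alpha> \<le> N" "card (cent a) = card Z * \<alpha>"
    "card (norm_cent a) = card Z * (e * \<alpha>)" "real (card (swept a)) = real (card H) * class_weight e \<alpha>"
proof -
  obtain \<alpha> where al: "card (cent a) = card Z * \<alpha>" "\<alpha> \<ge> 2" using card_cent_ge[OF a] .
  obtain e where e: "e = 1 \<or> e = 2" "card (norm_cent a) = e * card (cent a)"
    using card_norm_cent[OF a] by (metis mult_1)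
  then have nc: "card (norm_cent a) = card Z * (e * \<alpha>)" using al by simp
  have "card (norm_cent a) \<le> card H"
    using fin_H by (intro card_mono) (auto simp: norm_cent_def)
  then have le: "e * \<alpha> \<le> N" using nc N card_Z_pos by simp
  have "card Z * \<alpha> - card Z = card Z * (\<alpha> - 1)" by (simp add: diff_mult_distrib2)
  then have "card (swept a) * (card Z * (e * \<alpha>)) = card H * (card Z * (\<alpha> - 1))"
    using card_swept[OF a] nc al by simp
  then have "card (swept a) * (e * \<alpha>) = card H * (\<alpha> - 1)" using card_Z_pos by simp
  then have "real (card (swept a)) * (real e * real \<alpha>) = real (card H) * (real \<alpha> - 1)"
    using al(2) by (metis of_nat_1 of_nat_diff of_nat_mult one_le_numeral order_trans)
  then have "real (card (swept a)) = real (card H) * class_weight e \<alpha>"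
    using al(2) e(1) by (auto simp: class_weight_def field_simps)
  then show ?thesis using that al e nc le by blast
qed

lemma Z_dvd_H: "card Z dvd card H"
  using card_subgroup_dvd[OF sub_Z sub_H Z_le] .

text \<open>The weights of the classes add up to \<open>1 - 1/N\<close>, where \<open>N\<close> is the order of \<open>H\<close> modulo \<open>Z\<close>. The element
  \<open>a0\<close> is arbitrary, which in the case of order 60 gives the bound for every centraliser.\<close>

lemma dickson_aux:
  assumes a0: "a0 \<in> H" "a0 \<notin> Z"
  shows "splits_half \<or> card H = 12 * card Z \<or>
    (card H = 24 * card Z \<and> (\<exists>a\<in>H - Z. card (cent a) = 3 * card Z \<and> card (norm_cent a) = 6 * card Z)) \<or>
    (card H = 60 * card Z \<and> card (cent a0) \<le> 5 * card Z)"
proof -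
  obtain N where N: "card H = card Z * N" using Z_dvd_H by blast
  have Hpos: "card H > 0" using fin_H a0 card_gt_0_iff by blast
  then have N1: "N \<ge> 1" using N by (cases N) auto
  let ?Cl = "swept ` (H - Z)"
  let ?w = "\<lambda>D. real (card D) / real (card H)"
  have fin: "finite ?Cl" using fin_H by blast
  have "real (card H) = real (card Z) + (\<Sum>D\<in>?Cl. real (card D))"
    using class_equation by (metis of_nat_add of_nat_sum)
  then have "(\<Sum>D\<in>?Cl. real (card D)) = real (card H) - real (card Z)" by simp
  moreover have "(real (card H) - real (card Z)) / real (card H) = 1 - 1 / real N"
    using Hpos N card_Z_pos by (simp add: diff_divide_distrib)
  ultimately have "(\<Sum>D\<in>?Cl. real (card D)) / real (card H) = 1 - 1 / real N" by simp
  then have sum: "(\<Sum>D\<in>?Cl. ?w D) = 1 - 1 / real N" by (simp add: sum_divide_distrib)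
  have data: "\<exists>\<alpha> e. \<alpha> \<ge> 2 \<and> (e = 1 \<or> e = 2) \<and> e * \<alpha> \<le> N \<and> card (cent a) = card Z * \<alpha> \<and>
    card (norm_cent a) = card Z * (e * \<alpha>) \<and> ?w (swept a) = class_weight e \<alpha>" if "a \<in> H - Z" for a
  proof -
    have a: "a \<in> H" "a \<notin> Z" using that by auto
    from class_data[OF a N] obtain \<alpha> e where "\<alpha> \<ge> 2" "e = 1 \<or> e = 2" "e * \<alpha> \<le> N"
      "card (cent a) = card Z * \<alpha>" "card (norm_cent a) = card Z * (e * \<alpha>)"
      "real (card (swept a)) = real (card H) * class_weight e \<alpha>" .
    then show ?thesis using Hpos by (intro exI[of _ \<alpha>] exI[of _ e]) simp
  qed
  have wge: "?w D \<ge> 1/4" if "D \<in> ?Cl" for D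
  proof -
    from that obtain a where "a \<in> H - Z" "D = swept a" by blast
    then show ?thesis using data[of a] class_weight_ge(1) by fastforce
  qed
  \<comment> \<open>Every class weighs at least a quarter, so there are at most three of them.\<close>
  have "real (card ?Cl) * (1/4) \<le> (\<Sum>D\<in>?Cl. ?w D)" using wge by (intro sum_bounded_below) auto
  also have "\<dots> < 1" using sum N1 by simp
  finally have c3: "card ?Cl \<le> 3" by simp
  have in0: "swept a0 \<in> ?Cl" using a0 by blast
  obtain \<alpha> e where d0: "\<alpha> \<ge> 2" "e = 1 \<or> e = 2" "e * \<alpha> \<le> N" "card (cent a0) = card Z * \<alpha>"
    "card (norm_cent a0) = card Z * (e * \<alpha>)" "?w (swept a0) = class_weight e \<alpha>"
    using data[of a0] a0 by blast
  have half: splits_half if "a \<in> H - Z" "card (cent a) = card Z * x" "card (norm_cent a) = card Z * (f * x)"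
      "f = 1 \<and> x = N \<or> f = 2 \<and> N = 2 * x" for a x f
    using that N splits_halfI[of a] by auto
  define R where "R = ?Cl - {swept a0}"
  have finR: "finite R" using fin by (simp add: R_def)
  have cR: "card R \<le> 2" using c3 in0 fin by (simp add: R_def)
  have sumR: "class_weight e \<alpha> + (\<Sum>D\<in>R. ?w D) = 1 - 1 / real N"
    using sum d0(6) sum.remove[OF fin in0, of ?w] by (simp add: R_def)
  consider "card R = 0" | "card R = 1" | "card R = 2" using cR by linarith
  then show ?thesis
  proof cases
    case 1
    then have "R = {}" using finR by simp
    then have "e = 1 \<and> \<alpha> = N" using one_class[OF d0(1-3)] sumR by simp
    then show ?thesis using half[of a0 \<alpha> e] d0 a0 by blast
  next
    case 2
    then obtain D1 where R: "R = {D1}" by (auto simp: card_1_singleton_iff)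
    then have "D1 \<in> ?Cl" unfolding R_def by blast
    then obtain a1 where a1: "a1 \<in> H - Z" "D1 = swept a1" by blast
    obtain \<beta> f where d1: "\<beta> \<ge> 2" "f = 1 \<or> f = 2" "f * \<beta> \<le> N" "card (cent a1) = card Z * \<beta>"
      "card (norm_cent a1) = card Z * (f * \<beta>)" "?w (swept a1) = class_weight f \<beta>"
      using data[OF a1(1)] by blast
    have "class_weight e \<alpha> + class_weight f \<beta> = 1 - 1 / real N" using sumR R a1 d1 by simp
    from two_classes[OF d0(1) d1(1) d0(2) d1(2) d0(3) d1(3) this]
    show ?thesis using half[of a0 \<alpha> e] half[of a1 \<beta> f] d0 d1 a0 a1 N by auto
  next
    case 3
    then obtain D1 D2 where R: "R = {D1, D2}" "D1 \<noteq> D2" by (auto simp: card_2_iff)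
    then have "D1 \<in> ?Cl" "D2 \<in> ?Cl" unfolding R_def by blast+
    then obtain a1 a2 where a1: "a1 \<in> H - Z" "D1 = swept a1" and a2: "a2 \<in> H - Z" "D2 = swept a2" by blast
    obtain \<beta> f where d1: "\<beta> \<ge> 2" "f = 1 \<or> f = 2" "f * \<beta> \<le> N" "card (cent a1) = card Z * \<beta>"
      "card (norm_cent a1) = card Z * (f * \<beta>)" "?w (swept a1) = class_weight f \<beta>"
      using data[OF a1(1)] by blast
    obtain \<gamma> g where d2: "\<gamma> \<ge> 2" "g = 1 \<or> g = 2" "g * \<gamma> \<le> N" "card (cent a2) = card Z * \<gamma>"
      "card (norm_cent a2) = card Z * (g * \<gamma>)" "?w (swept a2) = class_weight g \<gamma>"
      using data[OF a2(1)] by blast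
    have "class_weight e \<alpha> + class_weight f \<beta> + class_weight g \<gamma> = 1 - 1 / real N"
      using sumR R a1(2) a2(2) d1(6) d2(6) by simp
    from three_classes[OF d0(1) d1(1) d2(1) d0(2) d1(2) d2(2) N1 this]
    have efg: "e = 2" "f = 2" "g = 2" and N': "N = 2 * \<alpha> \<or> N = 2 * \<beta> \<or> N = 2 * \<gamma> \<or> N = 12 \<or>
      (N = 24 \<and> (\<alpha> = 3 \<or> \<beta> = 3 \<or> \<gamma> = 3)) \<or> (N = 60 \<and> \<alpha> \<le> 5 \<and> \<beta> \<le> 5 \<and> \<gamma> \<le> 5)" by blast+
    have a0': "a0 \<in> H - Z" using a0 by blast
    from N' consider "N = 2 * \<alpha>" | "N = 2 * \<beta>" | "N = 2 * \<gamma>" | "N = 12" | "N = 24" "\<alpha> = 3"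
      | "N = 24" "\<beta> = 3" | "N = 24" "\<gamma> = 3" | "N = 60" "\<alpha> \<le> 5" by blast
    then show ?thesis
    proof cases
      case 1 then show ?thesis using half[OF a0' d0(4,5)] efg by simp
    next
      case 2 then show ?thesis using half[OF a1(1) d1(4,5)] efg by simp
    next
      case 3 then show ?thesis using half[OF a2(1) d2(4,5)] efg by simp
    next
      case 4 then show ?thesis using N by simp
    next
      case 5
      then have "card H = 24 * card Z" "card (cent a0) = 3 * card Z" "card (norm_cent a0) = 6 * card Z"
        using N d0(4,5) efg by simp_all
      then show ?thesis using a0' by blast
    next
      case 6
      then have "card H = 24 * card Z" "card (cent a1) = 3 * card Z" "card (norm_cent a1) = 6 * card Z"
        using N d1(4,5) efg by simp_all
      then show ?thesis using a1(1) by blast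
    next
      case 7
      then have "card H = 24 * card Z" "card (cent a2) = 3 * card Z" "card (norm_cent a2) = 6 * card Z"
        using N d2(4,5) efg by simp_all
      then show ?thesis using a2(1) by blast
    next
      case 8 then show ?thesis using N d0(4) by (simp add: mult.commute)
    qed
  qed
qed

theorem dickson:
  obtains (half) splits_half
  | (T) "card H = 12 * card Z"
  | (O) a where "card H = 24 * card Z" "a \<in> H - Z" "card (cent a) = 3 * card Z" "card (norm_cent a) = 6 * card Z"
  | (I) "card H = 60 * card Z" "\<And>a. a \<in> H \<Longrightarrow> a \<notin> Z \<Longrightarrow> card (cent a) \<le> 5 * card Z"
proof (cases "H = Z")
  case True
  have "z \<otimes> b \<otimes> inv z \<in> Z" if "z \<in> Z" "b \<in> Z" for z b using that conj_in_Z[of b z] Z_le by auto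
  then have splits_half unfolding splits_half_def
    using sub_Z True central by (intro exI[of _ Z]) auto
  then show ?thesis by (rule half)
next
  case False
  show ?thesis using dickson_aux half T O I Z_le False by (metis DiffI subset_antisym subsetI)
qed

end

section \<open>Matrices modulo p\<close>

text \<open>Representatives of residue classes are arbitrary integers here, so that identities of matrices become
  congruences between polynomials in the entries.\<close>

definition mat2 :: "nat \<Rightarrow> int \<Rightarrow> int \<Rightarrow> int \<Rightarrow> int \<Rightarrow> int^2^2" where
  "mat2 p a b c d = reduce_mod p (vector [vector [a, b], vector [c, d]])"

lemma mat2_entries [simp]:
  "mat2 p a b c d $ 1 $ 1 = a mod int p" "mat2 p a b c d $ 1 $ 2 = b mod int p"
  "mat2 p a b c d $ 2 $ 1 = c mod int p" "mat2 p a b c d $ 2 $ 2 = d mod int p"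
  by (simp_all add: mat2_def reduce_mod_def)

lemma mat2_eq_iff:
  "mat2 p a b c d = mat2 p a' b' c' d' \<longleftrightarrow>
    [a = a'] (mod int p) \<and> [b = b'] (mod int p) \<and> [c = c'] (mod int p) \<and> [d = d'] (mod int p)"
  by (simp add: vec_eq_iff forall_2 cong_def)

lemma mat2_mult:
  "mat2 p a b c d \<otimes>\<^bsub>SL2 p\<^esub> mat2 p a' b' c' d' =
    mat2 p (a * a' + b * c') (a * b' + b * d') (c * a' + d * c') (c * b' + d * d')"
proof -
  have "mat2 p a b c d \<otimes>\<^bsub>SL2 p\<^esub> mat2 p a' b' c' d' =
    reduce_mod p ((vector [vector [a, b], vector [c, d]] :: int^2^2) **
      (vector [vector [a', b'], vector [c', d']] :: int^2^2))"
    by (simp add: SL2_def mat2_def reduce_mod_mult_left reduce_mod_mult_right)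
  then show ?thesis
    by (simp add: mat2_def reduce_mod_def vec_eq_iff forall_2 matrix_matrix_mult_def sum_2)
qed

lemma mat2_one: assumes "p \<ge> 2" shows "\<one>\<^bsub>SL2 p\<^esub> = mat2 p 1 0 0 1"
  using assms by (simp add: SL2_def vec_eq_iff forall_2 mat_def)

lemma mat2_carrier: assumes "p \<ge> 2"
  shows "mat2 p a b c d \<in> carrier (SL2 p) \<longleftrightarrow> [a * d - b * c = 1] (mod int p)"
proof -
  have "[det (mat2 p a b c d) = a * d - b * c] (mod int p)"
    unfolding mat2_def by (rule cong_trans[OF det_reduce_mod]) (simp add: det_2)
  then have "[det (mat2 p a b c d) = 1] (mod int p) \<longleftrightarrow> [a * d - b * c = 1] (mod int p)"
    using cong_sym cong_trans by blast
  moreover have "\<forall>i j. mat2 p a b c d $ i $ j \<in> {0..<int p}" using assms by (simp add: forall_2)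
  ultimately show ?thesis by (simp add: SL2_def)
qed

lemma mat2_self: assumes "A \<in> carrier (SL2 p)"
  shows "A = mat2 p (A $ 1 $ 1) (A $ 1 $ 2) (A $ 2 $ 1) (A $ 2 $ 2)"
  using assms by (simp add: SL2_def vec_eq_iff forall_2)

locale sl2 =
  fixes p :: nat
  assumes prime_p: "prime p" and p_ge_5: "p \<ge> 5"
begin

sublocale group "SL2 p" using group_SL2[of p] p_ge_5 by simp

abbreviation "G \<equiv> SL2 p"
abbreviation "M \<equiv> mat2 p"
abbreviation "P \<equiv> int p"
abbreviation SL2_mult (infixl "\<cdot>" 70) where "g \<cdot> h \<equiv> g \<otimes>\<^bsub>SL2 p\<^esub> h"

lemma p2: "p \<ge> 2" using p_ge_5 by simp

lemma prime_int: "prime P" using prime_p by simp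

lemma carrier_iff: "M a b c d \<in> carrier G \<longleftrightarrow> P dvd a * d - b * c - 1"
  using mat2_carrier[OF p2] by (simp add: cong_iff_dvd_diff)

lemma M_eq_iff:
  "M a b c d = M a' b' c' d' \<longleftrightarrow> P dvd a - a' \<and> P dvd b - b' \<and> P dvd c - c' \<and> P dvd d - d'"
  by (simp add: mat2_eq_iff cong_iff_dvd_diff)

lemma SL2_cases:
  assumes "A \<in> carrier G"
  obtains a b c d where "A = M a b c d" "P dvd a * d - b * c - 1"
  using mat2_self[OF assms] carrier_iff assms by metis

lemmas one_M = mat2_one[OF p2]

lemma inv_M: assumes "P dvd a * d - b * c - 1"
  shows "inv\<^bsub>G\<^esub> (M a b c d) = M d (-b) (-c) a"
proof (rule inv_equality)
  show "M d (- b) (- c) a \<cdot> M a b c d = \<one>\<^bsub>G\<^esub>"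
    using assms unfolding mat2_mult one_M M_eq_iff by (auto simp: algebra_simps)
qed (use assms in \<open>auto simp: carrier_iff algebra_simps\<close>)

lemma dvd_prod_cases: "P dvd x * y \<Longrightarrow> P dvd x \<or> P dvd y"
  using prime_int prime_dvd_mult_iff by blast

lemma dvd_cancel: "P dvd x * y \<Longrightarrow> \<not> P dvd x \<Longrightarrow> P dvd y"
  using dvd_prod_cases by blast

lemma small_not_dvd: "0 < k \<Longrightarrow> k < P \<Longrightarrow> \<not> P dvd k"
  using zdvd_not_zless by blast

lemma not_dvd_2: "\<not> P dvd 2"
  using small_not_dvd p_ge_5 by auto

lemma inverse_mod: assumes "\<not> P dvd c" obtains c' where "P dvd c * c' - 1"
proof -
  have "coprime c P" using assms prime_int by (metis coprime_commute prime_imp_coprime)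
  then obtain c' where "[c * c' = 1] (mod P)" using cong_solve_coprime_int by blast
  then show ?thesis using that by (simp add: cong_iff_dvd_diff)
qed

lemma finite_carrier: "finite (carrier G)"
proof (rule finite_subset)
  show "carrier G \<subseteq> (\<lambda>(a, b, c, d). M a b c d) ` ({0..<P} \<times> {0..<P} \<times> {0..<P} \<times> {0..<P})"
  proof
    fix A assume A: "A \<in> carrier G"
    then have "A = (\<lambda>(a, b, c, d). M a b c d) (A $ 1 $ 1, A $ 1 $ 2, A $ 2 $ 1, A $ 2 $ 2)"
      using mat2_self by simp
    moreover have "A $ i $ j \<in> {0..<P}" for i j using A by (simp add: SL2_def)
    ultimately show "A \<in> (\<lambda>(a, b, c, d). M a b c d) ` ({0..<P} \<times> {0..<P} \<times> {0..<P} \<times> {0..<P})"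
      by blast
  qed
qed simp

lemma finite_subgroup: "subgroup H G \<Longrightarrow> finite H"
  using finite_carrier finite_subset subgroup.subset by blast

lemma commute_M_iff:
  "M a b c d \<cdot> M a' b' c' d' = M a' b' c' d' \<cdot> M a b c d \<longleftrightarrow>
    P dvd b * c' - b' * c \<and> P dvd (a - d) * b' - (a' - d') * b \<and> P dvd (a - d) * c' - (a' - d') * c"
proof -
  have 1: "(a * a' + b * c') - (a' * a + b' * c) = b * c' - b' * c"
    "(a * b' + b * d') - (a' * b + b' * d) = (a - d) * b' - (a' - d') * b"
    "(c * a' + d * c') - (c' * a + d' * c) = - ((a - d) * c' - (a' - d') * c)"
    "(c * b' + d * d') - (c' * b + d' * d) = - (b * c' - b' * c)" by (simp_all add: algebra_simps)
  show ?thesis unfolding mat2_mult M_eq_iff 1 dvd_minus_iff by blast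
qed

abbreviation "Z \<equiv> group_centre G"

lemma centre_iff:
  assumes "P dvd a * d - b * c - 1"
  shows "M a b c d \<in> Z \<longleftrightarrow> P dvd b \<and> P dvd c \<and> P dvd a - d"
proof
  assume "M a b c d \<in> Z"
  moreover have "M 1 1 0 1 \<in> carrier G" "M 1 0 1 1 \<in> carrier G" by (auto simp: carrier_iff)
  ultimately have "M a b c d \<cdot> M 1 1 0 1 = M 1 1 0 1 \<cdot> M a b c d"
    "M a b c d \<cdot> M 1 0 1 1 = M 1 0 1 1 \<cdot> M a b c d" unfolding group_centre_def by blast+
  then show "P dvd b \<and> P dvd c \<and> P dvd a - d" unfolding commute_M_iff by auto
next
  assume *: "P dvd b \<and> P dvd c \<and> P dvd a - d"
  have "M a b c d \<cdot> g = g \<cdot> M a b c d" if "g \<in> carrier G" for g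
    using that by (elim SL2_cases) (use * in \<open>auto simp: commute_M_iff\<close>)
  then show "M a b c d \<in> Z" using assms by (simp add: group_centre_def carrier_iff)
qed

lemma centre_eq: "Z = {M 1 0 0 1, M (-1) 0 0 (-1)}"
proof (intro equalityI subsetI)
  fix A assume A: "A \<in> Z"
  then have "A \<in> carrier G" by (simp add: group_centre_def)
  then obtain a b c d where m: "A = M a b c d" and det: "P dvd a * d - b * c - 1" by (rule SL2_cases)
  have s: "P dvd b" "P dvd c" "P dvd a - d" using A centre_iff[OF det] m by auto
  have "P dvd (a - 1) * (a + 1)" using s det by algebra
  then have "P dvd a - 1 \<or> P dvd a + 1" by (rule dvd_prod_cases)
  then show "A \<in> {M 1 0 0 1, M (-1) 0 0 (-1)}"
  proof
    assume h: "P dvd a - 1"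
    then have "P dvd d - 1" using s(3) by algebra
    then show ?thesis using h s by (simp add: m M_eq_iff)
  next
    assume h: "P dvd a + 1"
    then have "P dvd d + 1" using s(3) by algebra
    then show ?thesis using h s by (simp add: m M_eq_iff)
  qed
next
  fix A assume "A \<in> {M 1 0 0 1, M (-1) 0 0 (-1)}"
  then show "A \<in> Z" by (auto simp: centre_iff)
qed

lemma card_centre: "card Z = 2"
proof -
  have "M 1 0 0 1 \<noteq> M (-1) 0 0 (-1)" using not_dvd_2 by (simp add: M_eq_iff)
  then show ?thesis by (simp add: centre_eq)
qed

lemma subgroup_centre: "subgroup Z G"
proof (rule subgroupI)
  show "inv\<^bsub>G\<^esub> a \<in> Z" if "a \<in> Z" for a using that by (auto simp: centre_eq inv_M)
  show "a \<cdot> b \<in> Z" if "a \<in> Z" "b \<in> Z" for a b using that by (auto simp: centre_eq mat2_mult)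
qed (auto simp: centre_eq carrier_iff)

lemma centreD: "z \<in> Z \<Longrightarrow> g \<in> carrier G \<Longrightarrow> z \<cdot> g = g \<cdot> z" "z \<in> Z \<Longrightarrow> z \<in> carrier G"
  by (auto simp: group_centre_def)

text \<open>Two matrices commute iff their traceless parts, written as vectors \<open>(b, c, a - d)\<close>, have zero cross
  product. Being parallel to a fixed nonzero vector is an equivalence relation.\<close>

lemma commute_trans_SL2:
  assumes "g \<in> carrier G" "g \<notin> Z" "h \<in> carrier G" "k \<in> carrier G"
    and "g \<cdot> h = h \<cdot> g" "g \<cdot> k = k \<cdot> g"
  shows "h \<cdot> k = k \<cdot> h"
proof -
  obtain a b c d where g: "g = M a b c d" "P dvd a * d - b * c - 1" using assms(1) by (rule SL2_cases)
  obtain a1 b1 c1 d1 where h: "h = M a1 b1 c1 d1" using assms(3) by (rule SL2_cases)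
  obtain a2 b2 c2 d2 where k: "k = M a2 b2 c2 d2" using assms(4) by (rule SL2_cases)
  define t t1 t2 where t: "t = a - d" "t1 = a1 - d1" "t2 = a2 - d2"
  have nz: "\<not> P dvd b \<or> \<not> P dvd c \<or> \<not> P dvd t" using assms(2) g centre_iff by (auto simp: t)
  have 1: "P dvd b * c1 - b1 * c" "P dvd t * b1 - t1 * b" "P dvd t * c1 - t1 * c"
    using assms(5) by (simp_all add: g h commute_M_iff t)
  have 2: "P dvd b * c2 - b2 * c" "P dvd t * b2 - t2 * b" "P dvd t * c2 - t2 * c"
    using assms(6) by (simp_all add: g k commute_M_iff t)
  let ?x = "b1 * c2 - b2 * c1" and ?y = "t1 * b2 - t2 * b1" and ?z = "t1 * c2 - t2 * c1"
  have "P dvd w * ?x \<and> P dvd w * ?y \<and> P dvd w * ?z" if "w \<in> {b, c, t}" for w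
    using that 1 2 by (elim insertE emptyE; intro conjI; hypsubst; algebra)
  then have "P dvd ?x \<and> P dvd ?y \<and> P dvd ?z" using nz dvd_cancel by blast
  then show ?thesis by (simp add: h k commute_M_iff t)
qed

text \<open>These are the noncentral elements of order divisible by \<open>p\<close>: up to sign and conjugation, the
  nontrivial unipotent upper triangular matrices.\<close>

definition parabolic :: "int^2^2 \<Rightarrow> bool" where
  "parabolic A \<longleftrightarrow> A \<in> carrier G \<and> A \<notin> Z \<and> P dvd (A $ 1 $ 1 + A $ 2 $ 2)\<^sup>2 - 4"

lemma parabolic_iff:
  assumes "P dvd a * d - b * c - 1"
  shows "parabolic (M a b c d) \<longleftrightarrow> M a b c d \<notin> Z \<and> P dvd (a + d)\<^sup>2 - 4"
proof -
  have "[(a mod P + d mod P)\<^sup>2 - 4 = (a + d)\<^sup>2 - 4] (mod P)"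
    by (intro cong_diff cong_pow cong_add) (auto simp: cong_def)
  then have "P dvd (a mod P + d mod P)\<^sup>2 - 4 \<longleftrightarrow> P dvd (a + d)\<^sup>2 - 4" using cong_dvd_iff by blast
  then show ?thesis using assms by (simp add: parabolic_def carrier_iff)
qed

lemma conj_trace:
  assumes "P dvd e * h - f * g - 1" "M e f g h \<cdot> M a b c d \<cdot> inv\<^bsub>G\<^esub> (M e f g h) = M a' b' c' d'"
  shows "P dvd (a' + d') - (a + d)"
proof -
  have "M e f g h \<cdot> M a b c d \<cdot> inv\<^bsub>G\<^esub> (M e f g h) =
    M ((e*a+f*c)*h + (e*b+f*d)*(-g)) ((e*a+f*c)*(-f) + (e*b+f*d)*e)
      ((g*a+h*c)*h + (g*b+h*d)*(-g)) ((g*a+h*c)*(-f) + (g*b+h*d)*e)"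
    using assms(1) by (simp add: inv_M mat2_mult)
  from trans[OF this[symmetric] assms(2)]
  have "P dvd ((e*a+f*c)*h + (e*b+f*d)*(-g)) - a'" "P dvd ((g*a+h*c)*(-f) + (g*b+h*d)*e) - d'"
    unfolding M_eq_iff by blast+
  then show ?thesis using assms(1) by algebra
qed

text \<open>The traceless parts are parallel, and the quadratic form \<open>t\<^sup>2 + 4 b c\<close> takes the same nonzero value
  on both, namely the discriminant \<open>(a + d)\<^sup>2 - 4\<close>. So the two vectors are equal or opposite.\<close>

lemma same_trace_commute:
  assumes 1: "P dvd a * d - b * c - 1" and 2: "P dvd a' * d' - b' * c' - 1"
    and nc: "M a b c d \<notin> Z" and nz: "\<not> P dvd (a + d)\<^sup>2 - 4" and tr: "P dvd (a' + d') - (a + d)"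
    and com: "M a b c d \<cdot> M a' b' c' d' = M a' b' c' d' \<cdot> M a b c d"
  shows "M a' b' c' d' = M a b c d \<or> M a' b' c' d' = inv\<^bsub>G\<^esub> (M a b c d)"
proof -
  define t t' where t: "t = a - d" "t' = a' - d'"
  define q where "q = t * t + 4 * b * c"
  have q: "\<not> P dvd q"
  proof
    assume "P dvd q"
    then have "P dvd (a + d)\<^sup>2 - 4" using 1 unfolding q_def t by algebra
    with nz show False by simp
  qed
  have q': "P dvd q - (t' * t' + 4 * b' * c')" using 1 2 tr unfolding q_def t by algebra
  have com': "P dvd b * c' - b' * c" "P dvd t * b' - t' * b" "P dvd t * c' - t' * c"
    using com by (simp_all add: commute_M_iff t)
  \<comment> \<open>Up to the nonzero factor \<open>w\<close>, the second vector is \<open>w'\<close> times the first; the form gives \<open>w'\<^sup>2 = w\<^sup>2\<close>.\<close>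
  have sgn: "P dvd w' - w \<or> P dvd w' + w" if
    "P dvd w * b' - w' * b" "P dvd w * c' - w' * c" "P dvd w * t' - w' * t" for w w'
  proof -
    have "P dvd q * ((w' - w) * (w' + w))" using that q' unfolding q_def by algebra
    then show ?thesis using q dvd_cancel dvd_prod_cases by blast
  qed
  have finish: ?thesis if w: "\<not> P dvd w" "P dvd w * b' - w' * b" "P dvd w * c' - w' * c" "P dvd w * t' - w' * t" for w w'
    using sgn[OF w(2-4)]
  proof
    assume s: "P dvd w' - w"
    have "P dvd w * (b' - b)" "P dvd w * (c' - c)" "P dvd w * (t' - t)" using s w(2-4) by algebra+
    then have e: "P dvd b' - b" "P dvd c' - c" "P dvd t' - t" using w(1) dvd_cancel by blast+
    then have "P dvd 2 * (a' - a)" "P dvd 2 * (d' - d)" using tr unfolding t by algebra+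
    then have "P dvd a' - a" "P dvd d' - d" using not_dvd_2 dvd_cancel by blast+
    then show ?thesis using e by (simp add: M_eq_iff)
  next
    assume s: "P dvd w' + w"
    have "P dvd w * (b' + b)" "P dvd w * (c' + c)" "P dvd w * (t' + t)" using s w(2-4) by algebra+
    then have e: "P dvd b' + b" "P dvd c' + c" "P dvd t' + t" using w(1) dvd_cancel by blast+
    then have "P dvd 2 * (a' - d)" "P dvd 2 * (d' - a)" using tr unfolding t by algebra+
    then have "P dvd a' - d" "P dvd d' - a" using not_dvd_2 dvd_cancel by blast+
    then show ?thesis using e 1 by (simp add: M_eq_iff inv_M)
  qed
  have "\<not> P dvd b \<or> \<not> P dvd c \<or> \<not> P dvd t" using nc centre_iff[OF 1] by (auto simp: t)
  moreover have "?thesis" if "\<not> P dvd b"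
  proof -
    have "P dvd b * t' - b' * t" using com' by algebra
    then show ?thesis using finish[OF that, of b'] com' by (simp add: mult.commute)
  qed
  moreover have "?thesis" if "\<not> P dvd c"
  proof -
    have "P dvd c * b' - c' * b" "P dvd c * t' - c' * t" using com' by algebra+
    then show ?thesis using finish[OF that, of c'] by (simp add: mult.commute)
  qed
  moreover have "?thesis" if "\<not> P dvd t" using finish[OF that, of t'] com' by (simp add: mult.commute)
  ultimately show ?thesis by blast
qed

lemma conj_commute_SL2:
  assumes a: "a \<in> carrier G" "a \<notin> Z" "\<not> parabolic a" and g: "g \<in> carrier G"
    and com: "(g \<cdot> a \<cdot> inv\<^bsub>G\<^esub> g) \<cdot> a = a \<cdot> (g \<cdot> a \<cdot> inv\<^bsub>G\<^esub> g)"
  shows "g \<cdot> a \<cdot> inv\<^bsub>G\<^esub> g = a \<or> g \<cdot> a \<cdot> inv\<^bsub>G\<^esub> g = inv\<^bsub>G\<^esub> a"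
proof -
  obtain e f h k where g': "g = M e f h k" "P dvd e * k - f * h - 1" using g by (rule SL2_cases)
  obtain a1 b1 c1 d1 where a': "a = M a1 b1 c1 d1" "P dvd a1 * d1 - b1 * c1 - 1" using a(1) by (rule SL2_cases)
  have "g \<cdot> a \<cdot> inv\<^bsub>G\<^esub> g \<in> carrier G" using a g by simp
  then obtain a2 b2 c2 d2 where b: "g \<cdot> a \<cdot> inv\<^bsub>G\<^esub> g = M a2 b2 c2 d2"
    "P dvd a2 * d2 - b2 * c2 - 1" by (rule SL2_cases)
  have tr: "P dvd (a2 + d2) - (a1 + d1)" using conj_trace[OF g'(2)] b(1) unfolding g' a' by blast
  show ?thesis unfolding b(1) unfolding a'(1)
  proof (rule same_trace_commute[OF a'(2) b(2)])
    show "M a1 b1 c1 d1 \<cdot> M a2 b2 c2 d2 = M a2 b2 c2 d2 \<cdot> M a1 b1 c1 d1"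
      using com unfolding b(1) by (simp add: a')
  qed (use a a' tr parabolic_iff in auto)
qed

end

context group begin

text \<open>A form of the condition that \<open>H\<close> and \<open>x\<close> generate \<open>G\<close> that can be applied directly to normalisers,
  centralisers and other subgroups.\<close>

definition generates_with :: "'a set \<Rightarrow> 'a \<Rightarrow> bool" where
  "generates_with H x \<longleftrightarrow> (\<forall>L. subgroup L G \<longrightarrow> H \<subseteq> L \<longrightarrow> x \<in> L \<longrightarrow> L = carrier G)"

text \<open>The intersection of \<open>H\<close> and \<open>x^-1 H x\<close>.\<close>

definition conj_int :: "'a set \<Rightarrow> 'a \<Rightarrow> 'a set" where
  "conj_int H x = {k \<in> H. x \<otimes> k \<otimes> inv x \<in> H}"

definition conj_by :: "'a \<Rightarrow> 'a \<Rightarrow> 'a" where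
  "conj_by g a = g \<otimes> a \<otimes> inv g"

lemma conj_by_closed [simp]: "g \<in> carrier G \<Longrightarrow> a \<in> carrier G \<Longrightarrow> conj_by g a \<in> carrier G"
  by (simp add: conj_by_def)

lemma conj_by_mult:
  "\<lbrakk>g \<in> carrier G; a \<in> carrier G; b \<in> carrier G\<rbrakk> \<Longrightarrow> conj_by g (a \<otimes> b) = conj_by g a \<otimes> conj_by g b"
  by (simp add: conj_by_def group_word_simps)

lemma conj_by_inv:
  "\<lbrakk>g \<in> carrier G; a \<in> carrier G\<rbrakk> \<Longrightarrow> conj_by g (inv a) = inv (conj_by g a)"
  by (simp add: conj_by_def group_word_simps)

lemma conj_by_cancel [simp]:
  "\<lbrakk>g \<in> carrier G; a \<in> carrier G\<rbrakk> \<Longrightarrow> conj_by (inv g) (conj_by g a) = a"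
  "\<lbrakk>g \<in> carrier G; a \<in> carrier G\<rbrakk> \<Longrightarrow> conj_by g (conj_by (inv g) a) = a"
  by (simp_all add: conj_by_def group_word_simps)

lemma inj_conj_by: "g \<in> carrier G \<Longrightarrow> inj_on (conj_by g) (carrier G)"
  by (rule inj_on_inverseI[of _ "conj_by (inv g)"]) simp

lemma subgroup_conj_image:
  assumes "subgroup H G" "g \<in> carrier G" shows "subgroup (conj_by g ` H) G"
proof (rule subgroupI)
  note sc = subgroup.mem_carrier[OF assms(1)]
  show "conj_by g ` H \<subseteq> carrier G" using sc assms by auto
  show "conj_by g ` H \<noteq> {}" using subgroup.one_closed[OF assms(1)] by blast
  show "inv a \<in> conj_by g ` H" if a: "a \<in> conj_by g ` H" for a
  proof -
    from a obtain h where h: "h \<in> H" "a = conj_by g h" by blast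
    then have "inv a = conj_by g (inv h)" using conj_by_inv[of g h] assms(2) sc by simp
    then show ?thesis using subgroup.m_inv_closed[OF assms(1) h(1)] by blast
  qed
  show "a \<otimes> b \<in> conj_by g ` H" if a: "a \<in> conj_by g ` H" and b: "b \<in> conj_by g ` H" for a b
  proof -
    from a obtain h where h: "h \<in> H" "a = conj_by g h" by blast
    from b obtain k where k: "k \<in> H" "b = conj_by g k" by blast
    have "a \<otimes> b = conj_by g (h \<otimes> k)" using conj_by_mult[of g h k] assms(2) sc h k by simp
    then show ?thesis using subgroup.m_closed[OF assms(1) h(1) k(1)] by blast
  qed
qed

lemma subgroup_conj_int:
  assumes "subgroup H G" "x \<in> carrier G" shows "subgroup (conj_int H x) G"
proof -
  note sc = subgroup.mem_carrier[OF assms(1)]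
  have "conj_int H x = H \<inter> conj_by (inv x) ` H"
  proof (intro equalityI subsetI)
    fix k assume k: "k \<in> conj_int H x"
    then have "k \<in> H" "conj_by x k \<in> H" by (auto simp: conj_int_def conj_by_def)
    moreover have "k = conj_by (inv x) (conj_by x k)" using calculation sc assms by simp
    ultimately show "k \<in> H \<inter> conj_by (inv x) ` H" by blast
  next
    fix k assume "k \<in> H \<inter> conj_by (inv x) ` H"
    then obtain h where "k \<in> H" "h \<in> H" "k = conj_by (inv x) h" by blast
    moreover from this have "conj_by x k = h" using sc assms by simp
    ultimately show "k \<in> conj_int H x" by (auto simp: conj_int_def conj_by_def)
  qed
  then show ?thesis using subgroups_Inter_pair subgroup_conj_image assms by simp
qed

lemma conj_int_conj:
  assumes "subgroup H G" "x \<in> carrier G" "g \<in> carrier G"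
  shows "conj_int (conj_by g ` H) (conj_by g x) = conj_by g ` conj_int H x"
proof -
  note sc = subgroup.mem_carrier[OF assms(1)]
  have "conj_by g x \<otimes> conj_by g k \<otimes> inv (conj_by g x) = conj_by g (x \<otimes> k \<otimes> inv x)" if "k \<in> H" for k
    using that assms sc by (simp add: conj_by_mult conj_by_inv)
  then have "conj_by g x \<otimes> conj_by g k \<otimes> inv (conj_by g x) \<in> conj_by g ` H \<longleftrightarrow> x \<otimes> k \<otimes> inv x \<in> H" if "k \<in> H" for k
    using inj_on_image_mem_iff[OF inj_conj_by[OF assms(3)], of "x \<otimes> k \<otimes> inv x" H] that assms sc
      subgroup.subset[OF assms(1)] by simp
  then show ?thesis unfolding conj_int_def by blast
qed

lemma generates_with_conj:
  assumes "subgroup H G" "x \<in> carrier G" "g \<in> carrier G" "generates_with H x"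
  shows "generates_with (conj_by g ` H) (conj_by g x)"
  unfolding generates_with_def
proof (intro allI impI)
  note sc = subgroup.mem_carrier[OF assms(1)]
  fix L assume L: "subgroup L G" "conj_by g ` H \<subseteq> L" "conj_by g x \<in> L"
  let ?L = "conj_by (inv g) ` L"
  have sub: "subgroup ?L G" using subgroup_conj_image[OF L(1)] assms by simp
  have "h \<in> ?L" if "h \<in> H" for h
  proof -
    have "conj_by g h \<in> L" using L that by blast
    then have "conj_by (inv g) (conj_by g h) \<in> ?L" by blast
    then show ?thesis using that sc assms by simp
  qed
  moreover have "x \<in> ?L"
  proof -
    have "conj_by (inv g) (conj_by g x) \<in> ?L" using L by blast
    then show ?thesis using assms by simp
  qed
  ultimately have eq: "?L = carrier G" using assms(4) sub unfolding generates_with_def by blast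
  show "L = carrier G"
  proof
    show "L \<subseteq> carrier G" using subgroup.subset[OF L(1)] .
    show "carrier G \<subseteq> L"
    proof
      fix y assume y: "y \<in> carrier G"
      then have "conj_by (inv g) y \<in> ?L" using eq assms by simp
      then obtain l where "l \<in> L" "conj_by (inv g) y = conj_by (inv g) l" by blast
      moreover from this have "y = l"
        using inj_conj_by[of "inv g"] assms y subgroup.mem_carrier[OF L(1)] by (auto dest: inj_onD)
      ultimately show "y \<in> L" by simp
    qed
  qed
qed

end

context sl2 begin

section \<open>Parabolic elements and normal subgroups\<close>

lemma upper_power:
  assumes "subgroup H G" "M 1 \<alpha> 0 1 \<in> H" shows "M 1 (int n * \<alpha>) 0 1 \<in> H"
proof (induction n)
  case 0 then show ?case using subgroup.one_closed[OF assms(1)] by (simp add: one_M)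
next
  case (Suc n)
  have "M 1 (int n * \<alpha>) 0 1 \<cdot> M 1 \<alpha> 0 1 = M 1 (int (Suc n) * \<alpha>) 0 1"
    unfolding mat2_mult M_eq_iff by (simp add: algebra_simps)
  then show ?case using subgroup.m_closed[OF assms(1) Suc assms(2)] by simp
qed

lemma all_upper:
  assumes "subgroup H G" "M 1 \<alpha> 0 1 \<in> H" "\<not> P dvd \<alpha>" shows "M 1 t 0 1 \<in> H"
proof -
  obtain \<alpha>' where a: "P dvd \<alpha> * \<alpha>' - 1" using inverse_mod[OF assms(3)] .
  define n where "n = nat ((t * \<alpha>') mod P)"
  have "int n = (t * \<alpha>') mod P" using p_ge_5 by (simp add: n_def)
  then have "P dvd t * \<alpha>' - int n" by (simp add: minus_mod_eq_mult_div)
  then have "P dvd int n * \<alpha> - t" using a by algebra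
  then have "M 1 (int n * \<alpha>) 0 1 = M 1 t 0 1" by (simp add: M_eq_iff)
  then show ?thesis using upper_power[OF assms(1,2), of n] by simp
qed

text \<open>All upper transvections lie in \<open>H\<close>. With them, a matrix with \<open>c \<noteq> 0\<close> can be turned into an
  antidiagonal one, which conjugates the upper transvections to the lower ones; and every matrix with
  \<open>c \<noteq> 0\<close> is a product of an upper, a lower and an upper transvection.\<close>

lemma subgroup_eq_carrier:
  assumes H: "subgroup H G" and u: "M 1 \<alpha> 0 1 \<in> H" "\<not> P dvd \<alpha>"
    and h: "M a b c d \<in> H" "\<not> P dvd c"
  shows "H = carrier G"
proof
  note cl = subgroup.m_closed[OF H] and inv = subgroup.m_inv_closed[OF H]
  have U: "M 1 t 0 1 \<in> H" for t using all_upper[OF H u] .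
  have det: "P dvd a * d - b * c - 1" using subgroup.mem_carrier[OF H h(1)] by (simp add: carrier_iff)
  obtain c' where c': "P dvd c * c' - 1" using inverse_mod[OF h(2)] .
  have "M 1 (- a * c') 0 1 \<cdot> M a b c d \<cdot> M 1 (- d * c') 0 1 = M 0 (-c') c 0"
    unfolding mat2_mult M_eq_iff using det c' by (intro conjI) (simp; algebra)+
  then have w: "M 0 (-c') c 0 \<in> H" using cl[OF cl[OF U h(1)] U] by metis
  have L: "M 1 0 r 1 \<in> H" for r
  proof -
    have "M 0 (-c') c 0 \<cdot> M 1 (- c' * c' * r) 0 1 \<cdot> inv\<^bsub>G\<^esub> (M 0 (-c') c 0) = M 1 0 r 1"
      using c' by (simp add: inv_M mult.commute mat2_mult M_eq_iff) algebra
    then show ?thesis using cl[OF cl[OF w U] inv[OF w]] by metis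
  qed
  have big: "M a b c d \<in> H" if det: "P dvd a * d - b * c - 1" and c: "\<not> P dvd c" for a b c d
  proof -
    obtain c' where c': "P dvd c * c' - 1" using inverse_mod[OF c] .
    have "M 1 ((a - 1) * c') 0 1 \<cdot> M 1 0 c 1 \<cdot> M 1 ((d - 1) * c') 0 1 = M a b c d"
      unfolding mat2_mult M_eq_iff using det c' by (intro conjI) (simp; algebra)+
    then show ?thesis using cl[OF cl[OF U L] U] by metis
  qed
  show "H \<subseteq> carrier G" using subgroup.subset[OF H] .
  show "carrier G \<subseteq> H"
  proof
    fix g assume "g \<in> carrier G"
    then obtain a b c d where g: "g = M a b c d" "P dvd a * d - b * c - 1" by (rule SL2_cases)
    show "g \<in> H"
    proof (cases "P dvd c")
      case False then show ?thesis using big g by simp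
    next
      case True
      have "\<not> P dvd a + c"
      proof
        assume "P dvd a + c"
        then have "P dvd 1" using True g(2) by algebra
        then show False using small_not_dvd[of 1] p_ge_5 by simp
      qed
      moreover have "P dvd a * (b + d) - b * (a + c) - 1" using g(2) by algebra
      ultimately have "M a b (a + c) (b + d) \<in> H" using big by blast
      then have "M 1 0 (-1) 1 \<cdot> M a b (a + c) (b + d) \<in> H" using cl L by blast
      then show ?thesis by (simp add: mat2_mult g)
    qed
  qed
qed

lemma upper_triangular_subgroup: "subgroup {A \<in> carrier G. P dvd A $ 2 $ 1} G"
proof (rule subgroupI)
  let ?B = "{A \<in> carrier G. P dvd A $ 2 $ 1}"
  have B: "\<exists>a b d. A = M a b 0 d \<and> P dvd a * d - 1" if "A \<in> ?B" for A
  proof -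
    have "A \<in> carrier G" "P dvd A $ 2 $ 1" using that by auto
    then have A: "A = M (A $ 1 $ 1) (A $ 1 $ 2) (A $ 2 $ 1) (A $ 2 $ 2)" using mat2_self by blast
    also have "\<dots> = M (A $ 1 $ 1) (A $ 1 $ 2) 0 (A $ 2 $ 2)" using \<open>P dvd A $ 2 $ 1\<close> by (simp add: M_eq_iff)
    finally have A: "A = M (A $ 1 $ 1) (A $ 1 $ 2) 0 (A $ 2 $ 2)" .
    moreover have "P dvd (A $ 1 $ 1) * (A $ 2 $ 2) - 1"
      using \<open>A \<in> carrier G\<close> by (subst (asm) A) (simp only: carrier_iff, simp)
    ultimately show ?thesis by blast
  qed
  have B': "M a b 0 d \<in> ?B" if "P dvd a * d - 1" for a b d
    using that by (simp add: carrier_iff)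
  show "?B \<noteq> {}" using B'[of 1 1 0] by auto
  show "inv\<^bsub>G\<^esub> A \<in> ?B" if "A \<in> ?B" for A
  proof -
    obtain a b d where A: "A = M a b 0 d" "P dvd a * d - 1" using B[OF \<open>A \<in> ?B\<close>] by blast
    then have "inv\<^bsub>G\<^esub> A = M d (-b) 0 a" by (simp add: inv_M)
    then show ?thesis using B'[of d a "-b"] A by (simp add: mult.commute)
  qed
  show "A \<cdot> A' \<in> ?B" if AA: "A \<in> ?B" "A' \<in> ?B" for A A'
  proof -
    obtain a b d where A: "A = M a b 0 d" "P dvd a * d - 1" using B[OF AA(1)] by blast
    obtain a' b' d' where A': "A' = M a' b' 0 d'" "P dvd a' * d' - 1" using B[OF AA(2)] by blast
    have "A \<cdot> A' = M (a * a') (a * b' + b * d') 0 (d * d')" by (simp add: A A' mat2_mult)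
    moreover have "P dvd (a * a') * (d * d') - 1" using A(2) A'(2) by algebra
    ultimately show ?thesis using B' by simp
  qed
qed auto

text \<open>As \<open>H\<close> is proper, it consists of upper triangular matrices, which are determined by their first rows.
  The matrix \<open>x\<close> is not upper triangular, so conjugation by \<open>x\<close> takes no nontrivial upper transvection
  back into \<open>H\<close>; thus the \<open>p\<close> upper transvections lie in different cosets of \<open>conj_int H x\<close>.\<close>

lemma upper_case_bounds:
  assumes H: "subgroup H G" and proper: "H \<noteq> carrier G" and u: "M 1 \<alpha> 0 1 \<in> H" "\<not> P dvd \<alpha>"
    and x: "x \<in> carrier G" and gen: "generates_with H x"
  shows "card H \<le> p\<^sup>2 \<and> p * card (conj_int H x) \<le> card H"
proof
  note sc = subgroup.mem_carrier[OF H] and cl = subgroup.m_closed[OF H] and inv = subgroup.m_inv_closed[OF H]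
  have U: "M 1 t 0 1 \<in> H" for t using all_upper[OF H u] .
  have tri: "P dvd c" if "M a b c d \<in> H" for a b c d
    using subgroup_eq_carrier[OF H u that] proper by blast
  have "inj_on (\<lambda>A. (A $ 1 $ 1, A $ 1 $ 2)) H"
  proof (rule inj_onI)
    fix A B assume AB: "A \<in> H" "B \<in> H" "(A $ 1 $ 1, A $ 1 $ 2) = (B $ 1 $ 1, B $ 1 $ 2)"
    obtain a b c d where A: "A = M a b c d" "P dvd a * d - b * c - 1" using sc[OF AB(1)] by (rule SL2_cases)
    obtain a' b' c' d' where B: "B = M a' b' c' d'" "P dvd a' * d' - b' * c' - 1" using sc[OF AB(2)] by (rule SL2_cases)
    have c: "P dvd c" "P dvd c'" using tri AB A B by blast+
    have ab: "P dvd a - a'" "P dvd b - b'" using AB(3) A B by (auto simp: mod_eq_dvd_iff)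
    have "P dvd a * (d - d')" using A(2) B(2) c ab by algebra
    moreover have "\<not> P dvd a"
    proof
      assume "P dvd a"
      then have "P dvd 1" using A(2) c by algebra
      then show False using small_not_dvd[of 1] p_ge_5 by simp
    qed
    ultimately have "P dvd d - d'" using dvd_cancel by blast
    moreover have "P dvd c - c'" using c by simp
    ultimately show "A = B" using ab by (simp add: A B M_eq_iff)
  qed
  moreover have "(\<lambda>A. (A $ 1 $ 1, A $ 1 $ 2)) ` H \<subseteq> {0..<P} \<times> {0..<P}"
    using sc by (auto simp: SL2_def)
  ultimately have "card H \<le> card ({0..<P} \<times> {0..<P})" by (intro card_inj_on_le) auto
  then show "card H \<le> p\<^sup>2" by (simp add: card_cartesian_product power2_eq_square)
  have xl: "\<not> P dvd x $ 2 $ 1"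
  proof
    assume *: "P dvd x $ 2 $ 1"
    have "H \<subseteq> {A \<in> carrier G. P dvd A $ 2 $ 1}"
    proof
      fix A assume "A \<in> H"
      moreover from this have "P dvd A $ 2 $ 1" using tri mat2_self sc by metis
      ultimately show "A \<in> {A \<in> carrier G. P dvd A $ 2 $ 1}" using sc by blast
    qed
    then have "{A \<in> carrier G. P dvd A $ 2 $ 1} = carrier G"
      using gen upper_triangular_subgroup x * unfolding generates_with_def by blast
    moreover have "M 0 (-1) 1 0 \<in> carrier G" by (simp add: carrier_iff)
    ultimately have "P dvd (M 0 (-1) 1 0) $ 2 $ 1" by blast
    then show False using small_not_dvd[of 1] p_ge_5 by simp
  qed
  have UK: "P dvd t" if "M 1 t 0 1 \<in> conj_int H x" for t
  proof -
    obtain a b c d where X: "x = M a b c d" "P dvd a * d - b * c - 1" using x by (rule SL2_cases)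
    have "x \<cdot> M 1 t 0 1 \<cdot> inv\<^bsub>G\<^esub> x \<in> H" using that by (simp add: conj_int_def)
    moreover have "x \<cdot> M 1 t 0 1 \<cdot> inv\<^bsub>G\<^esub> x =
       M (a * d - (a * t + b) * c) (- a * b + (a * t + b) * a) (c * d - (c * t + d) * c) (- c * b + (c * t + d) * a)"
      using X by (simp add: inv_M mat2_mult algebra_simps)
    ultimately have "P dvd c * d - (c * t + d) * c" using tri by metis
    then have "P dvd c * (c * t)" by algebra
    moreover have "\<not> P dvd c" using xl X by (simp add: dvd_mod_iff)
    ultimately show "P dvd t" using dvd_cancel by blast
  qed
  note K = subgroup_conj_int[OF H x]
  have KH: "conj_int H x \<subseteq> H" by (auto simp: conj_int_def)
  let ?f = "\<lambda>(t, k). M 1 (int t) 0 1 \<cdot> k"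
  have Uc: "M 1 t 0 1 \<in> carrier G" for t by (simp add: carrier_iff)
  have "inj_on ?f ({..<p} \<times> conj_int H x)"
  proof (rule inj_onI)
    fix v w assume vw: "v \<in> {..<p} \<times> conj_int H x" "w \<in> {..<p} \<times> conj_int H x" "?f v = ?f w"
    obtain t k s l where e: "v = (t, k)" "w = (s, l)" by (cases v, cases w)
    have tk: "t < p" "s < p" "k \<in> conj_int H x" "l \<in> conj_int H x"
      "M 1 (int t) 0 1 \<cdot> k = M 1 (int s) 0 1 \<cdot> l" using vw by (auto simp: e)
    have kc: "k \<in> carrier G" "l \<in> carrier G" using tk KH sc by auto
    have "inv\<^bsub>G\<^esub> (M 1 (int s) 0 1) \<cdot> (M 1 (int t) 0 1 \<cdot> k) \<cdot> inv\<^bsub>G\<^esub> k =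
      inv\<^bsub>G\<^esub> (M 1 (int s) 0 1) \<cdot> (M 1 (int s) 0 1 \<cdot> l) \<cdot> inv\<^bsub>G\<^esub> k" using tk(5) by simp
    then have "inv\<^bsub>G\<^esub> (M 1 (int s) 0 1) \<cdot> M 1 (int t) 0 1 = l \<cdot> inv\<^bsub>G\<^esub> k"
      using kc Uc by (simp add: group_word_simps)
    moreover have "inv\<^bsub>G\<^esub> (M 1 (int s) 0 1) \<cdot> M 1 (int t) 0 1 = M 1 (int t - int s) 0 1"
      by (simp add: inv_M mat2_mult)
    moreover have "l \<cdot> inv\<^bsub>G\<^esub> k \<in> conj_int H x"
      using subgroup.m_closed[OF K] subgroup.m_inv_closed[OF K] tk by blast
    ultimately have "P dvd int t - int s" using UK by metis
    then have "t = s" using tk by (metis mod_eq_dvd_iff mod_less of_nat_eq_iff zmod_int)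
    then have "k = l" using tk(5) kc Uc inv_mult_cancel by metis
    then show "v = w" using \<open>t = s\<close> by (simp add: e)
  qed
  moreover have "?f ` ({..<p} \<times> conj_int H x) \<subseteq> H" using cl U KH by auto
  ultimately have "card ({..<p} \<times> conj_int H x) \<le> card H"
    using finite_subgroup[OF H] by (meson card_inj_on_le)
  then show "p * card (conj_int H x) \<le> card H" by (simp add: card_cartesian_product)
qed

end

context sl2 begin

lemma centre_conj: "z \<in> Z \<Longrightarrow> g \<in> carrier G \<Longrightarrow> conj_by g z = z"
  using centreD(1)[of z g, symmetric] centreD(2)[of z] by (simp add: conj_by_def) (simp add: m_assoc)

lemma centre_conj_iff: assumes "a \<in> carrier G" "g \<in> carrier G" shows "conj_by g a \<in> Z \<longleftrightarrow> a \<in> Z"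
proof
  assume "conj_by g a \<in> Z"
  then have "conj_by (inv\<^bsub>G\<^esub> g) (conj_by g a) \<in> Z" using centre_conj assms by simp
  then show "a \<in> Z" using assms by simp
qed (use centre_conj assms in simp)

text \<open>The trace is \<open>2 e\<close> with \<open>e = 1\<close> or \<open>e = -1\<close>, so \<open>e\<close> is the only eigenvalue. If \<open>c \<noteq> 0\<close>, then \<open>(a - e, c)\<close>
  is an eigenvector, and it becomes the first basis vector.\<close>

lemma parabolic_conj_upper:
  assumes "parabolic A"
  obtains g e \<beta> where "g \<in> carrier G" "conj_by g A = M e \<beta> 0 e" "P dvd e * e - 1" "\<not> P dvd \<beta>"
proof -
  have A: "A \<in> carrier G" "A \<notin> Z" using assms by (auto simp: parabolic_def)
  obtain a b c d where m: "A = M a b c d" "P dvd a * d - b * c - 1" using A(1) by (rule SL2_cases)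
  have "P dvd (a + d)\<^sup>2 - 4" using assms parabolic_iff[OF m(2)] m by simp
  then have "P dvd (a + d - 2) * (a + d + 2)" by algebra
  then obtain e where e: "P dvd a + d - 2 * e" "P dvd e * e - 1"
    using dvd_prod_cases[of "a + d - 2" "a + d + 2"] that[of 1] that[of "-1"] by auto
  have "\<exists>g \<in> carrier G. \<exists>\<beta>. conj_by g A = M e \<beta> 0 e"
  proof (cases "P dvd c")
    case True
    have "P dvd (a - e) * (a - e)" using m(2) True e by algebra
    then have ae: "P dvd a - e" using dvd_prod_cases by blast
    then have "P dvd d - e" using e(1) by algebra
    then have "A = M e b 0 e" using True ae by (simp add: m M_eq_iff)
    moreover have "conj_by \<one>\<^bsub>G\<^esub> A = A" using A by (simp add: conj_by_def)
    ultimately show ?thesis using one_closed by metis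
  next
    case False
    then obtain c' where c': "P dvd c * c' - 1" using inverse_mod by blast
    let ?g = "M 0 c' (-c) (a - e)"
    have g: "P dvd 0 * (a - e) - c' * (-c) - 1" using c' by (simp add: mult.commute)
    let ?D = "a * d - b * c - 1" and ?E = "e * e - 1" and ?T = "a + d - 2 * e" and ?C = "c * c' - 1"
    have "P dvd ?C * (a + d - e) + ?T" "P dvd c * (?D - ?E - e * ?T)" "P dvd e * ?C"
      by (rule dvd_add dvd_mult dvd_mult2 dvd_diff e c' m(2))+
    moreover have "?C * (a + d - e) + ?T = c' * c * (a - e) + c' * d * c - e"
      "c * (?D - ?E - e * ?T) = (a * c - e * c - c * a) * (a - e) + ((a - e) * d - c * b) * c"
      "e * ?C = (c * a - (a - e) * c) * c' - e" by (simp_all add: algebra_simps)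
    ultimately have 1: "P dvd c' * c * (a - e) + c' * d * c - e"
      "P dvd (a * c - e * c - c * a) * (a - e) + ((a - e) * d - c * b) * c"
      "P dvd (c * a - (a - e) * c) * c' - e" by simp_all
    have "conj_by ?g A = M e (c' * c * - c') 0 e"
      unfolding conj_by_def inv_M[OF g] m(1) mat2_mult M_eq_iff
      using 1 by (simp add: algebra_simps)
    then show ?thesis using g carrier_iff by metis
  qed
  then obtain g \<beta> where g: "g \<in> carrier G" "conj_by g A = M e \<beta> 0 e" by blast
  have "\<not> P dvd \<beta>"
  proof
    assume "P dvd \<beta>"
    then have "conj_by g A \<in> Z" using centre_iff[of e e \<beta> 0] e g by simp
    then show False using A g centre_conj_iff by blast
  qed
  then show ?thesis using that g e by simp
qed

text \<open>The square of the triangular conjugate is a nontrivial upper transvection, because the diagonal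
  entries are both 1 or both -1.\<close>

lemma parabolic_bounds:
  assumes H: "subgroup H G" and proper: "H \<noteq> carrier G" and A: "A \<in> H" "parabolic A"
    and x: "x \<in> carrier G" and gen: "generates_with H x"
  shows "card H \<le> p\<^sup>2 \<and> p * card (conj_int H x) \<le> card H"
proof -
  obtain g e \<beta> where g: "g \<in> carrier G" "conj_by g A = M e \<beta> 0 e" "P dvd e * e - 1" "\<not> P dvd \<beta>"
    using parabolic_conj_upper[OF A(2)] .
  let ?H = "conj_by g ` H"
  note sc = subgroup.mem_carrier[OF H]
  have sub: "subgroup ?H G" using subgroup_conj_image[OF H g(1)] .
  have card: "card (conj_by g ` L) = card L" if "L \<subseteq> carrier G" for L
    using that by (intro card_image inj_on_subset[OF inj_conj_by[OF g(1)]])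
  have "conj_by g A \<cdot> conj_by g A \<in> ?H" using A subgroup.m_closed[OF sub] by blast
  moreover have "conj_by g A \<cdot> conj_by g A = M 1 (2 * e * \<beta>) 0 1"
    unfolding g(2) mat2_mult M_eq_iff using g(3) by (simp add: algebra_simps)
  ultimately have u: "M 1 (2 * e * \<beta>) 0 1 \<in> ?H" by simp
  have "\<not> P dvd 2 * e * \<beta>"
  proof
    assume "P dvd 2 * e * \<beta>"
    then have "P dvd 2 * \<beta>" using g(3) by algebra
    then show False using g(4) not_dvd_2 dvd_cancel by blast
  qed
  moreover have "?H \<noteq> carrier G"
  proof
    assume "?H = carrier G"
    then have "card H = card (carrier G)" using card subgroup.subset[OF H] by metis
    then show False using proper card_subset_eq[OF finite_carrier subgroup.subset[OF H]] by simp
  qed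
  ultimately have "card ?H \<le> p\<^sup>2 \<and> p * card (conj_int ?H (conj_by g x)) \<le> card ?H"
    using upper_case_bounds[OF sub _ u] generates_with_conj[OF H x g(1) gen]
      conj_by_closed[OF g(1) x] by blast
  moreover have "conj_int H x \<subseteq> carrier G" using sc by (auto simp: conj_int_def)
  ultimately show ?thesis using conj_int_conj[OF H x g(1)] card subgroup.subset[OF H] by simp
qed

lemma normal_with_upper:
  assumes N: "subgroup N G" and nrm: "\<And>g n. g \<in> carrier G \<Longrightarrow> n \<in> N \<Longrightarrow> conj_by g n \<in> N"
    and u: "M 1 \<alpha> 0 1 \<in> N" "\<not> P dvd \<alpha>"
  shows "N = carrier G"
proof (rule subgroup_eq_carrier[OF N u])
  have "conj_by (M 0 (-1) 1 0) (M 1 \<alpha> 0 1) \<in> N" by (rule nrm) (use u in \<open>auto simp: carrier_iff\<close>)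
  moreover have "conj_by (M 0 (-1) 1 0) (M 1 \<alpha> 0 1) = M 1 0 (-\<alpha>) 1"
    by (simp add: conj_by_def inv_M mat2_mult)
  ultimately show "M 1 0 (-\<alpha>) 1 \<in> N" by simp
  show "\<not> P dvd - \<alpha>" using u by simp
qed

text \<open>A noncentral normal subgroup contains a matrix with \<open>c \<noteq> 0\<close>, and after conjugation one with \<open>a = 0\<close>.
  Commutators of such a matrix yield a transvection, and then all of them.\<close>

lemma normal_subgroup_SL2:
  assumes N: "subgroup N G" and nrm: "\<And>g n. g \<in> carrier G \<Longrightarrow> n \<in> N \<Longrightarrow> conj_by g n \<in> N"
    and nc: "\<not> N \<subseteq> Z"
  shows "N = carrier G"
proof -
  note cl = subgroup.m_closed[OF N] and inv = subgroup.m_inv_closed[OF N]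
  note sc = subgroup.mem_carrier[OF N]
  obtain g where g: "g \<in> N" "g \<notin> Z" using nc by blast
  obtain a b c d where m: "g = M a b c d" "P dvd a * d - b * c - 1" using sc[OF g(1)] by (rule SL2_cases)
  have "\<exists>a b c d. M a b c d \<in> N \<and> P dvd a * d - b * c - 1 \<and> \<not> P dvd c"
  proof (cases "P dvd c")
    case False then show ?thesis using g m by blast
  next
    case c: True
    show ?thesis
    proof (cases "P dvd b")
      case False
      have "conj_by (M 0 (-1) 1 0) g \<in> N" by (rule nrm) (use g in \<open>auto simp: carrier_iff\<close>)
      moreover have "conj_by (M 0 (-1) 1 0) g = M d (-c) (-b) a"
        by (simp add: conj_by_def inv_M mat2_mult m)
      moreover have "P dvd d * a - (-c) * (-b) - 1" using m(2) by algebra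
      ultimately show ?thesis using False by (metis dvd_minus_iff)
    next
      case True
      have "conj_by (M 1 0 1 1) g \<in> N" by (rule nrm) (use g in \<open>auto simp: carrier_iff\<close>)
      moreover have "conj_by (M 1 0 1 1) g = M (a - b) b (a + c - b - d) (b + d)"
        by (simp add: conj_by_def inv_M mat2_mult m algebra_simps)
      moreover have "P dvd (a - b) * (b + d) - b * (a + c - b - d) - 1" using m(2) by algebra
      moreover have "\<not> P dvd a + c - b - d"
      proof
        assume "P dvd a + c - b - d"
        then have "P dvd a - d" using c True by algebra
        then show False using centre_iff[OF m(2)] g m c True by simp
      qed
      ultimately show ?thesis by metis
    qed
  qed
  then obtain a b c d where h: "M a b c d \<in> N" "P dvd a * d - b * c - 1" "\<not> P dvd c" by blast
  obtain c' where c': "P dvd c * c' - 1" using inverse_mod[OF h(3)] .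
  let ?y = "M 0 (-c') c (a + d)"
  have "conj_by (M 1 (- a * c') 0 1) (M a b c d) \<in> N" by (rule nrm) (use h in \<open>auto simp: carrier_iff\<close>)
  moreover have "conj_by (M 1 (- a * c') 0 1) (M a b c d) = ?y"
    unfolding conj_by_def using h(2) c' by (simp add: inv_M mat2_mult M_eq_iff; intro conjI; algebra)
  ultimately have y: "?y \<in> N" by simp
  have ydet: "P dvd 0 * (a + d) - (- c') * c - 1" using c' by (simp add: mult.commute)
  have comm: "conj_by g (inv\<^bsub>G\<^esub> n) \<cdot> n \<in> N" if "g \<in> carrier G" "n \<in> N" for g n
    using that nrm inv cl by simp
  have comm': "n \<cdot> conj_by g (inv\<^bsub>G\<^esub> n) \<in> N" if "g \<in> carrier G" "n \<in> N" for g n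
    using that nrm inv cl by simp
  show ?thesis
  proof (cases "p = 5")
    case False
    have p7: "p \<ge> 7"
    proof -
      have "p \<noteq> 6" using prime_p by (auto simp: prime_nat_iff dest!: spec[of _ 2])
      then show ?thesis using False p_ge_5 by simp
    qed
    obtain h where h: "P dvd 2 * h - 1" using inverse_mod[OF not_dvd_2] .
    \<comment> \<open>The commutator with \<open>diag(2, 1/2)\<close> is upper triangular with diagonal \<open>(4, 1/4)\<close>, and the commutator
      of that with a transvection has the entry \<open>4\<^sup>2 - 1 = 15\<close>, which is nonzero for \<open>p \<ge> 7\<close>.\<close>
    let ?D = "M 2 0 0 h"
    have D: "P dvd 2 * h - 0 * 0 - 1" using h by simp
    have Dc: "?D \<in> carrier G" using D carrier_iff by blast
    let ?q = "3 * (a + d) * c'"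
    have "conj_by ?D (inv\<^bsub>G\<^esub> ?y) \<cdot> ?y = M 4 ?q 0 (h * h)"
    proof -
      have "P dvd 4 * (c * c' - 1)" "P dvd (a + d) * c' * (2 * h - 1)" "P dvd h * h * (c * c' - 1)"
        by (rule dvd_mult h c')+
      then show ?thesis
        unfolding conj_by_def inv_M[OF D] inv_M[OF ydet] mat2_mult M_eq_iff
        by (simp add: algebra_simps dvd_diff_commute)
    qed
    then have z: "M 4 ?q 0 (h * h) \<in> N" using comm[OF Dc y] by simp
    have zdet: "P dvd 4 * (h * h) - ?q * 0 - 1" using h by simp algebra
    have U: "M 1 1 0 1 \<in> carrier G" by (simp add: carrier_iff)
    have "M 4 ?q 0 (h * h) \<cdot> conj_by (M 1 1 0 1) (inv\<^bsub>G\<^esub> (M 4 ?q 0 (h * h))) = M 1 15 0 1"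
      unfolding conj_by_def inv_M[OF zdet] using h
      by (simp add: inv_M mat2_mult M_eq_iff; intro conjI; algebra)
    then have "M 1 15 0 1 \<in> N" using comm'[OF U z] by simp
    moreover have "\<not> P dvd 15"
    proof
      assume "P dvd 15"
      then have "P dvd 3 * 5" by simp
      then have "P dvd 3 \<or> P dvd 5" by (rule dvd_prod_cases)
      then show False using small_not_dvd p7 by auto
    qed
    ultimately show ?thesis using normal_with_upper[OF N nrm] by blast
  next
    case True
    then have P5: "P = 5" by simp
    \<comment> \<open>Modulo 5 the fourth power of every unit is 1. The commutator with the transvection by \<open>1/c\<close> has
      trace 3, which is -2 modulo 5, so it is parabolic.\<close>
    have U: "M 1 c' 0 1 \<in> carrier G" by (simp add: carrier_iff)
    have "?y \<cdot> conj_by (M 1 c' 0 1) (inv\<^bsub>G\<^esub> ?y) = M 1 (-c') (-c) 2"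
      unfolding conj_by_def inv_M[OF ydet] using c'
      by (simp add: inv_M mat2_mult M_eq_iff; intro conjI; algebra)
    then have z: "M 1 (-c') (-c) 2 \<in> N" using comm'[OF U y] by simp
    have zdet: "P dvd 1 * 2 - (-c') * (-c) - 1" using c' by algebra
    have "M 1 (-c') (-c) 2 \<notin> Z" using centre_iff[OF zdet] h(3) by simp
    moreover have "P dvd (1 + 2)\<^sup>2 - 4" by (simp add: P5)
    ultimately have "parabolic (M 1 (-c') (-c) 2)" using parabolic_iff[OF zdet] by blast
    from parabolic_conj_upper[OF this] obtain k e \<beta> where k: "k \<in> carrier G"
      "conj_by k (M 1 (-c') (-c) 2) = M e \<beta> 0 e" "P dvd e * e - 1" "\<not> P dvd \<beta>" .
    have "M e \<beta> 0 e \<in> N" using nrm[OF k(1) z] k(2) by simp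
    then have "M e \<beta> 0 e \<cdot> M e \<beta> 0 e \<in> N" using cl by blast
    moreover have "M e \<beta> 0 e \<cdot> M e \<beta> 0 e = M 1 (2 * e * \<beta>) 0 1"
      unfolding mat2_mult M_eq_iff using k(3) by (simp add: algebra_simps)
    ultimately have "M 1 (2 * e * \<beta>) 0 1 \<in> N" by simp
    moreover have "\<not> P dvd 2 * e * \<beta>"
    proof
      assume "P dvd 2 * e * \<beta>"
      then have "P dvd 2 * \<beta>" using k(3) by algebra
      then show False using k(4) not_dvd_2 dvd_cancel by blast
    qed
    ultimately show ?thesis using normal_with_upper[OF N nrm] by blast
  qed
qed

lemma p_dvd_order: "p dvd card (carrier G)"
proof -
  let ?U = "(\<lambda>t. M 1 t 0 1) ` {0..<P}"
  have U: "M 1 t 0 1 \<in> ?U" for t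
  proof -
    have "M 1 t 0 1 = M 1 (t mod P) 0 1" by (simp add: mat2_eq_iff cong_def)
    moreover have "t mod P \<in> {0..<P}" using p_ge_5 by simp
    ultimately show ?thesis by blast
  qed
  have "subgroup ?U G"
  proof (rule subgroupI)
    show "?U \<subseteq> carrier G" by (auto simp: carrier_iff)
    show "?U \<noteq> {}" using U by blast
    show "inv\<^bsub>G\<^esub> a \<in> ?U" if "a \<in> ?U" for a using that U by (auto simp: inv_M)
    show "a \<cdot> b \<in> ?U" if "a \<in> ?U" "b \<in> ?U" for a b using that U by (auto simp: mat2_mult)
  qed
  from lagrange[OF this] have "card ?U dvd card (carrier G)" by (metis dvd_triv_right order_def)
  moreover have "inj_on (\<lambda>t. M 1 t 0 1) {0..<P}"
    by (rule inj_onI) (simp add: mat2_eq_iff cong_def)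
  ultimately show ?thesis by (simp add: card_image)
qed

lemma involution_central:
  assumes "h \<in> carrier G" "h \<cdot> h = \<one>\<^bsub>G\<^esub>" shows "h \<in> Z"
proof -
  obtain a b c d where m: "h = M a b c d" "P dvd a * d - b * c - 1" using assms(1) by (rule SL2_cases)
  have "inv\<^bsub>G\<^esub> h = h" using assms inv_equality by blast
  then have "P dvd d - a" "P dvd - b - b" "P dvd - c - c" using inv_M[OF m(2)] by (auto simp: m M_eq_iff)
  then have "P dvd a - d" "P dvd 2 * b" "P dvd 2 * c" by algebra+
  then show ?thesis using centre_iff[OF m(2)] m not_dvd_2 dvd_cancel by blast
qed

end

context group begin

lemma normalizer_is_subgroup:
  assumes "L \<subseteq> carrier G" shows "subgroup {g \<in> carrier G. conj_by g ` L = L} G"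
proof (rule subgroupI)
  let ?N = "{g \<in> carrier G. conj_by g ` L = L}"
  have one: "conj_by \<one> ` L = L"
  proof -
    have "conj_by \<one> l = l" if "l \<in> L" for l using that assms by (auto simp: conj_by_def)
    then show ?thesis by simp
  qed
  then show "?N \<noteq> {}" by blast
  have comp: "conj_by (g \<otimes> h) ` L = conj_by g ` (conj_by h ` L)" if "g \<in> carrier G" "h \<in> carrier G" for g h
  proof -
    have "conj_by (g \<otimes> h) l = conj_by g (conj_by h l)" if "l \<in> L" for l
      using that \<open>g \<in> carrier G\<close> \<open>h \<in> carrier G\<close> assms by (auto simp: conj_by_def group_word_simps)
    then show ?thesis by (force simp: image_iff)
  qed
  show "inv g \<in> ?N" if "g \<in> ?N" for g
  proof -
    have "conj_by (inv g) ` L = conj_by (inv g) ` (conj_by g ` L)" using that by simp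
    also have "\<dots> = L" using comp[of "inv g" g] that one by simp
    finally show ?thesis using that by simp
  qed
  show "g \<otimes> h \<in> ?N" if "g \<in> ?N" "h \<in> ?N" for g h using that comp[of g h] by simp
qed auto

end

text \<open>The class equation applies to every subgroup without parabolic elements.\<close>

lemma (in sl2) dickson_groupI:
  assumes H: "subgroup H G" and np: "\<And>a. a \<in> H \<Longrightarrow> \<not> parabolic a"
  shows "dickson_group G H (Z \<inter> H)"
  unfolding dickson_group_def dickson_group_axioms_def
proof (intro conjI allI impI)
  show "Group.group G" by (rule is_group)
  note sc = subgroup.mem_carrier[OF H]
  show "subgroup H G" by fact
  show "finite H" using finite_subgroup[OF H] .
  show "subgroup (Z \<inter> H) G" using subgroups_Inter_pair[OF subgroup_centre H] .
  show "Z \<inter> H \<subseteq> H" by blast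
  show "z \<cdot> h = h \<cdot> z" if "z \<in> Z \<inter> H" "h \<in> H" for z h using that centreD(1) sc by blast
  show "b \<cdot> c = c \<cdot> b" if "a \<in> H" "a \<notin> Z \<inter> H" "b \<in> H" "c \<in> H"
    "a \<cdot> b = b \<cdot> a" "a \<cdot> c = c \<cdot> a" for a b c
    using commute_trans_SL2[of a b c] that sc by blast
  show "g \<cdot> a \<cdot> inv\<^bsub>G\<^esub> g = a \<or> g \<cdot> a \<cdot> inv\<^bsub>G\<^esub> g = inv\<^bsub>G\<^esub> a"
    if "a \<in> H" "a \<notin> Z \<inter> H" "g \<in> H"
    "(g \<cdot> a \<cdot> inv\<^bsub>G\<^esub> g) \<cdot> a = a \<cdot> (g \<cdot> a \<cdot> inv\<^bsub>G\<^esub> g)" for a g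
    using conj_commute_SL2[of a g] that sc np by blast
qed


context sl2 begin

section \<open>The binary octahedral group\<close>

lemma normal_centre: "Z \<lhd> G"
  using subgroup_centre centre_conj by (auto simp: normal_inv_iff conj_by_def)

lemma group_PSL2: "group (PSL2 p)"
  unfolding PSL2_def using normal.factorgroup_is_group[OF normal_centre] .

lemma centre_coset: assumes "g \<in> carrier G" shows "card (Z #>\<^bsub>G\<^esub> g) = 2"
proof -
  have "Z #>\<^bsub>G\<^esub> g = (\<lambda>z. z \<cdot> g) ` Z" by (auto simp: r_coset_def)
  moreover have "inj_on (\<lambda>z. z \<cdot> g) Z" using assms centreD(2) by (intro inj_onI) simp
  ultimately show ?thesis using card_centre card_image by metis
qed

text \<open>The fibres of the projection to \<open>PSL(2,p)\<close> have two elements.\<close>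

lemma iso_2S4_card:
  assumes "iso_2S4 p (G\<lparr>carrier := H\<rparr>)" shows "card H = 48"
proof -
  obtain L where L: "subgroup L (PSL2 p)" "PSL2 p\<lparr>carrier := L\<rparr> \<cong> sym_group 4"
    "G\<lparr>carrier := H\<rparr> \<cong> G\<lparr>carrier := PSL2_preimage p L\<rparr>"
    using assms by (auto simp: iso_2S4_def)
  let ?P = "PSL2_preimage p L"
  have "card L = card (carrier (sym_group 4))"
    using L(2) by (auto simp: is_iso_def iso_def dest: bij_betw_same_card)
  then have cL: "card L = 24" by (simp add: sym_group_card_carrier fact_numeral)
  have "card H = card ?P" using L(3) by (auto simp: is_iso_def iso_def dest: bij_betw_same_card)
  also have "card ?P = card ((\<lambda>g. Z #>\<^bsub>G\<^esub> g) ` ?P) * 2"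
  proof (rule card_eq_fibres)
    show "finite ?P" using finite_carrier by (auto simp: PSL2_preimage_def)
    fix X assume "X \<in> (\<lambda>g. Z #>\<^bsub>G\<^esub> g) ` ?P"
    then obtain g where g: "g \<in> carrier G" "Z #>\<^bsub>G\<^esub> g \<in> L" "X = Z #>\<^bsub>G\<^esub> g" by (auto simp: PSL2_preimage_def)
    have "{h \<in> ?P. Z #>\<^bsub>G\<^esub> h = X} = X"
    proof (intro equalityI subsetI)
      fix h assume "h \<in> {h \<in> ?P. Z #>\<^bsub>G\<^esub> h = X}"
      then show "h \<in> X" using rcos_self[OF _ subgroup_centre, of h] by (auto simp: PSL2_preimage_def)
    next
      fix h assume h: "h \<in> X"
      then have "Z #>\<^bsub>G\<^esub> h = X" using repr_independence[OF _ g(1) subgroup_centre, of h] g(3) by simp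
      moreover have "h \<in> carrier G" using h g r_coset_subset_G[OF subgroup.subset[OF subgroup_centre]] by blast
      ultimately show "h \<in> {h \<in> ?P. Z #>\<^bsub>G\<^esub> h = X}" using g by (simp add: PSL2_preimage_def)
    qed
    then show "card {h \<in> ?P. Z #>\<^bsub>G\<^esub> h = X} = 2" using centre_coset g by simp
  qed
  also have "(\<lambda>g. Z #>\<^bsub>G\<^esub> g) ` ?P = L"
  proof (intro equalityI subsetI)
    fix X assume X: "X \<in> L"
    then have "X \<in> rcosets\<^bsub>G\<^esub> Z" using subgroup.subset[OF L(1)] by (auto simp: PSL2_def FactGroup_def)
    then obtain g where "g \<in> carrier G" "X = Z #>\<^bsub>G\<^esub> g" by (auto simp: RCOSETS_def)
    then show "X \<in> (\<lambda>g. Z #>\<^bsub>G\<^esub> g) ` ?P" using X by (auto simp: PSL2_preimage_def)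
  qed (auto simp: PSL2_preimage_def)
  finally show ?thesis using cL by simp
qed

text \<open>A subgroup that contains the centre is the full preimage of its image in \<open>PSL(2,p)\<close>.\<close>

lemma iso_2S4I:
  assumes H: "subgroup H G" and ZH: "Z \<subseteq> H" and iso: "(G\<lparr>carrier := H\<rparr>) Mod Z \<cong> sym_group 4"
  shows "iso_2S4 p (G\<lparr>carrier := H\<rparr>)"
proof -
  let ?L = "rcosets\<^bsub>G\<lparr>carrier := H\<rparr>\<^esub> Z"
  have eq: "PSL2 p\<lparr>carrier := ?L\<rparr> = (G\<lparr>carrier := H\<rparr>) Mod Z"
    by (simp add: PSL2_def FactGroup_def set_mult_def fun_eq_iff)
  have L: "X \<in> ?L \<longleftrightarrow> (\<exists>h\<in>H. X = Z #>\<^bsub>G\<^esub> h)" for X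
    by (simp add: RCOSETS_def r_coset_def)
  have "Z \<lhd> G\<lparr>carrier := H\<rparr>" using normal_restrict_supergroup[OF H normal_centre ZH] .
  then have "group (PSL2 p\<lparr>carrier := ?L\<rparr>)" unfolding eq by (rule normal.factorgroup_is_group)
  moreover have "?L \<subseteq> carrier (PSL2 p)"
    using L subgroup.mem_carrier[OF H] by (auto simp: PSL2_def FactGroup_def RCOSETS_def)
  ultimately have "subgroup ?L (PSL2 p)" using group.group_incl_imp_subgroup[OF group_PSL2] by blast
  moreover have "PSL2_preimage p ?L = H"
  proof (intro equalityI subsetI)
    fix g assume "g \<in> PSL2_preimage p ?L"
    then obtain h where g: "g \<in> carrier G" "h \<in> H" "Z #>\<^bsub>G\<^esub> g = Z #>\<^bsub>G\<^esub> h"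
      by (auto simp: PSL2_preimage_def L)
    then have "g \<in> Z #>\<^bsub>G\<^esub> h" using rcos_self[OF _ subgroup_centre] by blast
    then show "g \<in> H" using ZH g(2) subgroup.m_closed[OF H] by (auto simp: r_coset_def)
  next
    fix h assume "h \<in> H"
    then show "h \<in> PSL2_preimage p ?L" using L subgroup.mem_carrier[OF H] by (auto simp: PSL2_preimage_def)
  qed
  ultimately show ?thesis unfolding iso_2S4_def using iso eq iso_refl by metis
qed

end

text \<open>An action on an \<open>n\<close>-element set, transported to \<open>{1..n}\<close> by the enumeration \<open>e\<close>.\<close>

lemma sym_group_hom_of_action:
  fixes A :: "'b set" and act :: "'a \<Rightarrow> 'b \<Rightarrow> 'b"
  assumes e: "bij_betw e A {1..n}" and act: "\<And>g. g \<in> carrier L \<Longrightarrow> bij_betw (act g) A A"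
    and mult: "\<And>g h X. \<lbrakk>g \<in> carrier L; h \<in> carrier L; X \<in> A\<rbrakk> \<Longrightarrow> act (g \<otimes>\<^bsub>L\<^esub> h) X = act g (act h X)"
  obtains \<phi> where "\<phi> \<in> hom L (sym_group n)"
    "\<And>g h. \<lbrakk>g \<in> carrier L; h \<in> carrier L\<rbrakk> \<Longrightarrow> \<phi> g = \<phi> h \<longleftrightarrow> (\<forall>X\<in>A. act g X = act h X)"
proof -
  define \<phi> where "\<phi> = (\<lambda>g i. if i \<in> {1..n} then e (act g (inv_into A e i)) else i)"
  have e_mem: "e X \<in> {1..n}" if "X \<in> A" for X using e that by (auto simp: bij_betw_def)
  have inv_mem: "inv_into A e i \<in> A" if "i \<in> {1..n}" for i using e that by (metis bij_betw_def inv_into_into)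
  have e_inv: "e (inv_into A e i) = i" if "i \<in> {1..n}" for i using e that by (metis bij_betw_def f_inv_into_f)
  have inv_e: "inv_into A e (e X) = X" if "X \<in> A" for X using e that by (metis bij_betw_def inv_into_f_f)
  have act_mem: "act g X \<in> A" if "g \<in> carrier L" "X \<in> A" for g X using act that by (auto simp: bij_betw_def)
  have perm: "\<phi> g permutes {1..n}" if g: "g \<in> carrier L" for g
  proof (rule bij_imp_permutes)
    have "bij_betw (e \<circ> act g \<circ> inv_into A e) {1..n} {1..n}"
      using e act[OF g] bij_betw_inv_into[OF e] by (auto intro: bij_betw_trans)
    then show "bij_betw (\<phi> g) {1..n} {1..n}"
      by (rule bij_betw_cong[THEN iffD1, rotated]) (simp add: \<phi>_def)
  qed (simp only: \<phi>_def if_False)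
  have 1: "\<phi> \<in> hom L (sym_group n)"
  proof (rule homI)
    show "\<phi> g \<in> carrier (sym_group n)" if "g \<in> carrier L" for g using perm that by (simp add: sym_group_carrier)
    show "\<phi> (g \<otimes>\<^bsub>L\<^esub> h) = \<phi> g \<otimes>\<^bsub>sym_group n\<^esub> \<phi> h" if gh: "g \<in> carrier L" "h \<in> carrier L" for g h
    proof
      fix i show "\<phi> (g \<otimes>\<^bsub>L\<^esub> h) i = (\<phi> g \<otimes>\<^bsub>sym_group n\<^esub> \<phi> h) i"
      proof (cases "i \<in> {1..n}")
        case True
        note m = act_mem[OF gh(2) inv_mem[OF True]]
        have "\<phi> h i = e (act h (inv_into A e i))" using True by (simp only: \<phi>_def if_True)
        moreover have "\<phi> g (e (act h (inv_into A e i))) = e (act g (act h (inv_into A e i)))"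
          using e_mem[OF m] inv_e[OF m] by (simp only: \<phi>_def if_True)
        moreover have "\<phi> (g \<otimes>\<^bsub>L\<^esub> h) i = e (act g (act h (inv_into A e i)))"
          using True mult[OF gh inv_mem[OF True]] by (simp only: \<phi>_def if_True)
        ultimately show ?thesis by (simp add: sym_group_mult)
      next
        case False then show ?thesis by (simp only: \<phi>_def if_False sym_group_mult o_apply)
      qed
    qed
  qed
  have 2: "\<forall>X\<in>A. act g X = act h X" if gh: "g \<in> carrier L" "h \<in> carrier L" "\<phi> g = \<phi> h" for g h
  proof
    fix X assume X: "X \<in> A"
    have "\<phi> g (e X) = \<phi> h (e X)" using gh by simp
    then have "e (act g X) = e (act h X)" using e_mem[OF X] inv_e[OF X] by (simp only: \<phi>_def if_True)
    then show "act g X = act h X" using inv_e[OF act_mem[OF gh(1) X]] inv_e[OF act_mem[OF gh(2) X]] by metis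
  qed
  have 3: "\<phi> g = \<phi> h" if "\<forall>X\<in>A. act g X = act h X" for g h
  proof
    fix i show "\<phi> g i = \<phi> h i"
      using that inv_mem[of i] by (cases "i \<in> {1..n}") (simp_all only: \<phi>_def if_True if_False)
  qed
  show ?thesis by (rule that[OF 1]) (use 2 3 in blast)
qed


text \<open>The case of order 24 modulo the centre in the class equation: the centraliser of \<open>a\<close> has order 3 and
  its normaliser has order 6 modulo the centre, so \<open>a\<close> has four conjugate centralisers. The symmetric
  group of degree 4 arises as the group of permutations of these.\<close>

locale octahedral_subgroup = sl2 +
  fixes H :: "(int^2^2) set" and a :: "int^2^2"
  assumes oct_sub: "subgroup H (SL2 p)" and oct_centre: "group_centre (SL2 p) \<subseteq> H"
    and oct_nonparabolic: "h \<in> H \<Longrightarrow> \<not> parabolic h"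
    and oct_card: "card H = 48"
    and oct_elt: "a \<in> H" "a \<notin> group_centre (SL2 p)"
    and oct_cent: "card {h \<in> H. a \<cdot> h = h \<cdot> a} = 6"
    and oct_norm: "card {g \<in> H. a \<cdot> conj_by g a = conj_by g a \<cdot> a} = 12"
begin

sublocale dickson_group "SL2 p" H "group_centre (SL2 p)"
proof -
  have "Z \<inter> H = Z" using oct_centre by blast
  then show "dickson_group G H Z" using dickson_groupI[OF oct_sub oct_nonparabolic] by simp
qed

lemma cent_carrier: "h \<in> cent b \<Longrightarrow> h \<in> carrier G"
  by (simp add: cent_def)

lemma conj_H [simp]: "g \<in> H \<Longrightarrow> h \<in> H \<Longrightarrow> conj_by g h \<in> H"
  by (simp add: conj_by_def)

lemma norm_cent_conj_by: "norm_cent a = {g \<in> H. a \<cdot> conj_by g a = conj_by g a \<cdot> a}"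
  by (simp add: norm_cent_def conj_by_def)

lemma conj_by_conj_by:
  "\<lbrakk>u \<in> H; v \<in> H; h \<in> H\<rbrakk> \<Longrightarrow> conj_by u (conj_by v h) = conj_by (u \<cdot> v) h"
  by (simp add: conj_by_def group_word_simps)

lemma conj_by_one [simp]: "h \<in> H \<Longrightarrow> conj_by \<one>\<^bsub>G\<^esub> h = h"
  by (simp add: conj_by_def)

lemma conj_notin_centre: "\<lbrakk>g \<in> H; h \<in> H; h \<notin> Z\<rbrakk> \<Longrightarrow> conj_by g h \<notin> Z"
  using centre_conj_iff by simp

lemma conj_cent_subset:
  assumes "g \<in> H" "b \<in> H" shows "conj_by g ` cent b \<subseteq> cent (conj_by g b)"
proof
  fix w assume "w \<in> conj_by g ` cent b"
  then obtain h where h: "h \<in> H" "b \<cdot> h = h \<cdot> b" "w = conj_by g h" by (auto simp: cent_def)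
  have "conj_by g b \<cdot> conj_by g h = conj_by g h \<cdot> conj_by g b"
    using conj_commute[OF h(2), of g] h(1) assms by (simp add: conj_by_def)
  then show "w \<in> cent (conj_by g b)" using assms h by (simp add: cent_def)
qed

lemma conj_cent: assumes g: "g \<in> H" and b: "b \<in> H" shows "conj_by g ` cent b = cent (conj_by g b)"
proof
  show "conj_by g ` cent b \<subseteq> cent (conj_by g b)" using conj_cent_subset assms .
  show "cent (conj_by g b) \<subseteq> conj_by g ` cent b"
  proof
    fix h assume h: "h \<in> cent (conj_by g b)"
    then have hH: "h \<in> H" using cent_subset by blast
    have "conj_by (inv\<^bsub>G\<^esub> g) h \<in> cent b"
      using conj_cent_subset[of "inv\<^bsub>G\<^esub> g" "conj_by g b"] g b h by auto
    moreover have "h = conj_by g (conj_by (inv\<^bsub>G\<^esub> g) h)" using g hH by simp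
    ultimately show "h \<in> conj_by g ` cent b" by blast
  qed
qed

lemma cent_eq:
  assumes b: "b \<in> H" "b \<notin> Z" and c: "c \<in> cent b" "c \<notin> Z" shows "cent b = cent c"
proof -
  have cH: "c \<in> H" "b \<cdot> c = c \<cdot> b" using c by (auto simp: cent_def)
  have bc: "b \<in> cent c" using b cH by (simp add: cent_def)
  show ?thesis
  proof (intro equalityI subsetI)
    fix h assume h: "h \<in> cent b"
    then show "h \<in> cent c" using cent_abelian[OF b c(1) h] cent_subset by (auto simp: cent_def)
  next
    fix h assume h: "h \<in> cent c"
    then show "h \<in> cent b" using cent_abelian[OF cH(1) c(2) bc h] cent_subset by (auto simp: cent_def)
  qed
qed

text \<open>The centralisers of the conjugates of \<open>a\<close>, which are the four Sylow 3-subgroups modulo the centre.\<close>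

definition tori :: "(int^2^2) set set" where
  "tori = (\<lambda>g. cent (conj_by g a)) ` H"

lemma toriE:
  assumes "B \<in> tori"
  obtains b where "b \<in> H" "b \<notin> Z" "B = cent b" "card B = 6"
proof -
  obtain g where g: "g \<in> H" "B = cent (conj_by g a)" using assms unfolding tori_def by blast
  have "card B = card (conj_by g ` cent a)" using conj_cent[OF g(1) oct_elt(1)] g by simp
  also have "\<dots> = card (cent a)"
    using cent_carrier g by (intro card_image inj_on_subset[OF inj_conj_by]) auto
  also have "\<dots> = 6" using oct_cent by (simp add: cent_def)
  finally show ?thesis using that[of "conj_by g a"] g oct_elt conj_notin_centre by simp
qed

lemma tori_subset: "B \<in> tori \<Longrightarrow> B \<subseteq> H"
  using cent_subset by (auto simp: tori_def)

lemma tori_carrier: "B \<in> tori \<Longrightarrow> h \<in> B \<Longrightarrow> h \<in> carrier G"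
  using tori_subset[of B] by auto

lemma cent_a_in_tori: "cent a \<in> tori"
proof -
  have "cent (conj_by \<one>\<^bsub>G\<^esub> a) \<in> tori" unfolding tori_def by (rule imageI) simp
  then show ?thesis using oct_elt by simp
qed

lemma card_tori: "card tori = 4"
proof -
  have "card H = card tori * 12"
    unfolding tori_def
  proof (rule card_eq_fibres)
    show "finite H" by (rule fin_H)
    fix B assume "B \<in> (\<lambda>g. cent (conj_by g a)) ` H"
    then obtain g0 where g0: "g0 \<in> H" "B = cent (conj_by g0 a)" by blast
    have "bij_betw (\<lambda>m. g0 \<cdot> m) (norm_cent a) {g \<in> H. cent (conj_by g a) = B}"
    proof (rule bij_betwI')
      fix m m' assume "m \<in> norm_cent a" "m' \<in> norm_cent a"
      then show "(g0 \<cdot> m = g0 \<cdot> m') = (m = m')" using g0 by (auto simp: norm_cent_def)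
    next
      fix m assume "m \<in> norm_cent a"
      then have m: "m \<in> H" "conj_by m a \<in> cent a" using oct_elt by (auto simp: norm_cent_conj_by cent_def)
      have "cent (conj_by m a) = cent a"
        using cent_eq[OF oct_elt m(2)] conj_notin_centre[OF m(1) oct_elt] by simp
      then have "cent (conj_by (g0 \<cdot> m) a) = B"
        using conj_cent[of g0 "conj_by m a"] conj_cent[of g0 a] g0 m oct_elt
        by (simp add: conj_by_conj_by)
      then show "g0 \<cdot> m \<in> {g \<in> H. cent (conj_by g a) = B}" using g0 m by simp
    next
      fix g assume "g \<in> {g \<in> H. cent (conj_by g a) = B}"
      then have g: "g \<in> H" "cent (conj_by g a) = cent (conj_by g0 a)" using g0 by auto
      let ?m = "inv\<^bsub>G\<^esub> g0 \<cdot> g"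
      have "conj_by g a \<in> cent (conj_by g0 a)" using self_cent[of "conj_by g a"] g oct_elt by simp
      then have "conj_by (inv\<^bsub>G\<^esub> g0) (conj_by g a) \<in> cent (conj_by (inv\<^bsub>G\<^esub> g0) (conj_by g0 a))"
        using conj_cent[of "inv\<^bsub>G\<^esub> g0" "conj_by g0 a"] g0 oct_elt by auto
      then have "conj_by ?m a \<in> cent a" using g g0 oct_elt by (simp add: conj_by_conj_by)
      then have "?m \<in> norm_cent a" using g g0 by (simp add: norm_cent_conj_by cent_def)
      moreover have "g = g0 \<cdot> ?m" using g g0 by (simp add: group_word_simps)
      ultimately show "\<exists>m\<in>norm_cent a. g = g0 \<cdot> m" by blast
    qed
    from bij_betw_same_card[OF this] show "card {g \<in> H. cent (conj_by g a) = B} = 12"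
      using oct_norm norm_cent_conj_by by simp
  qed
  then show ?thesis using oct_card by simp
qed

text \<open>Otherwise the centre and \<open>y\<close> would generate a subgroup of order 4 in a group of order 6.\<close>

lemma central_square:
  assumes B: "B \<in> tori" and y: "y \<in> B" "y \<cdot> y \<in> Z" shows "y \<in> Z"
proof (rule ccontr)
  assume yZ: "y \<notin> Z"
  obtain b where b: "b \<in> H" "b \<notin> Z" "B = cent b" "card B = 6" using B by (rule toriE)
  have subB: "subgroup B G" using subgroup_cent b by simp
  have yc: "y \<in> carrier G" using tori_carrier[OF B y(1)] .
  note Zcl = subgroup.m_closed[OF subgroup_centre] and Zinv = subgroup.m_inv_closed[OF subgroup_centre]
  have comm: "y \<cdot> z = z \<cdot> y" if "z \<in> Z" for z using centreD(1)[OF that yc] by simp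
  let ?Y = "Z \<union> (\<lambda>z. z \<cdot> y) ` Z"
  have "subgroup ?Y G"
  proof (rule subgroupI)
    show "?Y \<subseteq> carrier G" using yc by auto
    show "?Y \<noteq> {}" using subgroup.one_closed[OF subgroup_centre] by blast
    fix w assume w: "w \<in> ?Y"
    show "inv\<^bsub>G\<^esub> w \<in> ?Y"
    proof (cases "w \<in> Z")
      case False
      then obtain z where z: "z \<in> Z" "w = z \<cdot> y" using w by blast
      have "w = y \<cdot> z" using z comm by simp
      then have "inv\<^bsub>G\<^esub> w = inv\<^bsub>G\<^esub> z \<cdot> inv\<^bsub>G\<^esub> y" using z(1) yc by (simp add: inv_mult_group)
      also have "inv\<^bsub>G\<^esub> y = inv\<^bsub>G\<^esub> (y \<cdot> y) \<cdot> y" using yc by (simp add: group_word_simps)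
      also have "inv\<^bsub>G\<^esub> z \<cdot> \<dots> = (inv\<^bsub>G\<^esub> z \<cdot> inv\<^bsub>G\<^esub> (y \<cdot> y)) \<cdot> y"
        using z(1) yc by (simp add: m_assoc)
      finally show ?thesis using Zcl[OF Zinv[OF z(1)] Zinv[OF y(2)]] by blast
    qed (use Zinv in blast)
    fix v assume v: "v \<in> ?Y"
    have 1: "(z \<cdot> y) \<cdot> z' = (z \<cdot> z') \<cdot> y" if "z \<in> Z" "z' \<in> Z" for z z'
      using that yc comm[OF that(2)] by (simp add: m_assoc)
    have 2: "(z \<cdot> y) \<cdot> (z' \<cdot> y) = (z \<cdot> z') \<cdot> (y \<cdot> y)" if "z \<in> Z" "z' \<in> Z" for z z'
      using 1[OF that] that yc by (simp add: m_assoc[symmetric])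
    have 3: "z \<cdot> (z' \<cdot> y) = (z \<cdot> z') \<cdot> y" if "z \<in> Z" "z' \<in> Z" for z z'
      using that yc by (simp add: m_assoc)
    from w v show "w \<cdot> v \<in> ?Y"
    proof (elim UnE imageE)
      fix z z' assume "z \<in> Z" "w = z \<cdot> y" "z' \<in> Z" "v = z' \<cdot> y"
      then have "w \<cdot> v \<in> Z" using 2[of z z'] Zcl[OF Zcl[of z z'] y(2)] by simp
      then show ?thesis by blast
    qed (use 1 3 Zcl in blast)+
  qed
  moreover have "?Y \<subseteq> B"
  proof -
    have "Z \<subseteq> B" using Z_subset_cent b by simp
    then show ?thesis using subgroup.m_closed[OF subB] y(1) by blast
  qed
  ultimately have "card ?Y dvd 6" using card_subgroup_dvd[OF _ subB] b(4) by metis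
  moreover have "card ?Y = 4"
  proof -
    have "card ((\<lambda>z. z \<cdot> y) ` Z) = 2"
      using card_centre yc by (subst card_image) (auto intro!: inj_onI)
    moreover have "Z \<inter> (\<lambda>z. z \<cdot> y) ` Z = {}"
    proof -
      have "y \<in> Z" if z: "z \<in> Z" "z \<cdot> y \<in> Z" for z
      proof -
        have "inv\<^bsub>G\<^esub> z \<cdot> (z \<cdot> y) \<in> Z" using z Zcl Zinv by blast
        then show ?thesis using z yc by (simp add: group_word_simps)
      qed
      then show ?thesis using yZ by blast
    qed
    ultimately show ?thesis using card_centre fin_Z by (simp add: card_Un_disjoint)
  qed
  ultimately show False by simp
qed

definition tori_kernel :: "(int^2^2) set" where
  "tori_kernel = {g \<in> H. \<forall>B\<in>tori. conj_by g ` B = B}"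

lemma tori_action_mult:
  assumes "u \<in> H" "v \<in> H" "B \<in> tori" shows "conj_by (u \<cdot> v) ` B = conj_by u ` (conj_by v ` B)"
proof -
  have "conj_by (u \<cdot> v) l = conj_by u (conj_by v l)" if "l \<in> B" for l
    using conj_by_conj_by assms that tori_subset by (metis subsetD)
  then show ?thesis by (simp add: image_image)
qed

lemma tori_action_one: "B \<in> tori \<Longrightarrow> conj_by \<one>\<^bsub>G\<^esub> ` B = B"
  using tori_subset by (force simp: image_iff)

lemma tori_action_closed: assumes "u \<in> H" "B \<in> tori" shows "conj_by u ` B \<in> tori"
proof -
  obtain g where g: "g \<in> H" "B = cent (conj_by g a)" using assms(2) unfolding tori_def by blast
  have "conj_by u ` B = cent (conj_by (u \<cdot> g) a)"
    using conj_cent[of u "conj_by g a"] assms(1) g oct_elt by (simp add: conj_by_conj_by)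
  then show ?thesis using assms(1) g unfolding tori_def by simp
qed

text \<open>The element \<open>g\<close> normalises the centraliser of \<open>b\<close> without centralising \<open>b\<close>, so it conjugates \<open>b\<close> to
  the only other element of that centraliser with the same trace.\<close>

lemma inverts_torus:
  assumes g: "g \<in> tori_kernel" and b: "b \<in> H" "b \<notin> Z" "cent b \<in> tori" "g \<notin> cent b"
  shows "conj_by g b = inv\<^bsub>G\<^esub> b"
proof -
  have gH: "g \<in> H" using g by (simp add: tori_kernel_def)
  have "conj_by g b \<in> cent b" using g b(3) self_cent[OF b(1)] by (auto simp: tori_kernel_def)
  then have "conj_by g b \<cdot> b = b \<cdot> conj_by g b" by (simp add: cent_def)
  then have "conj_by g b = b \<or> conj_by g b = inv\<^bsub>G\<^esub> b"
    using commute_conj[OF b(1,2) gH] by (simp add: conj_by_def)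
  moreover have "conj_by g b \<noteq> b"
  proof
    assume "conj_by g b = b"
    then have "conj_by g b \<cdot> g = b \<cdot> g" by simp
    then have "b \<cdot> g = g \<cdot> b" using gH b(1) by (simp add: conj_by_def m_assoc)
    then show False using b(4) gH by (simp add: cent_def)
  qed
  ultimately show ?thesis by blast
qed

text \<open>Otherwise \<open>g\<close> inverts a noncentral element of another torus, so the square of \<open>g\<close> lies in both tori.
  It is therefore central, against \<open>central_square\<close>.\<close>

lemma kernel_element_in_torus:
  assumes g: "g \<in> tori_kernel" and B: "B \<in> tori" "g \<in> B" shows "g \<in> Z"
proof (rule ccontr)
  assume gZ: "g \<notin> Z"
  have gH: "g \<in> H" using g by (simp add: tori_kernel_def)
  have "tori \<noteq> {B}" using card_tori by auto
  then obtain B' where B': "B' \<in> tori" "B' \<noteq> B" using B(1) by blast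
  obtain b where b: "b \<in> H" "b \<notin> Z" "B = cent b" using B(1) by (rule toriE)
  obtain b' where b': "b' \<in> H" "b' \<notin> Z" "B' = cent b'" using B'(1) by (rule toriE)
  have BB': "y \<in> Z" if "y \<in> B" "y \<in> B'" for y
    using cent_eq[OF b(1,2), of y] cent_eq[OF b'(1,2), of y] that b(3) b'(3) B'(2) by blast
  have "g \<notin> cent b'" using BB' B(2) b'(3) gZ by blast
  then have inv: "conj_by g b' = inv\<^bsub>G\<^esub> b'" using inverts_torus[OF g b'(1,2)] b'(3) B'(1) by simp
  have "conj_by (g \<cdot> g) b' = conj_by g (conj_by g b')" using gH b'(1) by (simp add: conj_by_conj_by)
  also have "\<dots> = b'" using inv conj_by_inv[of g b'] gH b'(1) by simp
  finally have "conj_by (g \<cdot> g) b' \<cdot> (g \<cdot> g) = b' \<cdot> (g \<cdot> g)" by simp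
  moreover have "conj_by (g \<cdot> g) b' \<cdot> (g \<cdot> g) = (g \<cdot> g) \<cdot> b'"
    using gH b'(1) by (simp add: conj_by_def group_word_simps)
  ultimately have "g \<cdot> g \<in> B'" using gH b'(3) by (simp add: cent_def)
  moreover have "g \<cdot> g \<in> B" using B(2) b(3) subgroup.m_closed[OF subgroup_cent[OF b(1)]] by simp
  ultimately show False using BB' central_square[OF B] gZ by blast
qed

lemma kernel_closed:
  "u \<in> tori_kernel \<Longrightarrow> inv\<^bsub>G\<^esub> u \<in> tori_kernel"
  "u \<in> tori_kernel \<Longrightarrow> v \<in> tori_kernel \<Longrightarrow> u \<cdot> v \<in> tori_kernel"
  "h \<in> H \<Longrightarrow> u \<in> tori_kernel \<Longrightarrow> conj_by h u \<in> tori_kernel"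
proof -
  show "inv\<^bsub>G\<^esub> u \<in> tori_kernel" if "u \<in> tori_kernel" for u
  proof -
    have u: "u \<in> H" "\<forall>B\<in>tori. conj_by u ` B = B" using that by (auto simp: tori_kernel_def)
    have "conj_by (inv\<^bsub>G\<^esub> u) ` B = B" if "B \<in> tori" for B
      using tori_action_mult[of "inv\<^bsub>G\<^esub> u" u B] u tori_action_one that by simp
    then show ?thesis using u by (simp add: tori_kernel_def)
  qed
  show "u \<cdot> v \<in> tori_kernel" if "u \<in> tori_kernel" "v \<in> tori_kernel" for u v
    using that tori_action_mult by (auto simp: tori_kernel_def)
  show "conj_by h u \<in> tori_kernel" if "h \<in> H" "u \<in> tori_kernel" for h u
  proof -
    have u: "u \<in> H" "\<forall>B\<in>tori. conj_by u ` B = B" using \<open>u \<in> tori_kernel\<close> by (auto simp: tori_kernel_def)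
    have "conj_by (conj_by h u) ` B = B" if B: "B \<in> tori" for B
    proof -
      let ?B = "conj_by (inv\<^bsub>G\<^esub> h) ` B"
      have BA: "?B \<in> tori" using tori_action_closed \<open>h \<in> H\<close> B by simp
      have "conj_by (conj_by h u) ` B = conj_by (h \<cdot> u) ` ?B"
        using tori_action_mult[of "h \<cdot> u" "inv\<^bsub>G\<^esub> h" B] \<open>h \<in> H\<close> u(1) B by (simp add: conj_by_def)
      also have "\<dots> = conj_by h ` ?B" using tori_action_mult[OF \<open>h \<in> H\<close> u(1) BA] u(2) BA by simp
      also have "\<dots> = B" using tori_action_mult[of h "inv\<^bsub>G\<^esub> h" B] tori_action_one[OF B] \<open>h \<in> H\<close> B by simp
      finally show ?thesis .
    qed
    then show ?thesis using u \<open>h \<in> H\<close> by (simp add: tori_kernel_def)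
  qed
qed

text \<open>A kernel element \<open>g\<close> outside \<open>cent a\<close> inverts \<open>a\<close>, so the commutator of \<open>a\<close> and \<open>g\<close> is \<open>a\<^sup>2\<close>. It is a
  kernel element in \<open>cent a\<close> and hence central, which is impossible for \<open>a\<close>.\<close>

lemma tori_kernel_eq: "tori_kernel = Z"
proof (intro equalityI subsetI)
  fix z assume z: "z \<in> Z"
  have "conj_by z ` B = B" if "B \<in> tori" for B
  proof -
    have "conj_by z l = l" if "l \<in> B" for l
    proof -
      have l: "l \<in> carrier G" using tori_carrier[OF \<open>B \<in> tori\<close> that] .
      then have "conj_by z l = l \<cdot> z \<cdot> inv\<^bsub>G\<^esub> z" using centreD(1)[OF z] by (simp add: conj_by_def)
      then show ?thesis using l z by (simp add: m_assoc)
    qed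
    then show ?thesis by simp
  qed
  then show "z \<in> tori_kernel" using z oct_centre by (auto simp: tori_kernel_def)
next
  fix g assume g: "g \<in> tori_kernel"
  have gc: "g \<in> H" "a \<in> H" using g oct_elt by (auto simp: tori_kernel_def)
  show "g \<in> Z"
  proof (cases "g \<in> cent a")
    case True then show ?thesis using kernel_element_in_torus[OF g cent_a_in_tori] by simp
  next
    case False
    have inv: "conj_by g a = inv\<^bsub>G\<^esub> a" using inverts_torus[OF g oct_elt cent_a_in_tori False] .
    have "a \<cdot> a = conj_by a (inv\<^bsub>G\<^esub> (inv\<^bsub>G\<^esub> g)) \<cdot> inv\<^bsub>G\<^esub> g"
    proof -
      have "conj_by a (inv\<^bsub>G\<^esub> (inv\<^bsub>G\<^esub> g)) \<cdot> inv\<^bsub>G\<^esub> g = a \<cdot> inv\<^bsub>G\<^esub> (conj_by g a)"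
        using gc by (simp add: conj_by_def group_word_simps)
      then show ?thesis using inv gc by simp
    qed
    then have "a \<cdot> a \<in> tori_kernel" using kernel_closed g gc by simp
    moreover have "a \<cdot> a \<in> cent a" using gc by (simp add: cent_def m_assoc)
    ultimately have "a \<cdot> a \<in> Z" using kernel_element_in_torus[OF _ cent_a_in_tori] by blast
    then have "a \<in> Z" using central_square[OF cent_a_in_tori self_cent] gc by blast
    then show ?thesis using oct_elt by blast
  qed
qed

theorem octahedral_iso: "iso_2S4 p (G\<lparr>carrier := H\<rparr>)"
proof (rule iso_2S4I[OF oct_sub oct_centre])
  let ?L = "G\<lparr>carrier := H\<rparr>"
  have "finite tori" using fin_H by (simp add: tori_def)
  then obtain e where e: "bij_betw e tori {1..4::nat}"
    using card_tori by (metis bij_betw_iff_card card_atLeastAtMost diff_Suc_1 finite_atLeastAtMost)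
  let ?act = "\<lambda>g B. conj_by g ` B"
  have act: "bij_betw (?act g) tori tori" if g: "g \<in> H" for g
  proof (rule bij_betw_byWitness[where f' = "?act (inv\<^bsub>G\<^esub> g)"])
    show "\<forall>B\<in>tori. ?act (inv\<^bsub>G\<^esub> g) (?act g B) = B" "\<forall>B\<in>tori. ?act g (?act (inv\<^bsub>G\<^esub> g) B) = B"
      using tori_action_mult[of "inv\<^bsub>G\<^esub> g" g] tori_action_mult[of g "inv\<^bsub>G\<^esub> g"] tori_action_one g by simp_all
    show "?act g ` tori \<subseteq> tori" "?act (inv\<^bsub>G\<^esub> g) ` tori \<subseteq> tori" using tori_action_closed g by auto
  qed
  have actL: "\<And>g. g \<in> carrier ?L \<Longrightarrow> bij_betw (?act g) tori tori" using act by simp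
  have multL: "\<And>g h X. \<lbrakk>g \<in> carrier ?L; h \<in> carrier ?L; X \<in> tori\<rbrakk> \<Longrightarrow> ?act (g \<otimes>\<^bsub>?L\<^esub> h) X = ?act g (?act h X)"
    using tori_action_mult by simp
  obtain \<phi> where hom: "\<phi> \<in> hom ?L (sym_group 4)"
    "\<And>g h. \<lbrakk>g \<in> carrier ?L; h \<in> carrier ?L\<rbrakk> \<Longrightarrow> \<phi> g = \<phi> h \<longleftrightarrow> (\<forall>X\<in>tori. ?act g X = ?act h X)"
    using sym_group_hom_of_action[OF e actL multL] by blast
  interpret L: group ?L using subgroup_imp_group[OF oct_sub] .
  interpret S: group "sym_group 4" by (rule sym_group_is_group)
  interpret phi: group_hom ?L "sym_group 4" \<phi> by unfold_locales (rule hom(1))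
  have one: "\<phi> g = \<phi> \<one>\<^bsub>G\<^esub> \<longleftrightarrow> g \<in> tori_kernel" if "g \<in> H" for g
    using hom(2)[of g "\<one>\<^bsub>G\<^esub>"] that tori_action_one by (simp add: tori_kernel_def)
  have ker: "kernel ?L (sym_group 4) \<phi> = Z"
    unfolding kernel_def using one phi.hom_one oct_centre by (auto simp: tori_kernel_eq)
  have "card H = card (\<phi> ` H) * 2"
  proof (rule card_eq_fibres)
    fix y assume "y \<in> \<phi> ` H"
    then obtain g0 where g0: "g0 \<in> H" "y = \<phi> g0" by blast
    have "{g \<in> H. \<phi> g = y} = (\<lambda>z. g0 \<cdot> z) ` Z"
    proof (intro equalityI subsetI)
      fix g assume "g \<in> {g \<in> H. \<phi> g = y}"
      then have g: "g \<in> H" "\<phi> g = \<phi> g0" using g0 by auto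
      have "\<phi> (inv\<^bsub>G\<^esub> g0 \<cdot> g) = \<phi> (inv\<^bsub>G\<^esub> g0 \<cdot> g0)"
        using phi.hom_mult[of "inv\<^bsub>G\<^esub> g0" g] phi.hom_mult[of "inv\<^bsub>G\<^esub> g0" g0] g g0 by simp
      then have "inv\<^bsub>G\<^esub> g0 \<cdot> g \<in> Z" using one[of "inv\<^bsub>G\<^esub> g0 \<cdot> g"] g g0 by (simp add: tori_kernel_eq)
      moreover have "g = g0 \<cdot> (inv\<^bsub>G\<^esub> g0 \<cdot> g)" using g g0 by (simp add: group_word_simps)
      ultimately show "g \<in> (\<lambda>z. g0 \<cdot> z) ` Z" by blast
    next
      fix g assume "g \<in> (\<lambda>z. g0 \<cdot> z) ` Z"
      then obtain z where z: "z \<in> Z" "g = g0 \<cdot> z" by blast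
      have zH: "z \<in> H" using z oct_centre by blast
      have "\<phi> z = \<phi> \<one>\<^bsub>G\<^esub>" using one[OF zH] z tori_kernel_eq by simp
      then have "\<phi> g = \<phi> (g0 \<cdot> \<one>\<^bsub>G\<^esub>)"
        using phi.hom_mult[of g0 z] phi.hom_mult[of g0 "\<one>\<^bsub>G\<^esub>"] g0 zH z by simp
      then show "g \<in> {g \<in> H. \<phi> g = y}" using g0 z zH by simp
    qed
    then show "card {g \<in> H. \<phi> g = y} = 2"
      using g0 card_centre by (simp add: card_image inj_on_def)
  qed (rule fin_H)
  then have "card (\<phi> ` H) = 24" using oct_card by simp
  moreover have "card (carrier (sym_group 4)) = 24" by (simp add: sym_group_card_carrier fact_numeral)
  moreover have "\<phi> ` H \<subseteq> carrier (sym_group 4)" using phi.hom_closed by auto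
  moreover have "finite (carrier (sym_group 4))"
    using \<open>card (carrier (sym_group 4)) = 24\<close> by (metis card.infinite zero_neq_numeral)
  ultimately have "\<phi> ` carrier ?L = carrier (sym_group 4)" by (simp add: card_subset_eq)
  from phi.FactGroup_iso[OF this] show "?L Mod Z \<cong> sym_group 4" by (simp add: ker)
qed

end

section \<open>A proper subgroup that generates together with one element\<close>

locale sl2_pair = sl2 +
  fixes H :: "(int^2^2) set" and x :: "int^2^2"
  assumes sub_H: "subgroup H (SL2 p)" and proper: "H \<noteq> carrier (SL2 p)"
    and x_carrier: "x \<in> carrier (SL2 p)" and gen: "generates_with H x"
begin

abbreviation "K \<equiv> conj_int H x"

lemmas H_carrier = subgroup.mem_carrier[OF sub_H]
lemmas sub_K = subgroup_conj_int[OF sub_H x_carrier]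
lemmas fin_H = finite_subgroup[OF sub_H]
lemmas fin_K = finite_subgroup[OF sub_K]

lemmas H_m_closed = subgroup.m_closed[OF sub_H]
lemmas H_inv_closed = subgroup.m_inv_closed[OF sub_H]
lemmas H_one = subgroup.one_closed[OF sub_H]

lemma K_subset: "K \<subseteq> H" by (auto simp: conj_int_def)

lemma conj_x_K: "k \<in> K \<Longrightarrow> conj_by x k \<in> H" by (auto simp: conj_int_def conj_by_def)

text \<open>The normaliser of \<open>L\<close> contains \<open>H\<close> and \<open>x\<close>, so \<open>L\<close> is normal in \<open>SL(2,p)\<close>.\<close>

lemma normalised_cases:
  assumes L: "subgroup L G" and h: "\<And>h. h \<in> H \<Longrightarrow> conj_by h ` L \<subseteq> L" and x: "conj_by x ` L \<subseteq> L"
  shows "L = carrier G \<or> L \<subseteq> Z"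
proof -
  have Lc: "L \<subseteq> carrier G" using subgroup.subset[OF L] .
  have eq: "conj_by g ` L = L" if "conj_by g ` L \<subseteq> L" "g \<in> carrier G" for g
    using that finite_subgroup[OF L] card_image[OF inj_on_subset[OF inj_conj_by Lc]]
    by (intro card_subset_eq) auto
  have "{g \<in> carrier G. conj_by g ` L = L} = carrier G"
    using gen normalizer_is_subgroup[OF Lc] eq h x H_carrier x_carrier
    unfolding generates_with_def by blast
  then have "conj_by g n \<in> L" if "g \<in> carrier G" "n \<in> L" for g n using that by blast
  then show ?thesis using normal_subgroup_SL2[OF L] by blast
qed

lemma not_all_central: "\<not> (H \<subseteq> Z \<and> x \<in> Z)"
proof
  assume "H \<subseteq> Z \<and> x \<in> Z"
  then have "Z = carrier G" using gen subgroup_centre unfolding generates_with_def by blast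
  moreover have "M 1 1 0 1 \<in> carrier G" by (simp add: carrier_iff)
  moreover have "M 1 1 0 1 \<notin> Z" using centre_iff[of 1 1 1 0] small_not_dvd[of 1] p_ge_5 by simp
  ultimately show False by simp
qed

text \<open>Otherwise \<open>H\<close> and \<open>x\<close> would generate an abelian group.\<close>

lemma H_not_central: "\<not> H \<subseteq> Z"
proof
  assume HZ: "H \<subseteq> Z"
  have "subgroup {g \<in> carrier G. x \<cdot> g = g \<cdot> x} G"
    using centraliser_is_subgroup[OF x_carrier] .
  moreover have "H \<subseteq> {g \<in> carrier G. x \<cdot> g = g \<cdot> x}"
    using HZ centreD(1)[OF _ x_carrier] H_carrier by force
  ultimately have "{g \<in> carrier G. x \<cdot> g = g \<cdot> x} = carrier G"
    using gen x_carrier unfolding generates_with_def by blast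
  then have "x \<in> Z" using x_carrier by (auto simp: group_centre_def)
  then show False using HZ not_all_central by blast
qed

lemma K_neq_H: "K \<noteq> H"
proof
  assume "K = H"
  then have "conj_by x ` H \<subseteq> H" using conj_x_K by blast
  moreover have "conj_by h ` H \<subseteq> H" if "h \<in> H" for h
    using that subgroup.m_closed[OF sub_H] subgroup.m_inv_closed[OF sub_H] by (auto simp: conj_by_def)
  ultimately show False using normalised_cases[OF sub_H] proper H_not_central by blast
qed

lemma index_K: obtains k where "card H = k * card K" "k \<ge> 2" "card K \<ge> 1"
proof -
  obtain k where k: "card H = card K * k" using card_subgroup_dvd[OF sub_K sub_H K_subset] by (auto elim: dvdE)
  have "card K < card H" using K_subset K_neq_H fin_H by (simp add: psubset_card_mono psubset_eq)
  then have "k \<ge> 2" using k by (cases k; cases "k - 1") auto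
  moreover have "card K \<ge> 1" using subgroup.one_closed[OF sub_K] fin_K
    by (metis One_nat_def Suc_leI card_gt_0_iff empty_iff)
  ultimately show ?thesis using that k by (simp add: mult.commute)
qed

text \<open>By transitivity of commuting, the centraliser of \<open>a\<close> would be normalised by \<open>H\<close> and \<open>x\<close>. A normal
  subgroup with the noncentral element \<open>a\<close> is all of \<open>SL(2,p)\<close>, and \<open>a\<close> would be central.\<close>

lemma no_invariant_centraliser:
  assumes a: "a \<in> carrier G" "a \<notin> Z"
    and h: "\<And>h. h \<in> H \<Longrightarrow> a \<cdot> conj_by h a = conj_by h a \<cdot> a"
    and x: "a \<cdot> conj_by x a = conj_by x a \<cdot> a"
  shows False
proof -
  let ?T = "{g \<in> carrier G. a \<cdot> g = g \<cdot> a}"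
  have inv_T: "conj_by y ` ?T \<subseteq> ?T" if y: "y \<in> carrier G" "a \<cdot> conj_by y a = conj_by y a \<cdot> a" for y
  proof
    fix w assume "w \<in> conj_by y ` ?T"
    then obtain g where g: "g \<in> carrier G" "a \<cdot> g = g \<cdot> a" "w = conj_by y g" by blast
    have "conj_by y a \<cdot> conj_by y g = conj_by y g \<cdot> conj_by y a"
      using conj_by_mult[of y a g] conj_by_mult[of y g a] g y a by simp
    moreover have "conj_by y a \<cdot> a = a \<cdot> conj_by y a" using y(2) by simp
    ultimately have "a \<cdot> conj_by y g = conj_by y g \<cdot> a"
      using commute_trans_SL2[of "conj_by y a" a "conj_by y g"] centre_conj_iff[OF a(1) y(1)] a g y by simp
    then show "w \<in> ?T" using g y by simp
  qed
  have "?T = carrier G \<or> ?T \<subseteq> Z"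
    using normalised_cases[OF centraliser_is_subgroup[OF a(1)]] inv_T h x H_carrier x_carrier by blast
  moreover have "a \<in> ?T" using a by simp
  ultimately have "?T = carrier G" using a by blast
  then have "a \<in> Z" using a(1) by (auto simp: group_centre_def)
  then show False using a by simp
qed

lemma card_Z_Int: "card (Z \<inter> H) \<in> {1, 2}"
proof -
  have "card (Z \<inter> H) \<le> 2" using card_centre card_mono[of Z "Z \<inter> H"] by (metis Int_lower1 card.infinite zero_neq_numeral)
  moreover have "\<one>\<^bsub>G\<^esub> \<in> Z \<inter> H" using subgroup.one_closed[OF subgroup_centre] subgroup.one_closed[OF sub_H] by blast
  then have "card (Z \<inter> H) \<noteq> 0" using fin_H by (metis card_eq_0_iff empty_iff finite_Int)
  ultimately show ?thesis by auto
qed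

text \<open>Passing from \<open>K\<close> to \<open>K \<inter> A\<close> and then to the part that \<open>x\<close> conjugates into \<open>A\<close> costs a factor of at most
  2 each time, and what is left is central.\<close>

lemma half_abelian_card_K:
  assumes A: "subgroup A G" "A \<subseteq> H" "\<And>b c. b \<in> A \<Longrightarrow> c \<in> A \<Longrightarrow> b \<cdot> c = c \<cdot> b"
    and nrm: "\<And>h b. h \<in> H \<Longrightarrow> b \<in> A \<Longrightarrow> conj_by h b \<in> A" and half: "card H \<le> 2 * card A"
  shows "card K \<le> 8"
proof -
  have Apos: "card A > 0" using finite_subgroup[OF A(1)] subgroup.one_closed[OF A(1)] by (auto simp: card_gt_0_iff)
  have two: "card L \<le> 2 * card (L \<inter> A)" if L: "subgroup L G" "L \<subseteq> H" for L
  proof -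
    have "card L * card A \<le> card H * card (L \<inter> A)"
      using card_subgroup_Int_ge[OF sub_H L(1) A(1) fin_H L(2) A(2)] .
    also have "\<dots> \<le> 2 * card A * card (L \<inter> A)" using half by simp
    finally show ?thesis using Apos by simp
  qed
  let ?B = "K \<inter> A"
  have subB: "subgroup ?B G" using subgroups_Inter_pair[OF sub_K A(1)] .
  let ?L = "conj_by x ` ?B"
  have L: "subgroup ?L G" "?L \<subseteq> H" using subgroup_conj_image[OF subB x_carrier] conj_x_K by auto
  have cL: "card ?L = card ?B"
    using inj_conj_by[OF x_carrier] subgroup.subset[OF subB] by (intro card_image) (rule inj_on_subset)
  have "?L \<inter> A \<subseteq> Z"
  proof
    fix y assume "y \<in> ?L \<inter> A"
    then obtain a where a: "a \<in> A" "y = conj_by x a" "conj_by x a \<in> A" by blast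
    have ac: "a \<in> carrier G" using subgroup.mem_carrier[OF A(1) a(1)] .
    have "a \<in> Z"
    proof (rule ccontr)
      assume "a \<notin> Z"
      then show False using no_invariant_centraliser[OF ac] nrm A(3) a by blast
    qed
    then show "y \<in> Z" using centre_conj x_carrier a by simp
  qed
  then have "card (?L \<inter> A) \<le> 2" using card_centre card_mono[of Z "?L \<inter> A"] by (metis card.infinite zero_neq_numeral)
  then show ?thesis using two[OF sub_K K_subset] two[OF L] cL by linarith
qed

text \<open>The alternatives are the parabolic case, the cyclic and dihedral case, and the three exceptional orders
  12, 24 and 60 modulo the part of the centre in \<open>H\<close>. In the last case, let \<open>z \<le> 2\<close> be the order of that
  part. If \<open>k\<close> were 3 or 4, then \<open>K\<close> would have \<open>20 z\<close> or \<open>15 z\<close> elements. But the abelian subgroups of \<open>K\<close>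
  have at most \<open>5 z\<close> elements, so none has index at most 2; and 12, 24 or 60 times the order of the centre
  part of \<open>K\<close> is never \<open>20 z\<close> or \<open>15 z\<close>.\<close>

theorem pair_cases:
  obtains k where "card H = k * card K" "k \<ge> 2" "card K \<ge> 1"
    "(5 \<le> k \<and> card H \<le> k\<^sup>2) \<or> card K \<le> 8 \<or> card H \<in> {12, 24} \<or> (card H = 48 \<and> (\<exists>a. octahedral_subgroup p H a)) \<or>
     (card H \<in> {60, 120} \<and> k \<noteq> 3 \<and> k \<noteq> 4)"
proof -
  obtain k where k: "card H = k * card K" "k \<ge> 2" "card K \<ge> 1" using index_K .
  have "(5 \<le> k \<and> card H \<le> k\<^sup>2) \<or> card K \<le> 8 \<or> card H \<in> {12, 24} \<or> (card H = 48 \<and> (\<exists>a. octahedral_subgroup p H a)) \<or>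
     (card H \<in> {60, 120} \<and> k \<noteq> 3 \<and> k \<noteq> 4)"
  proof (cases "\<exists>a\<in>H. parabolic a")
    case True
    then obtain a where "a \<in> H" "parabolic a" by blast
    from parabolic_bounds[OF sub_H proper this x_carrier gen]
    have b: "card H \<le> p\<^sup>2" "p * card K \<le> card H" by auto
    then have "p \<le> k" using k by simp
    then have "card H \<le> k\<^sup>2" "5 \<le> k" using b(1) p_ge_5 power_mono[of p k 2] by linarith+
    then show ?thesis by blast
  next
    case np: False
    interpret D: dickson_group G H "Z \<inter> H" using dickson_groupI[OF sub_H] np by blast
    show ?thesis
    proof (cases rule: D.dickson)
      case half
      then obtain A where "subgroup A G" "A \<subseteq> H" "\<forall>b\<in>A. \<forall>c\<in>A. b \<cdot> c = c \<cdot> b"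
        "\<forall>h\<in>H. \<forall>b\<in>A. h \<cdot> b \<cdot> inv\<^bsub>G\<^esub> h \<in> A" "card H \<le> 2 * card A"
        unfolding D.splits_half_def by blast
      then have "card K \<le> 8" using half_abelian_card_K[of A] unfolding conj_by_def by blast
      then show ?thesis by blast
    next
      case T
      then show ?thesis using card_Z_Int by auto
    next
      case (O a)
      show ?thesis
      proof (cases "card (Z \<inter> H) = 2")
        case True
        then have "Z \<inter> H = Z" using card_centre by (intro card_subset_eq) (auto intro: card_ge_0_finite)
        moreover have "D.cent a = {h \<in> H. a \<cdot> h = h \<cdot> a}"
          "D.norm_cent a = {g \<in> H. a \<cdot> conj_by g a = conj_by g a \<cdot> a}"
          unfolding D.cent_def D.norm_cent_def conj_by_def by auto
        ultimately have "octahedral_subgroup p H a"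
          unfolding octahedral_subgroup_def octahedral_subgroup_axioms_def
          using O True np sl2_axioms sub_H by auto
        then show ?thesis using O True by auto
      next
        case False
        then show ?thesis using O(1) card_Z_Int by auto
      qed
    next
      case I
      have "k \<noteq> 3 \<and> k \<noteq> 4"
      proof (rule ccontr)
        assume "\<not> (k \<noteq> 3 \<and> k \<noteq> 4)"
        then have "60 * card (Z \<inter> H) = 3 * card K \<or> 60 * card (Z \<inter> H) = 4 * card K" using k(1) I(1) by auto
        then have m: "card K = 20 * card (Z \<inter> H) \<or> card K = 15 * card (Z \<inter> H)" by linarith
        interpret E: dickson_group G K "Z \<inter> K" using dickson_groupI[OF sub_K] np K_subset by blast
        have "Z \<inter> K \<subseteq> Z \<inter> H" using K_subset by blast
        then have zK: "card (Z \<inter> K) \<le> card (Z \<inter> H)" using fin_H by (intro card_mono) auto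
        have "card (Z \<inter> K) \<ge> 1" using E.card_Z_pos by simp
        then have zK1: "card (Z \<inter> K) = 1 \<or> card (Z \<inter> K) = 2" using zK card_Z_Int by auto
        show False
        proof (cases rule: E.dickson)
          case half
          then obtain A where A: "subgroup A G" "A \<subseteq> K" "\<forall>b\<in>A. \<forall>c\<in>A. b \<cdot> c = c \<cdot> b"
            "card K \<le> 2 * card A"
            unfolding E.splits_half_def by blast
          have "card A \<le> 5 * card (Z \<inter> H)"
          proof (cases "A \<subseteq> Z")
            case True
            then have "A \<subseteq> Z \<inter> H" using A(2) K_subset by blast
            then have "card A \<le> card (Z \<inter> H)" using fin_H by (intro card_mono) auto
            then show ?thesis by simp
          next
            case False
            then obtain a where a: "a \<in> A" "a \<notin> Z" by blast
            then have "A \<subseteq> D.cent a" using A(2,3) K_subset unfolding D.cent_def by blast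
            then have "card A \<le> card (D.cent a)" using D.fin_cent by (intro card_mono)
            also have "\<dots> \<le> 5 * card (Z \<inter> H)" using I(2)[of a] a A(2) K_subset by blast
            finally show ?thesis .
          qed
          then show False using m A(4) card_Z_Int by auto
        next
          case T
          then show False using m zK zK1 card_Z_Int by auto
        next
          case (O a)
          from O(1) show False using m zK zK1 card_Z_Int by auto
        next
          case I
          from I(1) show False using m zK zK1 card_Z_Int by auto
        qed
      qed
      then show ?thesis using I(1) card_Z_Int by auto
    qed
  qed
  then show ?thesis using that k by blast
qed

end

section \<open>Double cosets and the size of the triple product\<close>

text \<open>As \<open>7 ^ 8 < 2 ^ 23\<close>, the exponent \<open>1 + \<delta>\<close> is at most \<open>21/16\<close>.\<close>

lemma powr_less_of_power_less:
  fixes y X :: nat and \<delta> :: real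
  assumes "\<delta> = (log 2 7 - 1) / 6" "y \<ge> 1" "y ^ 21 < X ^ 16"
  shows "real y powr (1 + \<delta>) < real X"
proof -
  have "8 * log 2 7 = log 2 (7 ^ 8)" by (simp only: log_nat_power)
  also have "\<dots> \<le> log 2 (2 ^ 23)" by (subst log_le_cancel_iff) simp_all
  also have "\<dots> = 23" by (subst log_pow_cancel) simp_all
  finally have "log 2 7 \<le> 23/8" by simp
  then have "1 + \<delta> \<le> 21/16" using assms(1) by simp
  then have "real y powr (1 + \<delta>) \<le> real y powr (21/16)" using assms(2) by (intro powr_mono) simp_all
  moreover have "real y powr (21/16) < real X"
  proof (rule power_less_imp_less_base[of _ 16])
    have "(real y powr (21/16)) ^ 16 = real y powr (real 16 * (21/16))"
      using assms(2) by (subst powr_power) (auto simp: mult.commute)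
    also have "\<dots> = real y powr 21" by simp
    also have "\<dots> = real (y ^ 21)" by simp
    also have "\<dots> < real (X ^ 16)" using assms(3) by (simp only: of_nat_less_iff)
    finally show "(real y powr (21/16)) ^ 16 < real X ^ 16" by simp
  qed simp
  ultimately show ?thesis by linarith
qed

context group begin

definition double_coset :: "'a set \<Rightarrow> 'a \<Rightarrow> 'a set" where
  "double_coset H x = (\<lambda>(h, h'). h \<otimes> x \<otimes> h') ` (H \<times> H)"

lemma double_cosetI: "h \<in> H \<Longrightarrow> h' \<in> H \<Longrightarrow> h \<otimes> x \<otimes> h' \<in> double_coset H x"
  unfolding double_coset_def by (rule image_eqI[of _ _ "(h, h')"]) auto

lemma double_cosetE:
  assumes "y \<in> double_coset H x" obtains h h' where "h \<in> H" "h' \<in> H" "y = h \<otimes> x \<otimes> h'"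
  using assms unfolding double_coset_def by auto

text \<open>The factorisations of a fixed element as \<open>h x h'\<close> differ by elements of \<open>conj_int H x\<close>.\<close>

lemma card_double_coset:
  assumes H: "subgroup H G" and fin: "finite H" and x: "x \<in> carrier G"
  shows "card (double_coset H x) * card (conj_int H x) = card H * card H"
proof -
  note sc = subgroup.mem_carrier[OF H] and cl = subgroup.m_closed[OF H] and inv = subgroup.m_inv_closed[OF H]
  have "card (H \<times> H) = card (double_coset H x) * card (conj_int H x)"
    unfolding double_coset_def
  proof (rule card_eq_fibres)
    let ?f = "\<lambda>(h, h'). h \<otimes> x \<otimes> h'"
    fix y assume "y \<in> ?f ` (H \<times> H)"
    then obtain h0 h0' where 0: "h0 \<in> H" "h0' \<in> H" "y = h0 \<otimes> x \<otimes> h0'" by auto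
    have "bij_betw (\<lambda>k. (h0 \<otimes> inv (x \<otimes> k \<otimes> inv x), k \<otimes> h0')) (conj_int H x) {v \<in> H \<times> H. ?f v = y}"
    proof (rule bij_betwI')
      fix k k' assume "k \<in> conj_int H x" "k' \<in> conj_int H x"
      then have "k \<in> carrier G" "k' \<in> carrier G" using sc by (auto simp: conj_int_def)
      then show "((h0 \<otimes> inv (x \<otimes> k \<otimes> inv x), k \<otimes> h0') = (h0 \<otimes> inv (x \<otimes> k' \<otimes> inv x), k' \<otimes> h0')) = (k = k')"
        using 0 sc by auto
    next
      fix k assume "k \<in> conj_int H x"
      then have k: "k \<in> H" "x \<otimes> k \<otimes> inv x \<in> H" by (auto simp: conj_int_def)
      have "h0 \<otimes> inv (x \<otimes> k \<otimes> inv x) \<otimes> x \<otimes> (k \<otimes> h0') = y"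
        using 0 k(1) sc x by (simp add: group_word_simps)
      then show "(h0 \<otimes> inv (x \<otimes> k \<otimes> inv x), k \<otimes> h0') \<in> {v \<in> H \<times> H. ?f v = y}"
        using k 0 cl inv by simp
    next
      fix v assume "v \<in> {v \<in> H \<times> H. ?f v = y}"
      then obtain h h' where v: "v = (h, h')" "h \<in> H" "h' \<in> H" "h \<otimes> x \<otimes> h' = h0 \<otimes> x \<otimes> h0'" using 0 by auto
      define k where "k = h' \<otimes> inv h0'"
      have kH: "k \<in> H" using v 0 cl inv by (simp add: k_def)
      have "inv h \<otimes> (h \<otimes> x \<otimes> h') \<otimes> inv h0' \<otimes> inv x = inv h \<otimes> (h0 \<otimes> x \<otimes> h0') \<otimes> inv h0' \<otimes> inv x"
        using v(4) by simp
      then have xk: "x \<otimes> k \<otimes> inv x = inv h \<otimes> h0"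
        using v(2,3) 0(1,2) sc x by (simp add: k_def group_word_simps)
      then have "k \<in> conj_int H x" using kH v 0 cl inv by (simp add: conj_int_def)
      moreover have "v = (h0 \<otimes> inv (x \<otimes> k \<otimes> inv x), k \<otimes> h0')"
        unfolding xk v(1) using v(2,3) 0(1,2) sc by (simp add: k_def group_word_simps)
      ultimately show "\<exists>k\<in>conj_int H x. v = (h0 \<otimes> inv (x \<otimes> k \<otimes> inv x), k \<otimes> h0')" by blast
    qed
    from bij_betw_same_card[OF this] show "card {v \<in> H \<times> H. ?f v = y} = card (conj_int H x)" by simp
  qed (use fin in simp)
  then show ?thesis by (simp add: card_cartesian_product)
qed

lemma double_coset_inv:
  assumes H: "subgroup H G" and x: "x \<in> carrier G"
  shows "double_coset H (inv x) = m_inv G ` double_coset H x"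
proof -
  note sc = subgroup.mem_carrier[OF H] and inv = subgroup.m_inv_closed[OF H]
  have *: "inv (h \<otimes> x \<otimes> h') = inv h' \<otimes> inv x \<otimes> inv h" if "h \<in> H" "h' \<in> H" for h h'
    using that sc x by (simp add: group_word_simps)
  show ?thesis
  proof (intro equalityI subsetI)
    fix y assume "y \<in> double_coset H (inv x)"
    then obtain h h' where h: "h \<in> H" "h' \<in> H" "y = h \<otimes> inv x \<otimes> h'" by (rule double_cosetE)
    then have "y = inv (inv h' \<otimes> x \<otimes> inv h)" using *[of "inv h'" "inv h"] inv sc by simp
    then show "y \<in> m_inv G ` double_coset H x" using double_cosetI h inv by blast
  next
    fix y assume "y \<in> m_inv G ` double_coset H x"
    then obtain h h' where "h \<in> H" "h' \<in> H" "y = inv (h \<otimes> x \<otimes> h')" unfolding double_coset_def by auto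
    then show "y \<in> double_coset H (inv x)" using * double_cosetI inv by simp
  qed
qed

lemma triple_productI:
  "a \<in> S \<Longrightarrow> b \<in> S \<Longrightarrow> c \<in> S \<Longrightarrow> a \<otimes> b \<otimes> c \<in> triple_product G S"
  unfolding triple_product_def set_mult_def by blast

lemma triple_productE:
  assumes "y \<in> triple_product G S"
  obtains a b c where "a \<in> S" "b \<in> S" "c \<in> S" "y = a \<otimes> b \<otimes> c"
  using assms unfolding triple_product_def set_mult_def by auto

end

context sl2_pair begin

lemma x_notin_H: "x \<notin> H"
  using gen sub_H proper unfolding generates_with_def by blast

lemma H_Int_double_coset: assumes "y \<in> carrier G" "y \<notin> H" shows "H \<inter> double_coset H y = {}"
proof -
  have "y \<in> H" if "h \<in> H" "h' \<in> H" "h \<cdot> y \<cdot> h' \<in> H" for h h'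
  proof -
    have "inv\<^bsub>G\<^esub> h \<cdot> (h \<cdot> y \<cdot> h') \<cdot> inv\<^bsub>G\<^esub> h' \<in> H" using that H_m_closed H_inv_closed by blast
    then show ?thesis using that H_carrier assms by (simp add: group_word_simps)
  qed
  then show ?thesis using assms by (auto elim!: double_cosetE)
qed

lemma double_coset_finite: "finite (double_coset H y)"
  unfolding double_coset_def using fin_H by blast

lemma double_coset_carrier: "y \<in> carrier G \<Longrightarrow> double_coset H y \<subseteq> carrier G"
  using H_carrier by (auto elim!: double_cosetE)

lemma card_double_coset_x: assumes "card H = k * card K" "card K \<ge> 1"
  shows "card (double_coset H x) = card H * k"
proof -
  have "card (double_coset H x) * card K = card H * k * card K"
    using card_double_coset[OF sub_H fin_H x_carrier] assms(1) by (simp add: mult_ac)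
  then show ?thesis using assms(2) by simp
qed

lemma K_conj_invariant: assumes "x \<cdot> x \<in> H" shows "conj_by x ` K \<subseteq> K"
proof
  fix y assume "y \<in> conj_by x ` K"
  then obtain k where k: "k \<in> K" "y = conj_by x k" by blast
  have kH: "k \<in> H" "conj_by x k \<in> H" using k K_subset conj_x_K by auto
  have "(x \<cdot> x) \<cdot> k \<cdot> inv\<^bsub>G\<^esub> (x \<cdot> x) \<in> H" using kH assms H_m_closed H_inv_closed by blast
  moreover have "(x \<cdot> x) \<cdot> k \<cdot> inv\<^bsub>G\<^esub> (x \<cdot> x) = x \<cdot> conj_by x k \<cdot> inv\<^bsub>G\<^esub> x"
    using kH(1) H_carrier x_carrier by (simp add: conj_by_def group_word_simps)
  ultimately show "y \<in> K" using k kH by (simp add: conj_int_def)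
qed

text \<open>The group \<open>K\<close> would be normalised by \<open>H\<close> and \<open>x\<close>, hence central.\<close>

lemma K_normal_imp_small:
  assumes "x \<cdot> x \<in> H" "\<And>h. h \<in> H \<Longrightarrow> conj_by h ` K \<subseteq> K" shows "card K \<le> 2"
proof -
  have "K \<noteq> carrier G" using K_subset proper subgroup.subset[OF sub_H] by blast
  then have "K \<subseteq> Z" using normalised_cases[OF sub_K assms(2) K_conj_invariant[OF assms(1)]] by blast
  then show ?thesis using card_centre card_mono[of Z K] by (metis card.infinite zero_neq_numeral)
qed

text \<open>A subgroup of index 2 is normal.\<close>

lemma index_two_small:
  assumes xx: "x \<cdot> x \<in> H" and two: "card H = 2 * card K" shows "card K \<le> 2"
proof (rule K_normal_imp_small[OF xx])
  note Kcl = subgroup.m_closed[OF sub_K] and Kinv = subgroup.m_inv_closed[OF sub_K] and Kc = subgroup.mem_carrier[OF sub_K]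
  fix h assume h: "h \<in> H"
  show "conj_by h ` K \<subseteq> K"
  proof (cases "h \<in> K")
    case True then show ?thesis using Kcl Kinv by (auto simp: conj_by_def)
  next
    case False
    let ?hK = "(\<lambda>k. h \<cdot> k) ` K"
    have disj: "K \<inter> ?hK = {}"
    proof -
      have "h \<in> K" if "k \<in> K" "h \<cdot> k \<in> K" for k
      proof -
        have "h \<cdot> k \<cdot> inv\<^bsub>G\<^esub> k \<in> K" using that Kcl Kinv by blast
        then show ?thesis using that h Kc H_carrier by (simp add: group_word_simps)
      qed
      then show ?thesis using False by blast
    qed
    have "card ?hK = card K" using Kc H_carrier h by (intro card_image inj_onI) simp
    then have "card (K \<union> ?hK) = card H" using two disj fin_K by (simp add: card_Un_disjoint)
    moreover have "K \<union> ?hK \<subseteq> H" using K_subset h H_m_closed by auto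
    ultimately have H: "H = K \<union> ?hK" using fin_H by (metis card_subset_eq)
    show ?thesis
    proof
      fix y assume "y \<in> conj_by h ` K"
      then obtain k where k: "k \<in> K" "y = h \<cdot> k \<cdot> inv\<^bsub>G\<^esub> h" by (auto simp: conj_by_def)
      have kc: "k \<in> carrier G" "h \<in> carrier G" using k h Kc H_carrier by auto
      have "y \<in> H" using k h K_subset H_m_closed H_inv_closed by blast
      show "y \<in> K"
      proof (rule ccontr)
        assume "y \<notin> K"
        then obtain k' where k': "k' \<in> K" "y = h \<cdot> k'" using H \<open>y \<in> H\<close> by blast
        have "inv\<^bsub>G\<^esub> k' \<cdot> k = inv\<^bsub>G\<^esub> (h \<cdot> k') \<cdot> (h \<cdot> k)" using kc k' Kc by (simp add: group_word_simps)
        also have "h \<cdot> k = y \<cdot> h" using k(2) kc by (simp add: group_word_simps)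
        also have "inv\<^bsub>G\<^esub> (h \<cdot> k') \<cdot> (y \<cdot> h) = h" using k'(2) kc Kc[OF k'(1)] by (simp add: group_word_simps)
        finally have "h \<in> K" using Kcl Kinv k k' by metis
        then show False using False by simp
      qed
    qed
  qed
qed

text \<open>Replacing \<open>x\<close> by another element of its coset \<open>x H\<close> changes \<open>K\<close> only by conjugation.\<close>

lemma translate_pair: assumes h: "h \<in> H" shows "sl2_pair p H (x \<cdot> h)"
    and "card (conj_int H (x \<cdot> h)) = card K"
proof -
  have hc: "h \<in> carrier G" using h H_carrier by blast
  have "generates_with H (x \<cdot> h)"
    unfolding generates_with_def
  proof (intro allI impI)
    fix L assume L: "subgroup L G" "H \<subseteq> L" "x \<cdot> h \<in> L"
    have "x \<cdot> h \<cdot> inv\<^bsub>G\<^esub> h \<in> L"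
      using L h subgroup.m_closed[OF L(1)] subgroup.m_inv_closed[OF L(1)] by blast
    then have "x \<in> L" using hc x_carrier by (simp add: group_word_simps)
    then show "L = carrier G" using gen L unfolding generates_with_def by blast
  qed
  then show "sl2_pair p H (x \<cdot> h)"
    unfolding sl2_pair_def sl2_pair_axioms_def using sl2_axioms sub_H proper x_carrier hc by simp
  have "conj_int H (x \<cdot> h) = conj_by (inv\<^bsub>G\<^esub> h) ` K"
  proof (intro equalityI subsetI)
    fix k assume "k \<in> conj_int H (x \<cdot> h)"
    then have k: "k \<in> H" "x \<cdot> h \<cdot> k \<cdot> inv\<^bsub>G\<^esub> (x \<cdot> h) \<in> H" by (auto simp: conj_int_def)
    have "x \<cdot> h \<cdot> k \<cdot> inv\<^bsub>G\<^esub> (x \<cdot> h) = x \<cdot> conj_by h k \<cdot> inv\<^bsub>G\<^esub> x"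
      using k(1) hc x_carrier H_carrier by (simp add: conj_by_def group_word_simps)
    then have "conj_by h k \<in> K" using k h H_m_closed H_inv_closed by (simp add: conj_int_def conj_by_def)
    moreover have "k = conj_by (inv\<^bsub>G\<^esub> h) (conj_by h k)" using k hc H_carrier by simp
    ultimately show "k \<in> conj_by (inv\<^bsub>G\<^esub> h) ` K" by blast
  next
    fix k assume "k \<in> conj_by (inv\<^bsub>G\<^esub> h) ` K"
    then obtain l where l: "l \<in> K" "k = conj_by (inv\<^bsub>G\<^esub> h) l" by blast
    have lH: "l \<in> H" using l K_subset by blast
    have "k \<in> H" using l lH h H_m_closed H_inv_closed by (simp add: conj_by_def)
    moreover have "x \<cdot> h \<cdot> k \<cdot> inv\<^bsub>G\<^esub> (x \<cdot> h) = x \<cdot> l \<cdot> inv\<^bsub>G\<^esub> x"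
      using l(2) lH hc x_carrier H_carrier by (simp add: conj_by_def group_word_simps)
    ultimately show "k \<in> conj_int H (x \<cdot> h)" using l by (simp add: conj_int_def)
  qed
  then show "card (conj_int H (x \<cdot> h)) = card K"
    using card_image[OF inj_on_subset[OF inj_conj_by[of "inv\<^bsub>G\<^esub> h"] subgroup.subset[OF sub_K]]] hc by simp
qed

text \<open>If \<open>x^-1 = h x h'\<close>, then \<open>(x h)\<^sup>2 = h'^-1 h\<close>, so that the case of a square in \<open>H\<close> applies to \<open>x h\<close>.\<close>

lemma plus_two_index_two:
  assumes two: "card H = 2 * card K" and inv: "inv\<^bsub>G\<^esub> x \<in> double_coset H x" shows "card K \<le> 2"
proof -
  obtain h h' where h: "h \<in> H" "h' \<in> H" "inv\<^bsub>G\<^esub> x = h \<cdot> x \<cdot> h'" using inv by (rule double_cosetE)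
  have hc: "h \<in> carrier G" "h' \<in> carrier G" using h H_carrier by auto
  interpret X: sl2_pair p H "x \<cdot> h" using translate_pair[OF h(1)] by simp
  have "x \<cdot> (h \<cdot> x \<cdot> h') = \<one>\<^bsub>G\<^esub>" using x_carrier h(3) by (metis r_inv)
  then have "x \<cdot> (h \<cdot> x \<cdot> h') \<cdot> inv\<^bsub>G\<^esub> h' \<cdot> h = inv\<^bsub>G\<^esub> h' \<cdot> h" using hc by simp
  then have "(x \<cdot> h) \<cdot> (x \<cdot> h) = inv\<^bsub>G\<^esub> h' \<cdot> h" using hc x_carrier by (simp add: group_word_simps)
  then have "(x \<cdot> h) \<cdot> (x \<cdot> h) \<in> H" using h H_m_closed H_inv_closed by simp
  then show ?thesis using X.index_two_small two translate_pair(2)[OF h(1)] by simp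
qed

text \<open>A group of order 2 is central, since the central element -1 is the only involution of \<open>SL(2,p)\<close>.\<close>

lemma card_H_ge_3: "card H \<ge> 3"
proof -
  obtain k where k: "card H = k * card K" "k \<ge> 2" "card K \<ge> 1" by (rule index_K)
  then have "card H \<ge> 2" using mult_le_mono[of 2 k 1 "card K"] by simp
  moreover have "card H \<noteq> 2"
  proof
    assume "card H = 2"
    then obtain h where h: "H = {\<one>\<^bsub>G\<^esub>, h}" "h \<noteq> \<one>\<^bsub>G\<^esub>" using H_one by (metis card_2_iff doubleton_eq_iff insertE singletonD)
    have hH: "h \<in> H" using h by simp
    have "h \<cdot> h \<in> H" using hH H_m_closed by blast
    moreover have "h \<cdot> h \<noteq> h" using h hH H_carrier by simp
    ultimately have "h \<cdot> h = \<one>\<^bsub>G\<^esub>" using h by blast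
    then have "h \<in> Z" using involution_central hH H_carrier by blast
    then have "H \<subseteq> Z" using h subgroup.one_closed[OF subgroup_centre] by simp
    then show False using H_not_central by blast
  qed
  ultimately show ?thesis by simp
qed

end

lemma mult_succ_le_cube:
  fixes k m :: nat
  assumes "k \<ge> 5" "m \<le> 8 \<or> m \<le> k" shows "m * (k + 1) \<le> k ^ 3"
proof -
  have m: "m \<le> 8 \<or> m \<le> k" by fact
  have "8 * (k + 1) \<le> k ^ 3"
  proof -
    have "8 * (k + 1) \<le> 10 * k" using assms(1) by simp
    also have "\<dots> \<le> (k * k) * k" using assms(1) mult_le_mono[of 5 k 5 k] by (intro mult_right_mono) simp_all
    finally show ?thesis by (simp add: power3_eq_cube)
  qed
  moreover have "k * (k + 1) \<le> k ^ 3"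
  proof -
    have "k + 1 \<le> k * k" using assms(1) mult_le_mono[of 5 k k k] by linarith
    then have "k * (k + 1) \<le> k * (k * k)" by (rule mult_le_mono2)
    then show ?thesis by (simp add: power3_eq_cube)
  qed
  ultimately show ?thesis using m by (meson le_trans mult_le_mono1)
qed

lemma power_transfer:
  fixes y X :: nat
  assumes "X \<ge> y * k" "y ^ 5 < k ^ 16" "y \<ge> 1" shows "y ^ 21 < X ^ 16"
proof -
  have "y ^ 21 = y ^ 16 * y ^ 5" by (simp flip: power_add)
  also have "\<dots> < y ^ 16 * k ^ 16" using assms(2,3) by (intro mult_strict_left_mono) simp_all
  also have "\<dots> = (y * k) ^ 16" by (simp add: power_mult_distrib)
  also have "\<dots> \<le> X ^ 16" using assms(1) by (intro power_mono) simp_all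
  finally show ?thesis .
qed

context sl2_pair begin

text \<open>For \<open>k \<le> 4\<close> the listed cases bound the left side by the fifth powers of 6, 32 and 60. For \<open>k \<ge> 5\<close> it is
  enough that \<open>|K| (k + 1) \<le> k ^ 3\<close>, which can fail only for \<open>k = 5\<close>; there \<open>n \<le> 120\<close> bounds the left
  side by the fifth power of 144.\<close>

lemma growth_inequality:
  assumes k: "card H = k * card K" and two: "k = 2 \<Longrightarrow> card K \<le> 2" and ne: "\<not> (card H = 48 \<and> k = 3)"
  shows "(card K * (k + 1)) ^ 5 < k ^ 16"
proof -
  obtain k' where k': "card H = k' * card K" "k' \<ge> 2" "card K \<ge> 1"
    "(5 \<le> k' \<and> card H \<le> k'\<^sup>2) \<or> card K \<le> 8 \<or> card H \<in> {12, 24} \<or> (card H = 48 \<and> (\<exists>a. octahedral_subgroup p H a)) \<or>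
     (card H \<in> {60, 120} \<and> k' \<noteq> 3 \<and> k' \<noteq> 4)" using pair_cases by blast
  have "k' = k" using k k' by simp
  note k' = k'[unfolded this]
  define m where "m = card K"
  have n: "card H = k * m" using k by (simp add: m_def)
  have pow: "(m * (k + 1)) ^ 5 < k ^ 16" if "m * (k + 1) \<le> y" "y ^ 5 < k ^ 16" for y
    using le_less_trans[OF power_mono[OF that(1)] that(2)] by simp
  consider "k = 2" | "k = 3" | "k = 4" | "k \<ge> 5" using k'(2) by linarith
  then have "(m * (k + 1)) ^ 5 < k ^ 16"
  proof cases
    case 1
    then have "m * (k + 1) \<le> 6" using two by (simp add: m_def)
    then show ?thesis using pow[of 6] 1 by simp
  next
    case 2
    then have "m \<le> 8" using k'(4) n ne by (auto simp: m_def)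
    then have "m * (k + 1) \<le> 32" using 2 by simp
    then show ?thesis using pow[of 32] 2 by simp
  next
    case 3
    then have "m \<le> 12" using k'(4) n by (auto simp: m_def)
    then have "m * (k + 1) \<le> 60" using 3 by simp
    then show ?thesis using pow[of 60] 3 by simp
  next
    case 4
    have cube: ?thesis if "m * (k + 1) \<le> k ^ 3"
    proof (rule pow[OF that])
      have "(k ^ 3) ^ 5 = k ^ 15" by (simp flip: power_mult)
      also have "\<dots> < k ^ 16" using 4 by (intro power_strict_increasing) auto
      finally show "(k ^ 3) ^ 5 < k ^ 16" .
    qed
    from k'(4) consider "card H \<le> k\<^sup>2" | "m \<le> 8" | "card H \<le> 120" by (auto simp: m_def)
    then show ?thesis
    proof cases
      case 1
      then have "m \<le> k" using n 4 by (simp add: power2_eq_square)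
      then show ?thesis using cube mult_succ_le_cube 4 by blast
    next
      case 2
      then show ?thesis using cube mult_succ_le_cube 4 by blast
    next
      case 3
      show ?thesis
      proof (cases "k = 5")
        case True
        then have "m * (k + 1) \<le> 144" using 3 n by simp
        then show ?thesis using pow[of 144] True by simp
      next
        case False
        then have k6: "k \<ge> 6" using 4 by simp
        have "6 * m \<le> 120" using 3 n k6 mult_le_mono1[of 6 k m] by linarith
        then have "m * (k + 1) \<le> 140" using 3 n by (simp add: mult.commute)
        also have "140 \<le> k ^ 3" using power_mono[of 6 k 3] k6 by simp
        finally show ?thesis using cube by simp
      qed
    qed
  qed
  then show ?thesis by (simp add: m_def)
qed

lemma triple_product_finite: assumes "S \<subseteq> carrier G" shows "finite (triple_product G S)"
proof (rule finite_subset[OF _ finite_carrier])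
  show "triple_product G S \<subseteq> carrier G" using assms by (auto elim!: triple_productE)
qed

lemma triple_product_superset:
  assumes S: "H \<subseteq> S" "y \<in> S" "y \<in> carrier G" shows "H \<union> double_coset H y \<subseteq> triple_product G S"
proof
  fix w assume "w \<in> H \<union> double_coset H y"
  then show "w \<in> triple_product G S"
  proof (elim UnE)
    assume w: "w \<in> H"
    then have "w \<cdot> \<one>\<^bsub>G\<^esub> \<cdot> \<one>\<^bsub>G\<^esub> \<in> triple_product G S" using S H_one by (intro triple_productI) auto
    then show ?thesis using w H_carrier by simp
  next
    assume "w \<in> double_coset H y"
    then show ?thesis using S by (auto elim!: double_cosetE intro!: triple_productI)
  qed
qed

lemma card_H_Un_double_coset:
  assumes "card H = k * card K" "card K \<ge> 1" shows "card (H \<union> double_coset H x) = card H * (k + 1)"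
  using card_double_coset_x[OF assms] H_Int_double_coset[OF x_carrier x_notin_H] fin_H double_coset_finite
  by (simp add: card_Un_disjoint)

text \<open>Since \<open>n + 2 \<le> |K| (k + 1)\<close> as soon as \<open>|K| \<ge> 2\<close>, this mostly reduces to the inequality for the coset
  core. Exceptions are \<open>|K| = 1\<close>, where \<open>k = n\<close>; \<open>n = 48\<close> and \<open>k = 3\<close>, where \<open>50 ^ 21 < 192 ^ 16\<close>; and
  \<open>k = 2\<close> with \<open>|K| > 2\<close>, where the triple product contains two double cosets and thus \<open>5 n\<close> elements.\<close>

lemma plus_two_power:
  assumes S: "S = H \<union> {x, inv\<^bsub>G\<^esub> x}"
  shows "card S ^ 21 < card (triple_product G S) ^ 16"
proof -
  obtain k where k: "card H = k * card K" "k \<ge> 2" "card K \<ge> 1"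
    "(5 \<le> k \<and> card H \<le> k\<^sup>2) \<or> card K \<le> 8 \<or> card H \<in> {12, 24} \<or> (card H = 48 \<and> (\<exists>a. octahedral_subgroup p H a)) \<or>
     (card H \<in> {60, 120} \<and> k \<noteq> 3 \<and> k \<noteq> 4)" using pair_cases by blast
  let ?n = "card H" and ?X = "card (triple_product G S)"
  have Sc: "S \<subseteq> carrier G" using S H_carrier x_carrier by auto
  have "card S \<le> card H + card {x, inv\<^bsub>G\<^esub> x}" unfolding S by (rule card_Un_le)
  moreover have "card {x, inv\<^bsub>G\<^esub> x} \<le> 2" by (simp add: card_insert_if)
  ultimately have cS: "card S \<le> ?n + 2" by simp
  have "H \<union> double_coset H x \<subseteq> triple_product G S" using triple_product_superset[of S x] S x_carrier by blast
  then have "card (H \<union> double_coset H x) \<le> ?X" using triple_product_finite[OF Sc] by (rule card_mono[rotated])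
  then have X: "?X \<ge> ?n * (k + 1)" using card_H_Un_double_coset[OF k(1,3)] by simp
  have fin: "card S ^ 21 < ?X ^ 16" if "?n + 2 \<le> y" "X' \<le> ?X" "y ^ 21 < X' ^ 16" for y X'
  proof -
    have "card S ^ 21 \<le> y ^ 21" using cS that(1) by (intro power_mono) simp_all
    also have "\<dots> < X' ^ 16" by fact
    also have "\<dots> \<le> ?X ^ 16" using that(2) by (intro power_mono) simp_all
    finally show ?thesis .
  qed
  have gen: ?thesis if m2: "card K \<ge> 2" and "k = 2 \<Longrightarrow> card K \<le> 2" "\<not> (?n = 48 \<and> k = 3)"
  proof (rule fin)
    show "?n + 2 \<le> card K * (k + 1)" using m2 k(1) by (simp add: mult.commute)
    show "card K * (k + 1) * k \<le> ?X" using X k(1) by (simp add: mult_ac)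
    show "(card K * (k + 1)) ^ 21 < (card K * (k + 1) * k) ^ 16"
      using power_transfer[OF _ growth_inequality[OF k(1) that(2,3)], of "card K * (k + 1) * k"] k(3) by simp
  qed
  show ?thesis
  proof (cases "card K = 1")
    case True
    then have n: "?n = k" using k by simp
    have n3: "?n \<ge> 3" by (rule card_H_ge_3)
    show ?thesis
    proof (rule fin[OF order_refl X])
      define r where "r = ?n"
      have r: "r \<ge> 3" using n3 by (simp add: r_def)
      have "(r + 2) ^ 3 \<le> (r * (r + 1)) ^ 2"
      proof -
        \<comment> \<open>In powers of \<open>s = r - 3\<close> the inequality holds coefficient by coefficient.\<close>
        obtain s where s: "r = s + 3" using r by (metis add.commute le_Suc_ex)
        have "(r + 2) ^ 3 = s * s * s + 15 * (s * s) + 75 * s + 125"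
          unfolding s by (simp add: power3_eq_cube algebra_simps)
        also have "\<dots> \<le> s * s * s * s + 14 * (s * s * s) + 73 * (s * s) + 168 * s + 144" by simp
        also have "\<dots> = (r * (r + 1)) ^ 2" unfolding s by (simp add: power2_eq_square algebra_simps)
        finally show ?thesis .
      qed
      then have "((r + 2) ^ 3) ^ 7 \<le> ((r * (r + 1)) ^ 2) ^ 7" by (rule power_mono) simp
      then have "(r + 2) ^ 21 \<le> (r * (r + 1)) ^ 14" by (simp flip: power_mult)
      also have "\<dots> < (r * (r + 1)) ^ 16" using r by (intro power_strict_increasing) simp_all
      finally show "(?n + 2) ^ 21 < (?n * (k + 1)) ^ 16" using n by (simp add: r_def)
    qed
  next
    case False
    then have m2: "card K \<ge> 2" using k(3) by simp
    show ?thesis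
    proof (cases "?n = 48 \<and> k = 3")
      case True
      have "(?n + 2) ^ 21 < (?n * (k + 1)) ^ 16" using True by simp
      then show ?thesis using fin[OF order_refl X] by simp
    next
      case no: False
      show ?thesis
      proof (cases "k = 2 \<and> card K > 2")
        case False
        then show ?thesis using gen[OF m2] no by auto
      next
        case k2: True
        have xi: "inv\<^bsub>G\<^esub> x \<notin> double_coset H x" using plus_two_index_two k(1) k2 by fastforce
        have disj: "double_coset H x \<inter> double_coset H (inv\<^bsub>G\<^esub> x) = {}"
        proof -
          have False if hh: "h1 \<in> H" "h2 \<in> H" "h3 \<in> H" "h4 \<in> H"
            "h1 \<cdot> x \<cdot> h2 = h3 \<cdot> inv\<^bsub>G\<^esub> x \<cdot> h4" for h1 h2 h3 h4
          proof -
            note hc = hh(1-4)[THEN H_carrier]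
            have "(inv\<^bsub>G\<^esub> h3 \<cdot> h1) \<cdot> x \<cdot> (h2 \<cdot> inv\<^bsub>G\<^esub> h4) =
              inv\<^bsub>G\<^esub> h3 \<cdot> (h1 \<cdot> x \<cdot> h2) \<cdot> inv\<^bsub>G\<^esub> h4" using hc x_carrier by (simp add: m_assoc)
            also have "\<dots> = inv\<^bsub>G\<^esub> x" unfolding hh(5) using hc x_carrier by (simp add: group_word_simps)
            finally have "inv\<^bsub>G\<^esub> x \<in> double_coset H x"
              using double_cosetI[of "inv\<^bsub>G\<^esub> h3 \<cdot> h1" H "h2 \<cdot> inv\<^bsub>G\<^esub> h4" x] hh(1-4) H_m_closed H_inv_closed by simp
            then show False using xi by simp
          qed
          then show ?thesis by (auto elim!: double_cosetE)
        qed
        have xiH: "inv\<^bsub>G\<^esub> x \<notin> H" using x_notin_H H_inv_closed[of "inv\<^bsub>G\<^esub> x"] x_carrier by auto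
        have "card (double_coset H (inv\<^bsub>G\<^esub> x)) = card (double_coset H x)"
          unfolding double_coset_inv[OF sub_H x_carrier]
          using double_coset_carrier[OF x_carrier] by (intro card_image inj_on_subset[OF inv_inj])
        also have "\<dots> = ?n * k" by (rule card_double_coset_x[OF k(1,3)])
        finally have ci: "card (double_coset H (inv\<^bsub>G\<^esub> x)) = ?n * k" .
        have "(H \<union> double_coset H x) \<inter> double_coset H (inv\<^bsub>G\<^esub> x) = {}"
          using disj H_Int_double_coset[OF _ xiH] x_carrier by blast
        then have U: "card ((H \<union> double_coset H x) \<union> double_coset H (inv\<^bsub>G\<^esub> x)) = ?n * (k + 1) + ?n * k"
          using card_H_Un_double_coset[OF k(1,3)] ci fin_H double_coset_finite by (simp add: card_Un_disjoint)
        have "(H \<union> double_coset H x) \<union> double_coset H (inv\<^bsub>G\<^esub> x) \<subseteq> triple_product G S"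
          using triple_product_superset[of S x] triple_product_superset[of S "inv\<^bsub>G\<^esub> x"] S x_carrier by blast
        from card_mono[OF triple_product_finite[OF Sc] this] have X5: "5 * ?n \<le> ?X"
          unfolding U using k2 by simp
        have "?n \<in> {6,8,10,12,14,16} \<or> ?n \<in> {12,24,48,60,120}"
        proof -
          have "?n = 2 * card K" using k(1) k2 by simp
          moreover have "card K \<in> {3..8} \<or> ?n \<in> {12,24,48,60,120}" using k(4) k2 by auto
          moreover have "{3..8} = {3,4,5,6,7,8::nat}" by auto
          ultimately show ?thesis by auto
        qed
        then have "(?n + 2) ^ 21 < (5 * ?n) ^ 16" by auto
        then show ?thesis using fin[OF order_refl X5] by simp
      qed
    qed
  qed
qed

end

context sl2_pair begin

section \<open>The exceptional case\<close>

lemma coset_core_eq: "coset_core G H x = (\<lambda>k. x \<cdot> k) ` K"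
proof (intro equalityI subsetI)
  fix y assume "y \<in> coset_core G H x"
  then obtain h h' where h: "h \<in> H" "y = x \<cdot> h" "h' \<in> H" "y = h' \<cdot> x"
    by (auto simp: coset_core_def l_coset_def r_coset_def)
  have "x \<cdot> h \<cdot> inv\<^bsub>G\<^esub> x = h' \<cdot> x \<cdot> inv\<^bsub>G\<^esub> x" using h by simp
  also have "\<dots> = h'" using h(3) H_carrier x_carrier by (simp add: m_assoc)
  finally have "h \<in> K" using h by (simp add: conj_int_def)
  then show "y \<in> (\<lambda>k. x \<cdot> k) ` K" using h by blast
next
  fix y assume "y \<in> (\<lambda>k. x \<cdot> k) ` K"
  then obtain k where k: "k \<in> H" "x \<cdot> k \<cdot> inv\<^bsub>G\<^esub> x \<in> H" "y = x \<cdot> k" by (auto simp: conj_int_def)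
  have "y = (x \<cdot> k \<cdot> inv\<^bsub>G\<^esub> x) \<cdot> x" using k H_carrier x_carrier by (simp add: m_assoc)
  then show "y \<in> coset_core G H x" using k by (auto simp: coset_core_def l_coset_def r_coset_def)
qed

lemma x_in_coset_core: "x \<in> coset_core G H x"
  unfolding coset_core_eq using subgroup.one_closed[OF sub_K] x_carrier by (metis image_eqI r_one)

lemma coset_core_disjoint: "H \<inter> coset_core G H x = {}"
proof -
  have "x \<in> H" if "k \<in> K" "x \<cdot> k \<in> H" for k
  proof -
    have kH: "k \<in> H" using that K_subset by blast
    have "x \<cdot> k \<cdot> inv\<^bsub>G\<^esub> k \<in> H" using that kH H_m_closed H_inv_closed by blast
    then show ?thesis using kH H_carrier x_carrier by (simp add: group_word_simps)
  qed
  then show ?thesis unfolding coset_core_eq using x_notin_H by blast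
qed

lemma card_plus_coset_core:
  assumes "card H = k * card K" "S = H \<union> coset_core G H x" shows "card S = card K * (k + 1)"
proof -
  have "card (coset_core G H x) = card K" unfolding coset_core_eq
    using subgroup.mem_carrier[OF sub_K] x_carrier by (intro card_image inj_onI) simp
  moreover have "finite (coset_core G H x)" unfolding coset_core_eq using fin_K by blast
  ultimately show ?thesis
    using assms fin_H coset_core_disjoint by (simp add: card_Un_disjoint)
qed

lemma coset_core_carrier: "coset_core G H x \<subseteq> carrier G"
  unfolding coset_core_eq using subgroup.mem_carrier[OF sub_K] x_carrier by auto

lemma coset_core_power:
  assumes xx: "x \<cdot> x \<in> H" and S: "S = H \<union> coset_core G H x"
    and ne: "\<not> (card H = 48 \<and> card K = 16)"
  shows "card S ^ 21 < card (triple_product G S) ^ 16"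
proof -
  obtain k where k: "card H = k * card K" "k \<ge> 2" "card K \<ge> 1" by (rule index_K)
  have ne': "\<not> (card H = 48 \<and> k = 3)" using ne k by auto
  have two: "card K \<le> 2" if "k = 2" using index_two_small[OF xx] k that by simp
  have Sc: "S \<subseteq> carrier G" using S H_carrier coset_core_carrier by auto
  have "H \<union> double_coset H x \<subseteq> triple_product G S"
    using triple_product_superset[of S x] S x_carrier x_in_coset_core by blast
  from card_mono[OF triple_product_finite[OF Sc] this]
  have "card K * (k + 1) * k \<le> card (triple_product G S)"
    unfolding card_H_Un_double_coset[OF k(1,3)] using k(1) by (simp add: mult_ac)
  from power_transfer[OF this growth_inequality[OF k(1) two ne']]
  show ?thesis using card_plus_coset_core[OF k(1) S] k(3) by simp
qed

lemma conj_x_K_eq: assumes "x \<cdot> x \<in> H" shows "conj_by x ` K = K"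
  using K_conj_invariant[OF assms] fin_K
    card_image[OF inj_on_subset[OF inj_conj_by[OF x_carrier] subgroup.subset[OF sub_K]]]
  by (intro card_subset_eq)

text \<open>The double coset of \<open>K\<close> has 16 or 32 elements. If it had 16, then \<open>h\<close> would normalise \<open>K\<close>; the normaliser
  of \<open>K\<close> in \<open>H\<close> would properly contain \<open>K\<close>, so it would be \<open>H\<close>, and \<open>K\<close> would be central.\<close>

lemma K_double_coset_full:
  assumes xx: "x \<cdot> x \<in> H" and n: "card H = 48" and m: "card K = 16" and h: "h \<in> H" "h \<notin> K"
  shows "double_coset K h = H - K"
proof -
  note Kcl = subgroup.m_closed[OF sub_K] and Kinv = subgroup.m_inv_closed[OF sub_K] and Kc = subgroup.mem_carrier[OF sub_K]
  have hc: "h \<in> carrier G" using h H_carrier by blast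
  let ?c = "card (conj_int K h)"
  have sub: "double_coset K h \<subseteq> H - K"
  proof
    fix y assume "y \<in> double_coset K h"
    then obtain k k' where k: "k \<in> K" "k' \<in> K" "y = k \<cdot> h \<cdot> k'" by (rule double_cosetE)
    have "h \<in> K" if "y \<in> K"
    proof -
      have "inv\<^bsub>G\<^esub> k \<cdot> y \<cdot> inv\<^bsub>G\<^esub> k' \<in> K" using that k Kcl Kinv by blast
      then show ?thesis using k Kc hc by (simp add: group_word_simps)
    qed
    moreover have "y \<in> H" using k K_subset h H_m_closed by blast
    ultimately show "y \<in> H - K" using h by blast
  qed
  have cHK: "card (H - K) = 32" using n m card_Diff_subset[OF fin_K K_subset] by simp
  have prod: "card (double_coset K h) * ?c = 256" using card_double_coset[OF sub_K fin_K hc] m by simp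
  have le: "card (double_coset K h) \<le> 32" using card_mono[OF _ sub] fin_H cHK by simp
  have subc: "conj_int K h \<subseteq> K" by (auto simp: conj_int_def)
  have "?c dvd 16" using card_subgroup_dvd[OF subgroup_conj_int[OF sub_K hc] sub_K subc] m by simp
  then obtain j where j: "16 = ?c * j" by (rule dvdE)
  have c8: "8 \<le> ?c" using prod mult_le_mono1[OF le, of ?c] by simp
  have "j \<noteq> 0" using j by (cases j) auto
  moreover have "j \<le> 2" using j mult_le_mono1[OF c8, of j] by linarith
  ultimately have "j = 1 \<or> j = 2" by linarith
  then have "?c = 8 \<or> ?c = 16" using j by auto
  moreover have "?c \<noteq> 16"
  proof
    assume "?c = 16"
    then have "conj_int K h = K" using subc m fin_K by (metis card_subset_eq)
    then have "conj_by h ` K \<subseteq> K" by (auto simp: conj_int_def conj_by_def)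
    moreover have card_conj: "card (conj_by g ` K) = card K" if "g \<in> carrier G" for g
      using card_image[OF inj_on_subset[OF inj_conj_by[OF that] subgroup.subset[OF sub_K]]] .
    ultimately have hN: "conj_by h ` K = K" using fin_K hc by (intro card_subset_eq) auto
    let ?N = "H \<inter> {g \<in> carrier G. conj_by g ` K = K}"
    have subN: "subgroup ?N G"
      using subgroups_Inter_pair[OF sub_H normalizer_is_subgroup[OF subgroup.subset[OF sub_K]]] .
    have "conj_by k ` K = K" if "k \<in> K" for k
    proof -
      have "conj_by k ` K \<subseteq> K" using that Kcl Kinv by (auto simp: conj_by_def)
      then show ?thesis using card_conj that Kc fin_K by (intro card_subset_eq) auto
    qed
    then have KN: "K \<subseteq> ?N" using K_subset Kc by blast
    have "h \<in> ?N" using h hc hN by blast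
    then have "K \<subset> ?N" using KN h by blast
    moreover have "finite ?N" using fin_H by simp
    ultimately have "card K < card ?N" by (rule psubset_card_mono[rotated])
    moreover have "16 dvd card ?N" using card_subgroup_dvd[OF sub_K subN KN] m by simp
    moreover have "card ?N dvd 48" using card_subgroup_dvd[OF subN sub_H] n by simp
    ultimately have "card ?N = 48"
    proof -
      assume a: "card K < card ?N" "16 dvd card ?N" "card ?N dvd 48"
      obtain j where j: "card ?N = 16 * j" using a(2) by blast
      have "card ?N \<le> 48" using a(3) by (simp add: dvd_imp_le)
      then have "j \<le> 3" "j \<ge> 2" using j a(1) m by auto
      then have "j = 2 \<or> j = 3" by auto
      then show ?thesis using j a(3) by auto
    qed
    then have "?N = H" using n fin_H by (intro card_subset_eq) auto
    then have "conj_by g ` K \<subseteq> K" if "g \<in> H" for g using that by blast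
    then show False using K_normal_imp_small[OF xx] m by simp
  qed
  ultimately have "card (double_coset K h) = 32" using prod by simp
  then show ?thesis using sub cHK fin_H by (intro card_subset_eq) auto
qed

text \<open>If some \<open>x h x\<close> with \<open>h\<close> outside \<open>K\<close> were in \<open>H x H\<close>, then all would be, since \<open>x\<close> normalises \<open>K\<close> and \<open>H - K\<close>
  is one double coset of \<open>K\<close>. Then \<open>H \<union> H x H\<close> would be a group with 192 elements.\<close>

lemma middle_not_in_double_coset:
  assumes xx: "x \<cdot> x \<in> H" and n: "card H = 48" and m: "card K = 16" and h: "h \<in> H" "h \<notin> K"
  shows "x \<cdot> h \<cdot> x \<notin> double_coset H x"
proof
  assume xhx: "x \<cdot> h \<cdot> x \<in> double_coset H x"
  let ?L = "H \<union> double_coset H x"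
  have lm: "a \<cdot> y \<cdot> b \<in> double_coset H x" if ab: "a \<in> H" "b \<in> H" and yy: "y \<in> double_coset H x" for a b y
  proof -
    obtain h h' where y: "h \<in> H" "h' \<in> H" "y = h \<cdot> x \<cdot> h'" using yy by (rule double_cosetE)
    have "a \<cdot> y \<cdot> b = (a \<cdot> h) \<cdot> x \<cdot> (h' \<cdot> b)"
      unfolding y(3) using y(1,2) ab H_carrier x_carrier by (simp add: m_assoc)
    then show ?thesis using double_cosetI[of "a \<cdot> h" H "h' \<cdot> b" x] ab y H_m_closed by simp
  qed
  have mid: "x \<cdot> g \<cdot> x \<in> ?L" if g: "g \<in> H" for g
  proof (cases "g \<in> K")
    case True
    then have "conj_by x g \<in> H" by (rule conj_x_K)
    then have "conj_by x g \<cdot> (x \<cdot> x) \<in> H" using xx H_m_closed by blast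
    moreover have "conj_by x g \<cdot> (x \<cdot> x) = x \<cdot> g \<cdot> x"
      using g H_carrier x_carrier by (simp add: conj_by_def group_word_simps)
    ultimately show ?thesis by simp
  next
    case False
    then have "g \<in> double_coset K h" using K_double_coset_full[OF xx n m h] g by blast
    then obtain k k' where k: "k \<in> K" "k' \<in> K" "g = k \<cdot> h \<cdot> k'" by (rule double_cosetE)
    obtain l where l: "l \<in> K" "k' = conj_by x l" using k(2) conj_x_K_eq[OF xx] by blast
    have c: "k \<in> carrier G" "l \<in> carrier G" "h \<in> carrier G" using k l h K_subset H_carrier by auto
    have "conj_by x k \<cdot> (x \<cdot> h \<cdot> x) \<cdot> l = x \<cdot> g \<cdot> x"
      unfolding k(3) l(2) using c x_carrier by (simp add: conj_by_def group_word_simps)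
    then show ?thesis using lm[OF conj_x_K[OF k(1)] _ xhx, of l] l K_subset by auto
  qed
  have "subgroup ?L G"
  proof (rule subgroupI)
    show "?L \<subseteq> carrier G" using H_carrier double_coset_carrier[OF x_carrier] by blast
    show "?L \<noteq> {}" using H_one by blast
    show "inv\<^bsub>G\<^esub> y \<in> ?L" if "y \<in> ?L" for y
    proof (cases "y \<in> H")
      case False
      then have "y \<in> double_coset H x" using that by blast
      then obtain h h' where y: "h \<in> H" "h' \<in> H" "y = h \<cdot> x \<cdot> h'" by (rule double_cosetE)
      have "inv\<^bsub>G\<^esub> y = (inv\<^bsub>G\<^esub> h' \<cdot> inv\<^bsub>G\<^esub> (x \<cdot> x)) \<cdot> x \<cdot> inv\<^bsub>G\<^esub> h"
        unfolding y(3) using y(1,2) H_carrier x_carrier by (simp add: group_word_simps)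
      then show ?thesis using y xx H_m_closed H_inv_closed double_cosetI by auto
    qed (use H_inv_closed in blast)
    show "y \<cdot> z \<in> ?L" if "y \<in> ?L" "z \<in> ?L" for y z
    proof (cases "y \<in> H")
      case True
      show ?thesis
      proof (cases "z \<in> H")
        case True then show ?thesis using \<open>y \<in> H\<close> H_m_closed by blast
      next
        case False
        then have z: "z \<in> double_coset H x" using that by blast
        then have "y \<cdot> z \<cdot> \<one>\<^bsub>G\<^esub> \<in> double_coset H x" using lm True H_one by blast
        then show ?thesis using True z H_carrier double_coset_carrier[OF x_carrier] by auto
      qed
    next
      case False
      then have y: "y \<in> double_coset H x" using that by blast
      then have yc: "y \<in> carrier G" using double_coset_carrier[OF x_carrier] by blast
      show ?thesis
      proof (cases "z \<in> H")
        case True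
        then have "\<one>\<^bsub>G\<^esub> \<cdot> y \<cdot> z \<in> double_coset H x" using lm y H_one by blast
        then show ?thesis using yc by simp
      next
        case False
        then have z: "z \<in> double_coset H x" using that by blast
        obtain h1 h2 where 1: "h1 \<in> H" "h2 \<in> H" "y = h1 \<cdot> x \<cdot> h2" using y by (rule double_cosetE)
        obtain h3 h4 where 2: "h3 \<in> H" "h4 \<in> H" "z = h3 \<cdot> x \<cdot> h4" using z by (rule double_cosetE)
        let ?w = "x \<cdot> (h2 \<cdot> h3) \<cdot> x"
        have "?w \<in> ?L" using mid[OF H_m_closed[OF 1(2) 2(1)]] .
        then have "h1 \<cdot> ?w \<cdot> h4 \<in> ?L"
          using lm[OF 1(1) 2(2), of ?w] H_m_closed[OF H_m_closed[OF 1(1), of ?w] 2(2)] by blast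
        moreover have "h1 \<cdot> ?w \<cdot> h4 = y \<cdot> z"
          unfolding 1(3) 2(3) using 1(1,2) 2(1,2) H_carrier x_carrier by (simp add: m_assoc)
        ultimately show ?thesis by simp
      qed
    qed
  qed
  moreover have "x \<in> ?L"
  proof -
    have "\<one>\<^bsub>G\<^esub> \<cdot> x \<cdot> \<one>\<^bsub>G\<^esub> \<in> double_coset H x" using double_cosetI H_one by blast
    then show ?thesis using x_carrier by simp
  qed
  ultimately have "?L = carrier G" using gen unfolding generates_with_def by blast
  moreover have "card ?L = 192" using card_H_Un_double_coset[of 3] n m by simp
  ultimately have "p dvd 2 ^ 6 * 3" using p_dvd_order by simp
  then have "p dvd 2 \<or> p dvd 3" using prime_p by (metis prime_dvd_mult_iff prime_dvd_power)
  then show False using p_ge_5 by (auto dest: dvd_imp_le)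
qed

text \<open>As \<open>S\<close> is \<open>H \<union> x K\<close> and \<open>x K = K x\<close>, the triple product is the union of \<open>H\<close>, \<open>H x H\<close> and \<open>x H x\<close>. The part
  \<open>x K x\<close> of the last set lies in \<open>H\<close>, and the rest adds 32 elements to the 192 of the first two.\<close>

theorem exceptional_counts:
  assumes xx: "x \<cdot> x \<in> H" and S: "S = H \<union> coset_core G H x" and n: "card H = 48" and m: "card K = 16"
  shows "card S = 64" "card (triple_product G S) = 224"
proof -
  note Kcl = subgroup.m_closed[OF sub_K] and Kc = subgroup.mem_carrier[OF sub_K]
  show "card S = 64" using card_plus_coset_core[of 3, OF _ S] n m by simp
  let ?mid = "\<lambda>h. x \<cdot> h \<cdot> x"
  let ?L = "H \<union> double_coset H x"
  have H1: "\<one>\<^bsub>G\<^esub> \<in> S" and HS: "H \<subseteq> S" and xS: "x \<in> S" using S H_one x_in_coset_core by auto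
  have xk: "\<exists>k'\<in>K. k' \<cdot> x = x \<cdot> k" if "k \<in> K" for k
  proof
    show "conj_by x k \<in> K" using that K_conj_invariant[OF xx] by blast
    show "conj_by x k \<cdot> x = x \<cdot> k" using that Kc x_carrier by (simp add: conj_by_def group_word_simps)
  qed
  have inH: "?mid k \<in> H" if "k \<in> K" for k
  proof -
    have "conj_by x k \<cdot> (x \<cdot> x) \<in> H" using xx conj_x_K that H_m_closed by blast
    then show ?thesis using that Kc x_carrier by (simp add: conj_by_def group_word_simps)
  qed
  have KH: "k \<in> H" if "k \<in> K" for k using that K_subset by blast
  have DC: "a \<cdot> x \<cdot> b \<in> ?L" if "a \<in> H" "b \<in> H" for a b using that double_cosetI by blast
  have T: "triple_product G S = ?L \<union> ?mid ` H"
  proof (intro equalityI subsetI)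
    fix w assume "w \<in> triple_product G S"
    then obtain a b c where abc: "a \<in> S" "b \<in> S" "c \<in> S" and w: "w = a \<cdot> b \<cdot> c" by (rule triple_productE)
    have cases: "s \<in> H \<or> (\<exists>k\<in>K. s = x \<cdot> k)" if "s \<in> S" for s using that S coset_core_eq by auto
    show "w \<in> ?L \<union> ?mid ` H"
    proof (cases "a \<in> H")
      case a: True
      show ?thesis
      proof (cases "b \<in> H")
        case b: True
        show ?thesis
        proof (cases "c \<in> H")
          case True
          then show ?thesis using w a b H_m_closed by blast
        next
          case False
          then obtain k where k: "k \<in> K" "c = x \<cdot> k" using cases abc by blast
          have "w = (a \<cdot> b) \<cdot> x \<cdot> k" unfolding w k(2) using a b k(1) H_carrier Kc x_carrier by (simp add: m_assoc)
          then show ?thesis using DC[of "a \<cdot> b" k] a b KH[OF k(1)] H_m_closed by simp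
        qed
      next
        case False
        then obtain k where k: "k \<in> K" "b = x \<cdot> k" using cases abc by blast
        show ?thesis
        proof (cases "c \<in> H")
          case c: True
          have "w = a \<cdot> x \<cdot> (k \<cdot> c)" unfolding w k(2) using a c k(1) H_carrier Kc x_carrier by (simp add: m_assoc)
          then show ?thesis using DC[of a "k \<cdot> c"] a c KH[OF k(1)] H_m_closed by simp
        next
          case False
          then obtain l where l: "l \<in> K" "c = x \<cdot> l" using cases abc by blast
          have "w = a \<cdot> ?mid k \<cdot> l" unfolding w k(2) l(2) using a k(1) l(1) H_carrier Kc x_carrier by (simp add: m_assoc)
          then show ?thesis using inH[OF k(1)] a KH[OF l(1)] H_m_closed by simp
        qed
      qed
    next
      case False
      then obtain j where j: "j \<in> K" "a = x \<cdot> j" using cases abc by blast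
      show ?thesis
      proof (cases "b \<in> H")
        case b: True
        show ?thesis
        proof (cases "c \<in> H")
          case c: True
          have "w = \<one>\<^bsub>G\<^esub> \<cdot> x \<cdot> (j \<cdot> b \<cdot> c)" unfolding w j(2) using b c j(1) H_carrier Kc x_carrier by (simp add: m_assoc)
          then show ?thesis using DC[of "\<one>\<^bsub>G\<^esub>" "j \<cdot> b \<cdot> c"] b c KH[OF j(1)] H_m_closed H_one by simp
        next
          case False
          then obtain l where l: "l \<in> K" "c = x \<cdot> l" using cases abc by blast
          obtain l' where l': "l' \<in> K" "l' \<cdot> x = x \<cdot> l" using xk[OF l(1)] by blast
          have "w = ?mid (j \<cdot> b \<cdot> l')"
            unfolding w j(2) l(2) l'(2)[symmetric] using b j(1) l'(1) H_carrier Kc x_carrier by (simp add: m_assoc)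
          then show ?thesis using b KH[OF j(1)] KH[OF l'(1)] H_m_closed by blast
        qed
      next
        case False
        then obtain k where k: "k \<in> K" "b = x \<cdot> k" using cases abc by blast
        have ab: "a \<cdot> b = ?mid j \<cdot> k" unfolding k(2) j(2) using j(1) k(1) Kc x_carrier by (simp add: m_assoc)
        have abH: "a \<cdot> b \<in> H" unfolding ab using inH[OF j(1)] KH[OF k(1)] H_m_closed by blast
        show ?thesis
        proof (cases "c \<in> H")
          case c: True
          then show ?thesis using w abH H_m_closed by blast
        next
          case False
          then obtain l where l: "l \<in> K" "c = x \<cdot> l" using cases abc by blast
          have "w = (a \<cdot> b) \<cdot> x \<cdot> l" unfolding w l(2) using l(1) abH H_carrier Kc x_carrier by (simp add: m_assoc)
          then show ?thesis using DC[OF abH KH[OF l(1)]] by simp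
        qed
      qed
    qed
  next
    fix w assume "w \<in> ?L \<union> ?mid ` H"
    then show "w \<in> triple_product G S"
      using triple_product_superset[OF HS xS x_carrier] triple_productI[OF xS _ xS] HS by blast
  qed
  have notin: "?mid h \<notin> ?L" if "h \<in> H - K" for h
  proof -
    have "h \<in> K" if "?mid h \<in> H"
    proof -
      have "?mid h \<cdot> inv\<^bsub>G\<^esub> (x \<cdot> x) \<in> H" using that xx H_m_closed H_inv_closed by blast
      moreover have "?mid h \<cdot> inv\<^bsub>G\<^esub> (x \<cdot> x) = x \<cdot> h \<cdot> inv\<^bsub>G\<^esub> x"
        using \<open>h \<in> H - K\<close> H_carrier x_carrier by (simp add: group_word_simps)
      ultimately show ?thesis using \<open>h \<in> H - K\<close> by (simp add: conj_int_def)
    qed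
    then show ?thesis using that middle_not_in_double_coset[OF xx n m] by blast
  qed
  have "?mid ` K \<subseteq> H" using inH by blast
  then have T': "triple_product G S = ?L \<union> ?mid ` (H - K)" unfolding T using K_subset by blast
  have "card (?mid ` (H - K)) = card (H - K)"
    using H_carrier x_carrier by (intro card_image inj_onI) simp
  also have "\<dots> = 32" using n m card_Diff_subset[OF fin_K K_subset] by simp
  finally have c32: "card (?mid ` (H - K)) = 32" .
  have "?L \<inter> ?mid ` (H - K) = {}" using notin by blast
  then have "card (triple_product G S) = card ?L + 32"
    unfolding T' using fin_H double_coset_finite c32 by (subst card_Un_disjoint) auto
  also have "card ?L = 192" using card_H_Un_double_coset[of 3] n m by simp
  finally show "card (triple_product G S) = 224" by simp
qed

end

lemma (in group) generates_withI:
  assumes "generate G (insert x H) = carrier G" shows "generates_with H x"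
  unfolding generates_with_def
proof (intro allI impI)
  fix L assume L: "subgroup L G" "H \<subseteq> L" "x \<in> L"
  then have "carrier G \<subseteq> L" using generate_subgroup_incl[of "insert x H" L] assms by simp
  then show "L = carrier G" using subgroup.subset[OF L(1)] by blast
qed

text \<open>This is where \<open>\<delta>\<close> comes from: \<open>64 = 2 ^ 6\<close> and \<open>224 = 2 ^ 5 * 7\<close>.\<close>

lemma growth_value_exceptional:
  assumes "\<delta> = (log 2 7 - 1) / 6" shows "real 64 powr (1 + \<delta>) = real 224"
proof -
  have "real 64 = 2 powr 6" by simp
  then have "real 64 powr (1 + \<delta>) = 2 powr (6 * (1 + \<delta>))" by (simp only: powr_powr)
  also have "6 * (1 + \<delta>) = 5 + log 2 7" using assms by simp
  also have "2 powr (5 + log 2 7) = 2 powr 5 * 2 powr (log 2 7)" by (rule powr_add)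
  also have "\<dots> = real 224" by simp
  finally show ?thesis .
qed

context sl2_pair begin

text \<open>The subgroup in the statement is \<open>K\<close>, and its index in \<open>H\<close> is \<open>n / |K|\<close>.\<close>

lemma exceptional_iff:
  "card (rcosets\<^bsub>G\<lparr>carrier := H\<rparr>\<^esub> ((inv\<^bsub>G\<^esub> x <#\<^bsub>G\<^esub> H #>\<^bsub>G\<^esub> x) \<inter> H)) = 3 \<longleftrightarrow> card H = 3 * card K"
proof -
  have "(inv\<^bsub>G\<^esub> x <#\<^bsub>G\<^esub> H #>\<^bsub>G\<^esub> x) \<inter> H = K"
  proof (intro equalityI subsetI)
    fix k assume "k \<in> (inv\<^bsub>G\<^esub> x <#\<^bsub>G\<^esub> H #>\<^bsub>G\<^esub> x) \<inter> H"
    then obtain h where h: "k \<in> H" "h \<in> H" "k = inv\<^bsub>G\<^esub> x \<cdot> h \<cdot> x" by (auto simp: l_coset_def r_coset_def)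
    have "x \<cdot> k \<cdot> inv\<^bsub>G\<^esub> x = h"
      unfolding h(3) using h(2) H_carrier x_carrier by (simp add: group_word_simps)
    then show "k \<in> K" using h by (simp add: conj_int_def)
  next
    fix k assume "k \<in> K"
    then have k: "k \<in> H" "x \<cdot> k \<cdot> inv\<^bsub>G\<^esub> x \<in> H" by (auto simp: conj_int_def)
    have "k = inv\<^bsub>G\<^esub> x \<cdot> (x \<cdot> k \<cdot> inv\<^bsub>G\<^esub> x) \<cdot> x"
      using k(1) H_carrier x_carrier by (simp add: group_word_simps)
    then show "k \<in> (inv\<^bsub>G\<^esub> x <#\<^bsub>G\<^esub> H #>\<^bsub>G\<^esub> x) \<inter> H"
      using k unfolding l_coset_def r_coset_def by blast
  qed
  moreover have "card (rcosets\<^bsub>G\<lparr>carrier := H\<rparr>\<^esub> K) * card K = card H"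
  proof -
    interpret HH: group "G\<lparr>carrier := H\<rparr>" using subgroup_imp_group[OF sub_H] .
    show ?thesis using HH.lagrange[OF subgroup_incl[OF sub_K sub_H K_subset]] by (simp add: order_def)
  qed
  moreover obtain k where "card K \<ge> 1" by (rule index_K)
  ultimately show ?thesis by (metis mult_cancel2 not_one_le_zero)
qed

end

section \<open>An example in SL(2,17)\<close>

text \<open>If a subgroup stabilises a finite set with the element 1 by left multiplication, then it is contained in
  that set. This shows that 48 explicit matrices form a group once they are closed under
  multiplication by three generators.\<close>

lemma (in group) left_stabiliser_subgroup:
  assumes "finite L" "L \<subseteq> carrier G" shows "subgroup {g \<in> carrier G. \<forall>l\<in>L. g \<otimes> l \<in> L} G"
proof (rule subgroupI)
  let ?T = "{g \<in> carrier G. \<forall>l\<in>L. g \<otimes> l \<in> L}"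
  have "\<one> \<in> ?T" using assms(2) by auto
  then show "?T \<noteq> {}" by blast
  show "inv g \<in> ?T" if g: "g \<in> ?T" for g
  proof -
    have "(\<lambda>l. g \<otimes> l) ` L = L"
    proof (rule card_subset_eq[OF assms(1)])
      show "(\<lambda>l. g \<otimes> l) ` L \<subseteq> L" using g by blast
      show "card ((\<lambda>l. g \<otimes> l) ` L) = card L"
        using g assms(2) by (intro card_image inj_onI) (auto simp: subset_eq)
    qed
    then have "inv g \<otimes> l \<in> L" if l: "l \<in> L" for l
    proof -
      have "l \<in> (\<lambda>l. g \<otimes> l) ` L" using l \<open>(\<lambda>l. g \<otimes> l) ` L = L\<close> by simp
      then obtain l' where "l' \<in> L" "l = g \<otimes> l'" by blast
      then show ?thesis using g assms(2) by (auto simp: inv_mult_cancel)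
    qed
    then show ?thesis using g by simp
  qed
  show "g \<otimes> h \<in> ?T" if "g \<in> ?T" "h \<in> ?T" for g h
    using that assms(2) by (auto simp: m_assoc subset_eq)
qed auto

text \<open>Matrices modulo 17 as quadruples of residues, for explicit computation.\<close>

type_synonym quad = "int \<times> int \<times> int \<times> int"

fun quad_mult :: "quad \<Rightarrow> quad \<Rightarrow> quad" where
  "quad_mult (a, b, c, d) (a', b', c', d') =
    ((a * a' + b * c') mod 17, (a * b' + b * d') mod 17, (c * a' + d * c') mod 17, (c * b' + d * d') mod 17)"

fun quad_matrix :: "quad \<Rightarrow> int^2^2" where
  "quad_matrix (a, b, c, d) = mat2 17 a b c d"

text \<open>Modulo 17 the element 2 has order 8 with inverse 9, and 3 has order 16 with inverse 6. So the diagonal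
  matrix \<open>quad_d\<close> and the antidiagonal \<open>quad_j\<close> generate a generalised quaternion group of order 16, which
  is a Sylow 2-subgroup of the binary octahedral group. With the quaternion units \<open>i = quad_d\<^sup>2\<close>,
  \<open>j = quad_j\<close> and \<open>k = i j\<close>, the element \<open>quad_w = (-1 + i + j + k) / 2\<close> of order 3 completes the generators.
  The diagonal matrix \<open>quad_x\<close> normalises the quaternion group, and its square is the inverse of \<open>quad_d\<close>.\<close>

definition quad_d :: quad where "quad_d = (2, 0, 0, 9)"
definition quad_j :: quad where "quad_j = (0, 1, 16, 0)"
definition quad_w :: quad where "quad_w = (10, 11, 10, 6)"
definition quad_x :: quad where "quad_x = (3, 0, 0, 6)"

fun quad_power :: "quad \<Rightarrow> nat \<Rightarrow> quad" where
  "quad_power s 0 = (1, 0, 0, 1)"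
| "quad_power s (Suc n) = quad_mult s (quad_power s n)"

definition quad_products :: "nat list \<Rightarrow> nat list \<Rightarrow> nat list \<Rightarrow> quad list" where
  "quad_products as bs cs =
    [quad_mult (quad_power quad_d a) (quad_mult (quad_power quad_j b) (quad_power quad_w c)).
     a \<leftarrow> as, b \<leftarrow> bs, c \<leftarrow> cs]"

definition octahedral_quads :: "quad list" where
  "octahedral_quads = quad_products [0..<8] [0..<2] [0..<3]"

lemma octahedral_quadsD:
  assumes "l \<in> set octahedral_quads"
  shows "\<exists>a b c. l = quad_mult (quad_power quad_d a) (quad_mult (quad_power quad_j b) (quad_power quad_w c))"
proof -
  have "\<exists>a b c. l = quad_mult (quad_power quad_d a) (quad_mult (quad_power quad_j b) (quad_power quad_w c))"
    if "l \<in> set (quad_products as bs cs)" for as bs cs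
    using that by (auto simp: quad_products_def)
  then show ?thesis using assms unfolding octahedral_quads_def by blast
qed

definition reduced_unit :: "quad \<Rightarrow> bool" where
  "reduced_unit = (\<lambda>(a, b, c, d). 0 \<le> a \<and> a < 17 \<and> 0 \<le> b \<and> b < 17 \<and> 0 \<le> c \<and> c < 17 \<and> 0 \<le> d \<and> d < 17 \<and>
     (a * d - b * c) mod 17 = 1)"

lemma quads_distinct: "distinct octahedral_quads \<and> length octahedral_quads = 48 \<and> list_all reduced_unit octahedral_quads"
  by code_simp

lemma quads_closed:
  "list_all (\<lambda>g. list_all (\<lambda>l. List.member octahedral_quads (quad_mult g l)) octahedral_quads)
    [quad_d, quad_j, quad_w]"
  by code_simp

text \<open>The quadruple \<open>(6, 0, 0, 3)\<close> is the inverse of \<open>quad_x\<close>, so these are the elements that \<open>quad_x\<close> conjugates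
  back into the group.\<close>

lemma quads_conj_int:
  "length (filter (\<lambda>l. List.member octahedral_quads (quad_mult (quad_mult quad_x l) (6, 0, 0, 3))) octahedral_quads) = 16"
  by code_simp

lemma quads_members:
  "List.member octahedral_quads (1, 0, 0, 1) \<and> List.member octahedral_quads (quad_mult quad_x quad_x) \<and>
   \<not> List.member octahedral_quads quad_x"
  by code_simp

text \<open>A transvection as a word in the generators, which together with \<open>quad_w\<close> forces the generated group to
  be \<open>SL(2,17)\<close>.\<close>

lemma quads_transvection:
  "foldr quad_mult [quad_j, quad_w, quad_x, quad_w, quad_x, quad_w, quad_x, quad_w, quad_w] (1, 0, 0, 1) = (1, 8, 0, 1)"
  by code_simp

definition octahedral17 :: "(int^2^2) set" where
  "octahedral17 = quad_matrix ` set octahedral_quads"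

interpretation SL17: sl2 17
  by unfold_locales (auto simp: prime_nat_numeral_eq)

lemma quad_matrix_mult:
  "quad_matrix (quad_mult s t) = quad_matrix s \<otimes>\<^bsub>SL2 17\<^esub> quad_matrix t"
  by (cases s; cases t) (simp add: mat2_mult mat2_eq_iff cong_def)

lemma quad_matrix_inj: "inj_on quad_matrix {s. reduced_unit s}"
  by (rule inj_onI) (auto simp: reduced_unit_def mat2_eq_iff cong_def)

lemma reduced_octahedral: "l \<in> set octahedral_quads \<Longrightarrow> reduced_unit l"
  using quads_distinct by (simp add: list_all_iff)

lemma reduced_carrier: "reduced_unit s \<Longrightarrow> quad_matrix s \<in> carrier (SL2 17)"
  by (auto simp: reduced_unit_def SL17.carrier_iff simp flip: mod_eq_dvd_iff)

lemma octahedral17_carrier: "octahedral17 \<subseteq> carrier (SL2 17)"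
  using reduced_octahedral reduced_carrier by (auto simp: octahedral17_def)

lemma card_octahedral17: "card octahedral17 = 48"
proof -
  have "card octahedral17 = card (set octahedral_quads)"
    unfolding octahedral17_def using reduced_octahedral
    by (intro card_image inj_on_subset[OF quad_matrix_inj]) auto
  then show ?thesis using quads_distinct distinct_card by metis
qed

lemma quad_matrix_octahedral_iff:
  assumes "reduced_unit s" shows "quad_matrix s \<in> octahedral17 \<longleftrightarrow> List.member octahedral_quads s"
proof -
  have "set octahedral_quads \<subseteq> {s. reduced_unit s}" using reduced_octahedral by blast
  from inj_on_image_mem_iff[OF quad_matrix_inj _ this] show ?thesis
    unfolding octahedral17_def List.member_iff using assms by blast
qed

lemma reduced_gens: "reduced_unit quad_d" "reduced_unit quad_j" "reduced_unit quad_w" "reduced_unit quad_x"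
  by (simp_all add: reduced_unit_def quad_d_def quad_j_def quad_w_def quad_x_def)

lemma reduced_mult: assumes "reduced_unit s" "reduced_unit t" shows "reduced_unit (quad_mult s t)"
proof -
  obtain a b c d where s: "s = (a, b, c, d)" by (cases s)
  obtain a' b' c' d' where t: "t = (a', b', c', d')" by (cases t)
  have "quad_matrix (quad_mult s t) \<in> carrier (SL2 17)"
    unfolding quad_matrix_mult using reduced_carrier assms by blast
  then have "((a * a' + b * c') mod 17 * ((c * b' + d * d') mod 17) -
    (a * b' + b * d') mod 17 * ((c * a' + d * c') mod 17)) mod 17 = 1"
    unfolding s t by (simp add: SL17.carrier_iff flip: mod_eq_dvd_iff)
  then show ?thesis unfolding s t by (simp add: reduced_unit_def)
qed

lemma subgroup_octahedral17: "subgroup octahedral17 (SL2 17)"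
proof -
  let ?gens = "quad_matrix ` {quad_d, quad_j, quad_w}"
  have gc: "?gens \<subseteq> carrier (SL2 17)" using reduced_carrier reduced_gens by auto
  let ?H = "generate (SL2 17) ?gens"
  have sub: "subgroup ?H (SL2 17)" using SL17.generate_is_subgroup[OF gc] .
  let ?T = "{g \<in> carrier (SL2 17). \<forall>l\<in>octahedral17. g \<otimes>\<^bsub>SL2 17\<^esub> l \<in> octahedral17}"
  have subT: "subgroup ?T (SL2 17)"
    using SL17.left_stabiliser_subgroup[OF _ octahedral17_carrier] card_octahedral17
    by (metis card.infinite zero_neq_numeral)
  have one: "\<one>\<^bsub>SL2 17\<^esub> \<in> octahedral17"
    using quads_members quad_matrix_octahedral_iff[of "(1, 0, 0, 1)"] by (simp add: SL17.one_M reduced_unit_def)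
  have "?gens \<subseteq> ?T"
  proof
    fix g assume "g \<in> ?gens"
    then obtain s where s: "s \<in> {quad_d, quad_j, quad_w}" "g = quad_matrix s" by blast
    have "quad_matrix (quad_mult s l) \<in> octahedral17" if "l \<in> set octahedral_quads" for l
      using quads_closed s(1) that by (auto simp: octahedral17_def list_all_iff List.member_iff)
    then show "g \<in> ?T" using s gc by (auto simp: octahedral17_def quad_matrix_mult)
  qed
  then have HT: "?H \<subseteq> ?T" by (rule SL17.generate_subgroup_incl[OF _ subT])
  have "?H \<subseteq> octahedral17"
  proof
    fix h assume "h \<in> ?H"
    then have "h \<otimes>\<^bsub>SL2 17\<^esub> \<one>\<^bsub>SL2 17\<^esub> \<in> octahedral17" "h \<in> carrier (SL2 17)" using HT one by auto
    then show "h \<in> octahedral17" by simp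
  qed
  moreover have "octahedral17 \<subseteq> ?H"
  proof -
    have pw: "quad_matrix (quad_power s n) \<in> ?H" if "s \<in> {quad_d, quad_j, quad_w}" for s n
    proof (induction n)
      case 0 then show ?case using subgroup.one_closed[OF sub] by (simp add: SL17.one_M)
    next
      case (Suc n)
      have "quad_matrix s \<in> ?H" using that by (blast intro: generate.incl)
      then show ?case using Suc subgroup.m_closed[OF sub] by (simp add: quad_matrix_mult)
    qed
    show ?thesis
    proof
      fix h assume "h \<in> octahedral17"
      then obtain l where l: "l \<in> set octahedral_quads" "h = quad_matrix l" unfolding octahedral17_def by blast
      obtain a b c where "l = quad_mult (quad_power quad_d a) (quad_mult (quad_power quad_j b) (quad_power quad_w c))"
        using octahedral_quadsD[OF l(1)] by blast
      then have "h = quad_matrix (quad_power quad_d a) \<otimes>\<^bsub>SL2 17\<^esub>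
        (quad_matrix (quad_power quad_j b) \<otimes>\<^bsub>SL2 17\<^esub> quad_matrix (quad_power quad_w c))"
        using l(2) by (simp only: quad_matrix_mult)
      then show "h \<in> ?H" using subgroup.m_closed[OF sub] pw by simp
    qed
  qed
  ultimately show ?thesis using sub by (simp add: subset_antisym)
qed

lemma sl2_pair_17: "sl2_pair 17 octahedral17 (quad_matrix quad_x)"
  unfolding sl2_pair_def sl2_pair_axioms_def
proof (intro conjI)
  let ?x = "quad_matrix quad_x"
  have xH: "?x \<notin> octahedral17" using quads_members quad_matrix_octahedral_iff reduced_gens by blast
  show xc: "?x \<in> carrier (SL2 17)" using reduced_carrier reduced_gens by blast
  then show "octahedral17 \<noteq> carrier (SL2 17)" using xH by blast
  show "SL17.generates_with octahedral17 ?x"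
    unfolding SL17.generates_with_def
  proof (intro allI impI)
    fix L assume L: "subgroup L (SL2 17)" "octahedral17 \<subseteq> L" "?x \<in> L"
    have gens: "quad_matrix s \<in> L" if "s \<in> {quad_j, quad_w, quad_x}" for s
    proof -
      have "quad_matrix (quad_mult s (1, 0, 0, 1)) \<in> octahedral17" if "s \<in> {quad_j, quad_w}"
        using quads_closed quads_members that by (auto simp: octahedral17_def list_all_iff List.member_iff)
      moreover have "quad_mult s (1, 0, 0, 1) = s" if "s \<in> {quad_j, quad_w}"
        using that by (auto simp: quad_j_def quad_w_def)
      ultimately show ?thesis using L that by auto
    qed
    have "quad_matrix (foldr quad_mult ss (1, 0, 0, 1)) \<in> L" if "set ss \<subseteq> {quad_j, quad_w, quad_x}" for ss
      using that
    proof (induction ss)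
      case Nil then show ?case using subgroup.one_closed[OF L(1)] by (simp add: SL17.one_M)
    next
      case (Cons s ss)
      then show ?case using gens subgroup.m_closed[OF L(1)] by (simp add: quad_matrix_mult)
    qed
    from this[of "[quad_j, quad_w, quad_x, quad_w, quad_x, quad_w, quad_x, quad_w, quad_w]"]
    have "mat2 17 1 8 0 1 \<in> L" unfolding quads_transvection by simp
    moreover have "mat2 17 10 11 10 6 \<in> L" using gens[of quad_w] by (simp add: quad_w_def)
    ultimately show "L = carrier (SL2 17)" using SL17.subgroup_eq_carrier[OF L(1)] by simp
  qed
qed (use subgroup_octahedral17 SL17.sl2_axioms in auto)

lemma exceptional_example:
  obtains H x S where "subgroup_plus_coset_core (SL2 17) H x S" "generate (SL2 17) S = carrier (SL2 17)"
    "card S = 64" "card (triple_product (SL2 17) S) = 224"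
proof -
  let ?H = octahedral17 and ?x = "quad_matrix quad_x"
  interpret X: sl2_pair 17 ?H ?x by (rule sl2_pair_17)
  let ?S = "?H \<union> coset_core (SL2 17) ?H ?x"
  have xx: "?x \<otimes>\<^bsub>SL2 17\<^esub> ?x \<in> ?H"
    using quads_members quad_matrix_octahedral_iff[OF reduced_mult[OF reduced_gens(4,4)]] by (simp add: quad_matrix_mult)
  have xi: "inv\<^bsub>SL2 17\<^esub> ?x = quad_matrix (6, 0, 0, 3)"
    by (simp add: quad_x_def SL17.inv_M)
  have K: "SL17.conj_int ?H ?x = quad_matrix `
    set (filter (\<lambda>l. List.member octahedral_quads (quad_mult (quad_mult quad_x l) (6, 0, 0, 3))) octahedral_quads)"
  proof -
    have "?x \<otimes>\<^bsub>SL2 17\<^esub> quad_matrix l \<otimes>\<^bsub>SL2 17\<^esub> inv\<^bsub>SL2 17\<^esub> ?x \<in> ?H \<longleftrightarrow>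
      List.member octahedral_quads (quad_mult (quad_mult quad_x l) (6, 0, 0, 3))" if "l \<in> set octahedral_quads" for l
    proof -
      have "reduced_unit (6, 0, 0, 3)" by (simp add: reduced_unit_def)
      then have "reduced_unit (quad_mult (quad_mult quad_x l) (6, 0, 0, 3))"
        using reduced_mult reduced_gens(4) reduced_octahedral[OF that] by blast
      from quad_matrix_octahedral_iff[OF this] show ?thesis by (simp only: quad_matrix_mult xi)
    qed
    then have "{l \<in> set octahedral_quads. ?x \<otimes>\<^bsub>SL2 17\<^esub> quad_matrix l \<otimes>\<^bsub>SL2 17\<^esub> inv\<^bsub>SL2 17\<^esub> ?x \<in> ?H} =
      set (filter (\<lambda>l. List.member octahedral_quads (quad_mult (quad_mult quad_x l) (6, 0, 0, 3))) octahedral_quads)"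
      unfolding set_filter by blast
    moreover have "SL17.conj_int ?H ?x = quad_matrix `
      {l \<in> set octahedral_quads. ?x \<otimes>\<^bsub>SL2 17\<^esub> quad_matrix l \<otimes>\<^bsub>SL2 17\<^esub> inv\<^bsub>SL2 17\<^esub> ?x \<in> ?H}"
      unfolding SL17.conj_int_def by (subst octahedral17_def) blast
    ultimately show ?thesis by simp
  qed
  have cK: "card (SL17.conj_int ?H ?x) = 16"
  proof -
    let ?F = "filter (\<lambda>l. List.member octahedral_quads (quad_mult (quad_mult quad_x l) (6, 0, 0, 3))) octahedral_quads"
    have "card (SL17.conj_int ?H ?x) = card (set ?F)"
      unfolding K using reduced_octahedral by (intro card_image inj_on_subset[OF quad_matrix_inj]) auto
    also have "\<dots> = length ?F" using quads_distinct by (intro distinct_card) simp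
    finally show ?thesis using quads_conj_int by simp
  qed
  have Sc: "?S \<subseteq> carrier (SL2 17)" using X.H_carrier X.coset_core_carrier by blast
  have gS: "L = carrier (SL2 17)" if "subgroup L (SL2 17)" "insert ?x ?H \<subseteq> L" for L
    using X.gen that unfolding SL17.generates_with_def by blast
  have incl: "W \<subseteq> generate (SL2 17) W" for W by (auto intro: generate.incl)
  have xS: "insert ?x ?H \<subseteq> ?S" using X.x_in_coset_core by blast
  have gen: "generate (SL2 17) ?S = carrier (SL2 17)"
    by (rule gS[OF SL17.generate_is_subgroup[OF Sc] order_trans[OF xS incl]])
  have "insert ?x ?H \<subseteq> carrier (SL2 17)" using X.x_carrier X.H_carrier by blast
  then have "generate (SL2 17) (insert ?x ?H) = carrier (SL2 17)"
    using gS[OF SL17.generate_is_subgroup incl] by simp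
  then have "subgroup_plus_coset_core (SL2 17) ?H ?x ?S"
    unfolding subgroup_plus_coset_core_def using X.sub_H X.proper X.x_carrier xx by (simp add: numeral_2_eq_2)
  then show ?thesis using that[OF _ gen] X.exceptional_counts[OF xx refl card_octahedral17 cK] by simp
qed

section \<open>The smallest growth exponent\<close>

lemma growth_exponent_bounds:
  assumes "card S \<ge> 2" "\<delta> = (log 2 7 - 1) / 6"
  shows "real (card S) powr (1 + \<delta>) \<le> real (card (triple_product G S)) \<Longrightarrow> \<delta> \<le> growth_exponent G S"
    and "real (card (triple_product G S)) = real (card S) powr (1 + \<delta>) \<Longrightarrow> growth_exponent G S = \<delta>"
    and "real (card S) powr (1 + \<delta>) < real (card (triple_product G S)) \<Longrightarrow> \<delta> < growth_exponent G S"
proof -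
  let ?y = "real (card S)" and ?X = "real (card (triple_product G S))"
  have y: "?y > 0" "ln ?y > 0" using assms(1) by simp_all
  have pos: "?y powr (1 + \<delta>) > 0" using y by simp
  have ln: "ln (?y powr (1 + \<delta>)) = (1 + \<delta>) * ln ?y" using y by (simp add: ln_powr)
  show "\<delta> \<le> growth_exponent G S" if "?y powr (1 + \<delta>) \<le> ?X"
  proof -
    have "ln (?y powr (1 + \<delta>)) \<le> ln ?X" using that pos by (subst ln_le_cancel_iff) linarith+
    then have "(1 + \<delta>) * ln ?y \<le> ln ?X" by (simp only: ln)
    then show ?thesis using y(2) by (simp add: growth_exponent_def le_diff_eq pos_le_divide_eq add.commute)
  qed
  show "growth_exponent G S = \<delta>" if "?X = ?y powr (1 + \<delta>)"
    using y(2) by (simp add: growth_exponent_def that ln)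
  show "\<delta> < growth_exponent G S" if "?y powr (1 + \<delta>) < ?X"
  proof -
    have "ln (?y powr (1 + \<delta>)) < ln ?X" using that pos by (subst ln_less_cancel_iff) linarith+
    then have "(1 + \<delta>) * ln ?y < ln ?X" by (simp only: ln)
    then show ?thesis using y(2) by (simp add: growth_exponent_def less_diff_eq pos_less_divide_eq add.commute)
  qed
qed

lemma sl2_pairI:
  assumes "prime p" "p \<ge> 5" "subgroup_plus_two (SL2 p) H x S \<or> subgroup_plus_coset_core (SL2 p) H x S"
  shows "sl2_pair p H x"
proof -
  interpret sl2 p using assms by unfold_locales
  have "subgroup H G" "H \<noteq> carrier G" "x \<in> carrier G" "generate G (insert x H) = carrier G"
    using assms(3) by (auto simp: subgroup_plus_two_def subgroup_plus_coset_core_def)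
  then show ?thesis
    unfolding sl2_pair_def sl2_pair_axioms_def using sl2_axioms generates_withI by blast
qed

context sl2_pair begin

lemma card_plus_two_less:
  assumes "S = H \<union> {x, inv\<^bsub>G\<^esub> x}" "\<delta> = (log 2 7 - 1) / 6"
  shows "real (card S) powr (1 + \<delta>) < real (card (triple_product G S))"
proof (rule powr_less_of_power_less[OF assms(2) _ plus_two_power[OF assms(1)]])
  have "card H \<le> card S" using assms(1) fin_H by (intro card_mono) auto
  then show "card S \<ge> 1" using card_H_ge_3 by simp
qed

lemma card_coset_core_less:
  assumes "x \<cdot> x \<in> H" "S = H \<union> coset_core G H x" "\<not> (card H = 48 \<and> card K = 16)"
    and "\<delta> = (log 2 7 - 1) / 6"
  shows "real (card S) powr (1 + \<delta>) < real (card (triple_product G S))"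
proof (rule powr_less_of_power_less[OF assms(4) _ coset_core_power[OF assms(1-3)]])
  have "finite (coset_core G H x)" unfolding coset_core_eq using fin_K by blast
  then have "card H \<le> card S" using assms(2) fin_H by (intro card_mono) auto
  then show "card S \<ge> 1" using card_H_ge_3 by simp
qed

lemma card_coset_core_eq:
  assumes "x \<cdot> x \<in> H" "S = H \<union> coset_core G H x" "card H = 48" "card K = 16"
    and "\<delta> = (log 2 7 - 1) / 6"
  shows "real (card (triple_product G S)) = real (card S) powr (1 + \<delta>)"
  unfolding exceptional_counts[OF assms(1-4)] by (rule growth_value_exceptional[OF assms(5), symmetric])

lemma card_48_octahedral:
  assumes "card H = 48" "card K = 16" shows "iso_2S4 p (G\<lparr>carrier := H\<rparr>)"
proof -
  from pair_cases obtain k where k: "card H = k * card K" "k \<ge> 2" "card K \<ge> 1"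
    "(5 \<le> k \<and> card H \<le> k\<^sup>2) \<or> card K \<le> 8 \<or> card H \<in> {12, 24} \<or>
     (card H = 48 \<and> (\<exists>a. octahedral_subgroup p H a)) \<or> (card H \<in> {60, 120} \<and> k \<noteq> 3 \<and> k \<noteq> 4)"
    .
  have "\<exists>a. octahedral_subgroup p H a" using k(1,4) assms by auto
  then obtain a where "octahedral_subgroup p H a" ..
  then show ?thesis by (rule octahedral_subgroup.octahedral_iso)
qed

text \<open>The value \<open>1 + \<delta>\<close> is exceeded except in the exceptional case, where it is attained.\<close>

lemma growth_dichotomy:
  assumes S: "subgroup_plus_two G H x S \<or> subgroup_plus_coset_core G H x S" and \<delta>: "\<delta> = (log 2 7 - 1) / 6"
  shows "real (card S) powr (1 + \<delta>) < real (card (triple_product G S)) \<or>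
    (real (card (triple_product G S)) = real (card S) powr (1 + \<delta>) \<and>
     x \<cdot> x \<in> H \<and> S = H \<union> coset_core G H x \<and> card H = 48 \<and> card K = 16)"
  using S
proof
  assume "subgroup_plus_two G H x S"
  then show ?thesis using card_plus_two_less[OF _ \<delta>] by (simp add: subgroup_plus_two_def)
next
  assume "subgroup_plus_coset_core G H x S"
  then have "x \<cdot> x \<in> H" "S = H \<union> coset_core G H x"
    using x_carrier by (auto simp: subgroup_plus_coset_core_def numeral_2_eq_2)
  then show ?thesis
    using card_coset_core_less[OF _ _ _ \<delta>] card_coset_core_eq[OF _ _ _ _ \<delta>] by blast
qed

lemma card_S_ge_2:
  assumes "subgroup_plus_two G H x S \<or> subgroup_plus_coset_core G H x S" shows "card S \<ge> 2"
proof -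
  have "finite (coset_core G H x)" unfolding coset_core_eq using fin_K by blast
  then have "finite S" "H \<subseteq> S"
    using assms fin_H by (auto simp: subgroup_plus_two_def subgroup_plus_coset_core_def)
  then have "card H \<le> card S" by (rule card_mono)
  then show ?thesis using card_H_ge_3 by simp
qed

end

lemma growth_exponents_minimum:
  assumes "\<delta> = (log 2 7 - 1) / 6"
  shows "\<delta> \<in> growth_exponents" "\<And>v. v \<in> growth_exponents \<Longrightarrow> \<delta> \<le> v"
proof -
  obtain H x S where ex: "subgroup_plus_coset_core (SL2 17) H x S" "generate (SL2 17) S = carrier (SL2 17)"
    "card S = 64" "card (triple_product (SL2 17) S) = 224" by (rule exceptional_example)
  have eq: "real (card (triple_product (SL2 17) S)) = real (card S) powr (1 + \<delta>)"
    unfolding ex(3,4) by (rule growth_value_exceptional[OF assms, symmetric])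
  have "card S \<ge> 2" using ex(3) by simp
  from growth_exponent_bounds(2)[OF this assms eq] have "growth_exponent (SL2 17) S = \<delta>" .
  moreover have "growth_exponent (SL2 17) S \<in> growth_exponents"
    unfolding growth_exponents_def using ex(1,2) SL17.prime_p
    by (intro CollectI exI[of _ 17] exI[of _ H] exI[of _ x] exI[of _ S]) simp
  ultimately show "\<delta> \<in> growth_exponents" by simp
  fix v assume "v \<in> growth_exponents"
  then obtain p H x S where v: "v = growth_exponent (SL2 p) S" "prime p" "p \<ge> 5"
    and S: "subgroup_plus_two (SL2 p) H x S \<or> subgroup_plus_coset_core (SL2 p) H x S"
    unfolding growth_exponents_def by blast
  interpret sl2_pair p H x using sl2_pairI[OF v(2,3) S] .
  show "\<delta> \<le> v" unfolding v(1)
    by (rule growth_exponent_bounds(1)[OF card_S_ge_2[OF S] assms]) (use growth_dichotomy[OF S assms] in linarith)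
qed

theorem corollary6p5:
  fixes p :: nat and H S :: "(int^2^2) set" and x :: "int^2^2" and \<delta> :: real
  assumes "prime p" and "p \<ge> 5"
    and "subgroup_plus_two (SL2 p) H x S \<or> subgroup_plus_coset_core (SL2 p) H x S"
    and "generate (SL2 p) S = carrier (SL2 p)"
    and "\<delta> = (log 2 7 - 1) / 6"
  shows "real (card (triple_product (SL2 p) S)) \<ge> real (card S) powr (1 + \<delta>)
    \<and> (real (card (triple_product (SL2 p) S)) = real (card S) powr (1 + \<delta>) \<longleftrightarrow>
         iso_2S4 p (SL2 p\<lparr>carrier := H\<rparr>) \<and>
         x [^]\<^bsub>SL2 p\<^esub> (2::nat) \<in> H \<and>
         card (rcosets\<^bsub>SL2 p\<lparr>carrier := H\<rparr>\<^esub> ((inv\<^bsub>SL2 p\<^esub> x <#\<^bsub>SL2 p\<^esub> H #>\<^bsub>SL2 p\<^esub> x) \<inter> H)) = 3 \<and>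
         S = H \<union> coset_core (SL2 p) H x)
    \<and> (subgroup_plus_two (SL2 p) H x S \<longrightarrow>
         real (card (triple_product (SL2 p) S)) \<noteq> real (card S) powr (1 + \<delta>) \<and>
         (\<exists>m\<in>growth_exponents. (\<forall>v\<in>growth_exponents. m \<le> v) \<and>
            growth_exponent (SL2 p) S \<noteq> m))"
proof -
  let ?y = "real (card S)" and ?X = "real (card (triple_product (SL2 p) S))"
  note S = assms(3) and \<delta> = assms(5)
  interpret sl2_pair p H x using sl2_pairI[OF assms(1-3)] .
  have pow: "x [^]\<^bsub>G\<^esub> (2::nat) = x \<cdot> x" using x_carrier by (simp add: numeral_2_eq_2)
  let ?R = "iso_2S4 p (SL2 p\<lparr>carrier := H\<rparr>) \<and> x [^]\<^bsub>SL2 p\<^esub> (2::nat) \<in> H \<and>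
    card (rcosets\<^bsub>SL2 p\<lparr>carrier := H\<rparr>\<^esub> ((inv\<^bsub>SL2 p\<^esub> x <#\<^bsub>SL2 p\<^esub> H #>\<^bsub>SL2 p\<^esub> x) \<inter> H)) = 3 \<and>
    S = H \<union> coset_core (SL2 p) H x"
  have bound: "?X \<ge> ?y powr (1 + \<delta>)" using growth_dichotomy[OF S \<delta>] by linarith
  have equality: "?X = ?y powr (1 + \<delta>) \<longleftrightarrow> ?R"
  proof
    assume "?X = ?y powr (1 + \<delta>)"
    then have *: "x \<cdot> x \<in> H" "S = H \<union> coset_core G H x" "card H = 48" "card K = 16"
      using growth_dichotomy[OF S \<delta>] by auto
    then show ?R using card_48_octahedral exceptional_iff pow by simp
  next
    assume R: ?R
    then have "card H = 48" using iso_2S4_card by blast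
    moreover from this have "card K = 16" using R exceptional_iff by simp
    ultimately show "?X = ?y powr (1 + \<delta>)" using R pow card_coset_core_eq[OF _ _ _ _ \<delta>] by simp
  qed
  have "?X \<noteq> ?y powr (1 + \<delta>) \<and>
      (\<exists>m\<in>growth_exponents. (\<forall>v\<in>growth_exponents. m \<le> v) \<and> growth_exponent (SL2 p) S \<noteq> m)"
    if two: "subgroup_plus_two (SL2 p) H x S"
  proof
    have less: "?y powr (1 + \<delta>) < ?X"
      using two card_plus_two_less[OF _ \<delta>] by (simp add: subgroup_plus_two_def)
    then show "?X \<noteq> ?y powr (1 + \<delta>)" by simp
    have "growth_exponent (SL2 p) S \<noteq> \<delta>"
      using growth_exponent_bounds(3)[OF card_S_ge_2[OF S] \<delta> less] by simp
    then show "\<exists>m\<in>growth_exponents. (\<forall>v\<in>growth_exponents. m \<le> v) \<and> growth_exponent (SL2 p) S \<noteq> m"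
      using growth_exponents_minimum[OF \<delta>] by blast
  qed
  then show ?thesis using bound equality by blast
qed

end
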